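(* The cohomology $\mathrm{Ext}_{\Gamma}(\mathbb{F}_3,\mathbb{F}_3)$ of the Hopf algebra $\Gamma$ is given by $$\mathbb{F}_3[v_0,c_6,v_2,\beta]\otimes E(\alpha_1,\alpha_2)/(v_0\alpha_1,\ v_0\alpha_2,\ \alpha_1\alpha_2-v_0\beta),$$ where the generators have the following $(s,t)$-bidegrees ($s$ cohomological, $t$ internal): $|v_0|=(1,1)$, $|\alpha_1|=(1,4)$, $|\alpha_2|=(2,9)$, $|\beta|=(2,12)$, $|c_6|=(3,15)$, $|v_2|=(1,17)$.
   Context: $A_*$ is the mod 3 dual Steenrod algebra with Milnor generators $\xi_n$ ($n\ge 1$, $|\xi_n|=2(3^n-1)$) and $\tau_n$ ($n\ge 0$, $|\tau_n|=2\cdot 3^n-1$); $\zeta_n=\chi\xi_n$ and $\overline{\tau}_n=\chi\tau_n$ are their conjugates. $\Gamma$ is the quotient Hopf algebra $$\Gamma=A_*/(\zeta_1^3,\zeta_n,\overline{\tau}_m\mid n\ge 2,\ m\ge 3)\cong \mathbb{F}_3[\zeta_1]/(\zeta_1^3)\otimes E(\overline{\tau}_0,\overline{\tau}_1,\overline{\tau}_2)$$ with coproduct induced from $A_*$ (so $\zeta_1,\overline{\tau}_0,\overline{\tau}_2$ are primitive and $\psi(\overline{\tau}_1)=\overline{\tau}_1\otimes 1+\overline{\tau}_0\otimes\zeta_1+1\otimes\overline{\tau}_1$). $E(-)$ denotes an exterior algebra over $\mathbb{F}_3$. The name $c_6$ is used for the class detected by $v_1^3$ in the May spectral sequence for $A(1)_*=\mathbb{F}_3[\zeta_1]/(\zeta_1^3)\otimes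 E(\overline{\tau}_0,\overline{\tau}_1)$, where $v_1$ corresponds to $\overline{\tau}_1$. *)

theory Defs
  imports
    "HOL-Algebra.QuotRing"
    "HOL-Library.Poly_Mapping"
    "HOL-Library.Numeral_Type"
    "HOL-Library.FSet"
begin

section \<open>Vector spaces and algebras over the field with three elements\<close>

type_synonym F3 = 3

text \<open>\<open>'b lin\<close> is the \<open>F3\<close>-vector space with basis \<open>'b\<close>.\<close>

type_synonym 'b lin = "'b \<Rightarrow>\<^sub>0 F3"

abbreviation basis :: "'b \<Rightarrow> 'b lin"
  where "basis b \<equiv> Poly_Mapping.single b 1"

definition scale :: "F3 \<Rightarrow> 'b lin \<Rightarrow> 'b lin"
  where "scale c p = Poly_Mapping.map ((*) c) p"

definition extend :: "('b \<Rightarrow> 'c lin) \<Rightarrow> 'b lin \<Rightarrow> 'c lin"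
  where "extend f p = (\<Sum>b\<in>Poly_Mapping.keys p. scale (Poly_Mapping.lookup p b) (f b))"

definition extend2 :: "('a \<Rightarrow> 'b \<Rightarrow> 'c lin) \<Rightarrow> 'a lin \<Rightarrow> 'b lin \<Rightarrow> 'c lin"
  where "extend2 f p q = extend (\<lambda>a. extend (f a) q) p"

definition tens :: "'a lin \<Rightarrow> 'b lin \<Rightarrow> ('a \<times> 'b) lin"
  where "tens = extend2 (\<lambda>a b. basis (a, b))"

text \<open>The algebra with basis \<open>C\<close>, unit \<open>u \<in> C\<close> and multiplication given on basis
  elements by \<open>m\<close>. A unital ring homomorphism between such algebras, or between quotients of
  such algebras by ideals, is automatically \<open>F3\<close>-linear.\<close>

definition basis_algebra :: "'b set \<Rightarrow> ('b \<Rightarrow> 'b \<Rightarrow> 'b lin) \<Rightarrow> 'b \<Rightarrow> 'b lin ring"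
  where "basis_algebra C m u =
    \<lparr>carrier = {p. Poly_Mapping.keys p \<subseteq> C}, mult = extend2 m, one = basis u,
     zero = 0, add = (+)\<rparr>"


section \<open>The algebra \<open>F3[X] \<otimes> E(Y)\<close>\<close>

text \<open>The pair \<open>(e, {|y\<^sub>1 < \<dots> < y\<^sub>k|})\<close> stands for the monomial
  \<open>(\<Prod>x. x ^ e x) \<otimes> y\<^sub>1 \<cdots> y\<^sub>k\<close>.\<close>

type_synonym ('x, 'y) mon = "('x \<Rightarrow>\<^sub>0 nat) \<times> 'y fset"

abbreviation unit_mon :: "('x, 'y) mon"
  where "unit_mon \<equiv> (0, {||})"

definition crossings :: "'y::linorder fset \<Rightarrow> 'y fset \<Rightarrow> nat"
  where "crossings S T = card {(s, t). s |\<in>| S \<and> t |\<in>| T \<and> t < s}"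

fun mon_mult :: "('x, 'y::linorder) mon \<Rightarrow> ('x, 'y) mon \<Rightarrow> ('x, 'y) mon lin"
  where "mon_mult (e, S) (f, T) =
    (if S |\<inter>| T = {||} then Poly_Mapping.single (e + f, S |\<union>| T) ((-1) ^ crossings S T) else 0)"

definition poly_ext :: "('x, 'y::linorder) mon lin ring"
  where "poly_ext = basis_algebra UNIV mon_mult unit_mon"

definition poly_gen :: "'x \<Rightarrow> ('x, 'y) mon lin"
  where "poly_gen x = basis (Poly_Mapping.single x 1, {||})"

definition ext_gen :: "'y \<Rightarrow> ('x, 'y) mon lin"
  where "ext_gen y = basis (0, {|y|})"

fun mon_deg :: "('x \<Rightarrow> nat) \<Rightarrow> ('y \<Rightarrow> nat) \<Rightarrow> ('x, 'y) mon \<Rightarrow> nat"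
  where "mon_deg dx dy (e, S) =
    (\<Sum>x\<in>Poly_Mapping.keys e. Poly_Mapping.lookup e x * dx x) + (\<Sum>y\<in>fset S. dy y)"


section \<open>The dual Steenrod algebra at the prime 3\<close>

text \<open>The polynomial generator with index \<open>n\<close> is \<open>\<xi>\<^sub>n\<^sub>+\<^sub>1\<close>, the exterior generator with index
  \<open>n\<close> is \<open>\<tau>\<^sub>n\<close>.\<close>

type_synonym smon = "(nat, nat) mon"

definition steenrod :: "smon lin ring"
  where "steenrod = poly_ext"

definition sdeg :: "smon \<Rightarrow> nat"
  where "sdeg = mon_deg (\<lambda>n. 2 * (3 ^ (n + 1) - 1)) (\<lambda>n. 2 * 3 ^ n - 1)"

definition xi :: "nat \<Rightarrow> smon lin"
  where "xi n = (if n = 0 then \<one>\<^bsub>steenrod\<^esub> else poly_gen (n - 1))"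

definition tau :: "nat \<Rightarrow> smon lin"
  where "tau n = ext_gen n"

text \<open>The tensor square as an algebra, with the Koszul sign
  \<open>(a \<otimes> b) (c \<otimes> d) = (-1)\<^bsup>|b| |c|\<^esup> ac \<otimes> bd\<close>.\<close>

definition steenrod2 :: "(smon \<times> smon) lin ring"
  where "steenrod2 = basis_algebra UNIV
    (\<lambda>(a, b) (c, d). scale ((-1) ^ (sdeg b * sdeg c)) (tens (mon_mult a c) (mon_mult b d)))
    (unit_mon, unit_mon)"

definition psi_xi :: "nat \<Rightarrow> (smon \<times> smon) lin"
  where "psi_xi n = (\<Sum>i\<le>n. tens (xi (n - i) [^]\<^bsub>steenrod\<^esub> ((3::nat) ^ i)) (xi i))"

definition psi_tau :: "nat \<Rightarrow> (smon \<times> smon) lin"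
  where "psi_tau n = tens (tau n) \<one>\<^bsub>steenrod\<^esub>
    + (\<Sum>i\<le>n. tens (xi (n - i) [^]\<^bsub>steenrod\<^esub> ((3::nat) ^ i)) (tau i))"

text \<open>The coproduct is the algebra homomorphism with the above values on the generators.\<close>

fun psi_mon :: "smon \<Rightarrow> (smon \<times> smon) lin"
  where "psi_mon (e, S) =
    foldr (\<otimes>\<^bsub>steenrod2\<^esub>)
      (map (\<lambda>n. psi_xi (n + 1) [^]\<^bsub>steenrod2\<^esub> Poly_Mapping.lookup e n)
        (sorted_list_of_set (Poly_Mapping.keys e)) @ map psi_tau (sorted_list_of_fset S))
      \<one>\<^bsub>steenrod2\<^esub>"

definition psi :: "smon lin \<Rightarrow> (smon \<times> smon) lin"
  where "psi = extend psi_mon"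

text \<open>The conjugates \<open>\<chi> \<xi>\<^sub>n\<close> and \<open>\<chi> \<tau>\<^sub>n\<close> are determined by applying the
  defining property \<open>\<mu> \<circ> (1 \<otimes> \<chi>) \<circ> \<psi> = \<eta> \<circ> \<epsilon>\<close> of the antipode to the generators.\<close>

fun zeta :: "nat \<Rightarrow> smon lin"
  where "zeta n = (if n = 0 then \<one>\<^bsub>steenrod\<^esub>
    else - (\<Sum>i<n. (xi (n - i) [^]\<^bsub>steenrod\<^esub> ((3::nat) ^ i)) \<otimes>\<^bsub>steenrod\<^esub> zeta i))"

fun taubar :: "nat \<Rightarrow> smon lin"
  where "taubar n =
    - tau n - (\<Sum>i<n. (xi (n - i) [^]\<^bsub>steenrod\<^esub> ((3::nat) ^ i)) \<otimes>\<^bsub>steenrod\<^esub> taubar i)"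

declare zeta.simps [simp del] taubar.simps [simp del]

text \<open>The Hopf ideal \<open>I\<close> with \<open>\<Gamma> = A\<^sub>* / I\<close>.\<close>

definition Gamma_ideal :: "smon lin set"
  where "Gamma_ideal = Idl\<^bsub>steenrod\<^esub>
    ({zeta 1 [^]\<^bsub>steenrod\<^esub> (3::nat)} \<union> {zeta n |n. n \<ge> 2} \<union> {taubar m |m. m \<ge> 3})"


section \<open>The cobar complex of \<open>\<Gamma>\<close>\<close>

text \<open>The reduced cobar complex of the coaugmented coalgebra \<open>\<Gamma> = A\<^sub>* / I\<close> is the tensor algebra
  on the coaugmentation coideal of \<open>\<Gamma>\<close>, identified with the augmentation ideal; the
  latter is \<open>V / I\<close> for \<open>V\<close> the augmentation ideal of \<open>A\<^sub>*\<close>, whose basis are the monomials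
  other than 1. The tensor algebra of \<open>V / I\<close> is the quotient of the tensor algebra of \<open>V\<close>, with
  basis the words in these monomials, by the two-sided ideal generated by \<open>I\<close>.\<close>

definition steenrod_tensor :: "smon list lin ring"
  where "steenrod_tensor = basis_algebra (lists (- {unit_mon})) (\<lambda>v w. basis (v @ w)) []"

definition letter :: "smon lin \<Rightarrow> smon list lin"
  where "letter = extend (\<lambda>m. if m = unit_mon then 0 else basis [m])"

definition Gamma_tensor_ideal :: "smon list lin set"
  where "Gamma_tensor_ideal = Idl\<^bsub>steenrod_tensor\<^esub> (letter ` Gamma_ideal)"

definition cobar_Gamma :: "smon list lin set ring"
  where "cobar_Gamma = steenrod_tensor Quot Gamma_tensor_ideal"

text \<open>The differential is \<open>d [a] = \<Sum> (-1)\<^bsup>|a'|\<^esup> [a' | a'']\<close>, where \<open>\<Sum> a' \<otimes> a''\<close> is the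
  reduced coproduct, extended as a derivation with respect to the total degree, in which \<open>[a]\<close>
  has degree \<open>|a| - 1\<close>. With these signs the cohomology is commutative in the graded sense
  for the degree \<open>t - s\<close>, so that \<open>E(\<dots>)\<close> is an exterior algebra in the usual sense and the
  polynomial generators are central.\<close>

definition d_letter :: "smon \<Rightarrow> smon list lin"
  where "d_letter m = extend
    (\<lambda>(a, b). if a = unit_mon \<or> b = unit_mon then 0
      else Poly_Mapping.single [a, b] ((-1) ^ sdeg a)) (psi (basis m))"

fun d_word :: "smon list \<Rightarrow> smon list lin"
  where
    "d_word [] = 0"
  | "d_word (m # w) = d_letter m \<otimes>\<^bsub>steenrod_tensor\<^esub> basis w
      + scale ((-1) ^ (sdeg m + 1)) (basis [m] \<otimes>\<^bsub>steenrod_tensor\<^esub> d_word w)"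

definition d_steenrod :: "smon list lin \<Rightarrow> smon list lin"
  where "d_steenrod = extend d_word"

text \<open>The map induced by \<^const>\<open>d_steenrod\<close> on cosets.\<close>

definition d_Gamma :: "smon list lin set \<Rightarrow> smon list lin set"
  where "d_Gamma X = (\<Union>x\<in>X. Gamma_tensor_ideal +>\<^bsub>steenrod_tensor\<^esub> d_steenrod x)"


section \<open>Cohomology\<close>

definition cocycles :: "('a, 'b) ring_scheme \<Rightarrow> ('a \<Rightarrow> 'a) \<Rightarrow> ('a, 'b) ring_scheme"
  where "cocycles R d = R\<lparr>carrier := {x \<in> carrier R. d x = \<zero>\<^bsub>R\<^esub>}\<rparr>"

definition cohomology :: "('a, 'b) ring_scheme \<Rightarrow> ('a \<Rightarrow> 'a) \<Rightarrow> 'a set ring"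
  where "cohomology R d = cocycles R d Quot (d ` carrier R)"

definition Ext_Gamma :: "smon list lin set set ring"
  where "Ext_Gamma = cohomology cobar_Gamma d_Gamma"

definition cobar_part :: "nat \<Rightarrow> nat \<Rightarrow> smon list lin set set"
  where "cobar_part s t =
    {Gamma_tensor_ideal +>\<^bsub>steenrod_tensor\<^esub> x |x. x \<in> carrier steenrod_tensor \<and>
      (\<forall>w\<in>Poly_Mapping.keys x. length w = s \<and> sum_list (map sdeg w) = t)}"

definition Ext_part :: "nat \<Rightarrow> nat \<Rightarrow> smon list lin set set set"
  where "Ext_part s t =
    {(d_Gamma ` carrier cobar_Gamma) +>\<^bsub>cocycles cobar_Gamma d_Gamma\<^esub> x |x.
      x \<in> carrier (cocycles cobar_Gamma d_Gamma) \<inter> cobar_part s t}"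


section \<open>The bigraded algebra
  \<open>F3[v0, c6, v2, \<beta>] \<otimes> E(\<alpha>1, \<alpha>2) / (v0 \<alpha>1, v0 \<alpha>2, \<alpha>1 \<alpha>2 - v0 \<beta>)\<close>\<close>

datatype poly_name = V0 | C6 | V2 | Beta

datatype ext_name = Alpha1 | Alpha2

instantiation ext_name :: linorder
begin

definition less_eq_ext_name :: "ext_name \<Rightarrow> ext_name \<Rightarrow> bool"
  where "x \<le> y \<longleftrightarrow> x = Alpha1 \<or> y = Alpha2"

definition less_ext_name :: "ext_name \<Rightarrow> ext_name \<Rightarrow> bool"
  where "x < y \<longleftrightarrow> x = Alpha1 \<and> y = Alpha2"

instance
  by standard (auto simp: less_eq_ext_name_def less_ext_name_def intro: ext_name.exhaust)

end

type_synonym pmon = "(poly_name, ext_name) mon"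

definition free_presentation :: "pmon lin ring"
  where "free_presentation = poly_ext"

definition relations :: "pmon lin set"
  where "relations =
    {poly_gen V0 \<otimes>\<^bsub>free_presentation\<^esub> ext_gen Alpha1,
     poly_gen V0 \<otimes>\<^bsub>free_presentation\<^esub> ext_gen Alpha2,
     ext_gen Alpha1 \<otimes>\<^bsub>free_presentation\<^esub> ext_gen Alpha2
       - poly_gen V0 \<otimes>\<^bsub>free_presentation\<^esub> poly_gen Beta}"

definition presentation :: "pmon lin set ring"
  where "presentation = free_presentation Quot (Idl\<^bsub>free_presentation\<^esub> relations)"

fun poly_s :: "poly_name \<Rightarrow> nat"
  where "poly_s V0 = 1" | "poly_s C6 = 3" | "poly_s V2 = 1" | "poly_s Beta = 2"

fun poly_t :: "poly_name \<Rightarrow> nat"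
  where "poly_t V0 = 1" | "poly_t C6 = 15" | "poly_t V2 = 17" | "poly_t Beta = 12"

fun ext_s :: "ext_name \<Rightarrow> nat"
  where "ext_s Alpha1 = 1" | "ext_s Alpha2 = 2"

fun ext_t :: "ext_name \<Rightarrow> nat"
  where "ext_t Alpha1 = 4" | "ext_t Alpha2 = 9"

definition presentation_part :: "nat \<Rightarrow> nat \<Rightarrow> pmon lin set set"
  where "presentation_part s t =
    {(Idl\<^bsub>free_presentation\<^esub> relations) +>\<^bsub>free_presentation\<^esub> p |p.
      \<forall>m\<in>Poly_Mapping.keys p. mon_deg poly_s ext_s m = s \<and> mon_deg poly_t ext_t m = t}"


section \<open>The algebras above are rings\<close>

text \<open>Consequently the generated ideals and quotient rings above have their usual meaning.\<close>

lemma lookup_scale: "Poly_Mapping.lookup (scale c p) b = c * Poly_Mapping.lookup p b"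
  by (auto simp: scale_def map.rep_eq when_def)

lemma scale_simps [simp]:
  "scale c 0 = 0" "scale 0 p = 0" "scale 1 p = p"
  "scale c (scale d p) = scale (c * d) p"
  "scale c (Poly_Mapping.single b x) = Poly_Mapping.single b (c * x)"
  by (auto intro!: poly_mapping_eqI simp: lookup_scale lookup_single when_def mult.assoc)

lemma scale_add: "scale c (p + q) = scale c p + scale c q"
  by (auto intro!: poly_mapping_eqI simp: lookup_scale lookup_add algebra_simps)

lemma scale_add_left: "scale (c + d) p = scale c p + scale d p"
  by (auto intro!: poly_mapping_eqI simp: lookup_scale lookup_add algebra_simps)

lemma scale_sum: "scale c (sum f A) = (\<Sum>a\<in>A. scale c (f a))"
  by (induction A rule: infinite_finite_induct) (auto simp: scale_add)

lemma extend_superset: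
  assumes "finite A" "Poly_Mapping.keys p \<subseteq> A"
  shows "extend f p = (\<Sum>b\<in>A. scale (Poly_Mapping.lookup p b) (f b))"
  unfolding extend_def using assms by (intro sum.mono_neutral_left) (auto simp: in_keys_iff)

lemma extend_add: "extend f (p + q) = extend f p + extend f q"
proof -
  let ?A = "Poly_Mapping.keys p \<union> Poly_Mapping.keys q"
  have "Poly_Mapping.keys (p + q) \<subseteq> ?A" by (rule keys_add)
  then show ?thesis
    by (simp add: extend_superset[of ?A] lookup_add scale_add_left sum.distrib)
qed

lemma extend_scale: "extend f (scale c p) = scale c (extend f p)"
proof -
  have "Poly_Mapping.keys (scale c p) \<subseteq> Poly_Mapping.keys p"
    by (auto simp: in_keys_iff lookup_scale)
  then show ?thesis
    by (simp add: extend_superset[of "Poly_Mapping.keys p"] lookup_scale scale_sum)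
qed

lemma extend_single [simp]: "extend f (Poly_Mapping.single b c) = scale c (f b)"
  by (subst extend_superset[of "{b}"]) auto

lemma extend_zero [simp]: "extend f 0 = 0"
  by (simp add: extend_def)

lemma extend_sum: "extend f (sum g A) = (\<Sum>a\<in>A. extend f (g a))"
  by (induction A rule: infinite_finite_induct) (auto simp: extend_add)

lemma extend_extend: "extend f (extend g p) = extend (\<lambda>b. extend f (g b)) p"
  by (simp add: extend_def[of g] extend_def[of "\<lambda>b. extend f (g b)"] extend_sum extend_scale)

lemma extend_cong:
  "(\<And>b. b \<in> Poly_Mapping.keys p \<Longrightarrow> f b = g b) \<Longrightarrow> extend f p = extend g p"
  by (auto simp: extend_def intro: sum.cong)

lemma extend_fun_add: "extend (\<lambda>b. f b + g b) p = extend f p + extend g p"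
  by (simp add: extend_def scale_add sum.distrib)

lemma extend_fun_scale: "extend (\<lambda>b. scale c (f b)) p = scale c (extend f p)"
  by (simp add: extend_def scale_sum mult.commute)

lemma extend_fun_zero [simp]: "extend (\<lambda>b. 0) p = 0"
  by (simp add: extend_def)

lemma extend_basis [simp]: "extend basis p = p"
  by (rule poly_mapping_eqI)
    (simp add: extend_def lookup_sum lookup_single when_def sum.delta' in_keys_iff if_distrib
      cong: if_cong)

lemma extend_swap: "extend (\<lambda>a. extend (f a) q) p = extend (\<lambda>b. extend (\<lambda>a. f a b) p) q"
  by (simp add: extend_def scale_sum mult.commute) (rule sum.swap)

lemma keys_extend:
  assumes "\<And>b. b \<in> Poly_Mapping.keys p \<Longrightarrow> Poly_Mapping.keys (f b) \<subseteq> C"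
  shows "Poly_Mapping.keys (extend f p) \<subseteq> C"
proof
  fix c assume "c \<in> Poly_Mapping.keys (extend f p)"
  then have "(\<Sum>b\<in>Poly_Mapping.keys p. Poly_Mapping.lookup p b * Poly_Mapping.lookup (f b) c) \<noteq> 0"
    by (simp add: extend_def in_keys_iff lookup_sum lookup_scale)
  then obtain b where "b \<in> Poly_Mapping.keys p"
    "Poly_Mapping.lookup p b * Poly_Mapping.lookup (f b) c \<noteq> 0"
    by (rule sum.not_neutral_contains_not_neutral)
  moreover from this have "c \<in> Poly_Mapping.keys (f b)"
    by (auto simp: in_keys_iff)
  ultimately show "c \<in> C" using assms by blast
qed

lemma basis_algebra_ring:
  assumes closed: "\<And>a b. a \<in> C \<Longrightarrow> b \<in> C \<Longrightarrow> Poly_Mapping.keys (m a b) \<subseteq> C"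
    and unit: "u \<in> C" "\<And>a. a \<in> C \<Longrightarrow> m u a = basis a" "\<And>a. a \<in> C \<Longrightarrow> m a u = basis a"
    and assoc: "\<And>a b c. a \<in> C \<Longrightarrow> b \<in> C \<Longrightarrow> c \<in> C \<Longrightarrow>
      extend (\<lambda>x. m x c) (m a b) = extend (m a) (m b c)"
  shows "ring (basis_algebra C m u)"
proof (rule ringI)
  have sub: "Poly_Mapping.keys (p + q) \<subseteq> C" if "Poly_Mapping.keys p \<subseteq> C" "Poly_Mapping.keys q \<subseteq> C" for p q :: "'a lin"
    using that keys_add[of p q] by blast
  show "abelian_group (basis_algebra C m u)"
  proof (rule abelian_groupI)
    fix p assume "p \<in> carrier (basis_algebra C m u)"
    then show "\<exists>q\<in>carrier (basis_algebra C m u). q \<oplus>\<^bsub>basis_algebra C m u\<^esub> p = \<zero>\<^bsub>basis_algebra C m u\<^esub>"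
      by (intro bexI[of _ "- p"]) (auto simp: basis_algebra_def)
  next
    fix p q assume "p \<in> carrier (basis_algebra C m u)" "q \<in> carrier (basis_algebra C m u)"
    then show "p \<oplus>\<^bsub>basis_algebra C m u\<^esub> q \<in> carrier (basis_algebra C m u)"
      by (simp add: basis_algebra_def sub)
  qed (auto simp: basis_algebra_def add.assoc add.commute)
  show "Group.monoid (basis_algebra C m u)"
  proof (rule monoidI)
    fix p q r
    assume pqr: "p \<in> carrier (basis_algebra C m u)" "q \<in> carrier (basis_algebra C m u)"
      "r \<in> carrier (basis_algebra C m u)"
    have "extend2 m (extend2 m p q) r = extend (\<lambda>a. extend (\<lambda>b. extend (\<lambda>x. extend (m x) r) (m a b)) q) p"
      by (simp add: extend2_def extend_extend)
    also have "\<dots> = extend (\<lambda>a. extend (\<lambda>b. extend (\<lambda>c. extend (\<lambda>x. m x c) (m a b)) r) q) p"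
      by (subst extend_swap) simp
    also have "\<dots> = extend (\<lambda>a. extend (\<lambda>b. extend (\<lambda>c. extend (m a) (m b c)) r) q) p"
      using pqr by (intro extend_cong assoc) (auto simp: basis_algebra_def)
    also have "\<dots> = extend2 m p (extend2 m q r)"
      by (simp add: extend2_def extend_extend)
    finally show "p \<otimes>\<^bsub>basis_algebra C m u\<^esub> q \<otimes>\<^bsub>basis_algebra C m u\<^esub> r =
        p \<otimes>\<^bsub>basis_algebra C m u\<^esub> (q \<otimes>\<^bsub>basis_algebra C m u\<^esub> r)"
      by (simp add: basis_algebra_def)
  next
    fix p q
    assume pq: "p \<in> carrier (basis_algebra C m u)" "q \<in> carrier (basis_algebra C m u)"
    show "p \<otimes>\<^bsub>basis_algebra C m u\<^esub> q \<in> carrier (basis_algebra C m u)"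
      using pq unfolding basis_algebra_def extend2_def partial_object.simps monoid.simps mem_Collect_eq
      by (intro keys_extend closed) blast+
  next
    fix p assume p: "p \<in> carrier (basis_algebra C m u)"
    have "extend (m u) p = extend basis p" "extend (\<lambda>a. m a u) p = extend basis p"
      using p by (intro extend_cong unit; auto simp: basis_algebra_def)+
    then show "\<one>\<^bsub>basis_algebra C m u\<^esub> \<otimes>\<^bsub>basis_algebra C m u\<^esub> p = p"
      "p \<otimes>\<^bsub>basis_algebra C m u\<^esub> \<one>\<^bsub>basis_algebra C m u\<^esub> = p"
      by (simp_all only: basis_algebra_def extend2_def monoid.simps extend_single extend_basis scale_simps)
  qed (auto simp: basis_algebra_def unit)
qed (auto simp: basis_algebra_def extend2_def extend_add extend_fun_add)

lemma steenrod_tensor_ring: "ring steenrod_tensor"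
  unfolding steenrod_tensor_def by (rule basis_algebra_ring) auto

lemma crossings_union_left:
  assumes "S |\<inter>| T = {||}"
  shows "crossings (S |\<union>| T) U = crossings S U + crossings T U"
proof -
  have fin: "finite {(s, t). s |\<in>| A \<and> t |\<in>| U \<and> t < s}" for A :: "'a::linorder fset"
    by (rule finite_subset[of _ "fset A \<times> fset U"]) auto
  have "{(s, t). s |\<in>| S |\<union>| T \<and> t |\<in>| U \<and> t < s} =
     {(s, t). s |\<in>| S \<and> t |\<in>| U \<and> t < s} \<union> {(s, t). s |\<in>| T \<and> t |\<in>| U \<and> t < s}" by auto
  then show ?thesis unfolding crossings_def using assms fin
    by (simp del: funion_iff) (rule card_Un_disjoint, auto)
qed

lemma crossings_union_right:
  assumes "S |\<inter>| T = {||}"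
  shows "crossings U (S |\<union>| T) = crossings U S + crossings U T"
proof -
  have fin: "finite {(s, t). s |\<in>| U \<and> t |\<in>| A \<and> t < s}" for A :: "'a::linorder fset"
    by (rule finite_subset[of _ "fset U \<times> fset A"]) auto
  have "{(s, t). s |\<in>| U \<and> t |\<in>| S |\<union>| T \<and> t < s} =
     {(s, t). s |\<in>| U \<and> t |\<in>| S \<and> t < s} \<union> {(s, t). s |\<in>| U \<and> t |\<in>| T \<and> t < s}" by auto
  then show ?thesis unfolding crossings_def using assms fin
    by (simp del: funion_iff) (rule card_Un_disjoint, auto)
qed

lemma crossings_empty [simp]: "crossings {||} S = 0" "crossings S {||} = 0"
  by (simp_all add: crossings_def)

lemma mon_mult_assoc:
  "extend (\<lambda>x. mon_mult x c) (mon_mult a b) = extend (mon_mult a) (mon_mult b c)"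
proof (cases a; cases b; cases c)
  fix e f g S T U assume [simp]: "a = (e, S)" "b = (f, T)" "c = (g, U)"
  show ?thesis
    by (auto simp: crossings_union_left crossings_union_right inf_sup_distrib1 inf_sup_distrib2
      add.assoc sup_assoc power_add mult_ac)
qed

lemma poly_ext_ring: "ring poly_ext"
  unfolding poly_ext_def by (rule basis_algebra_ring) (auto simp: mon_mult_assoc)


lemma mon_deg_mult:
  assumes "S |\<inter>| T = {||}"
  shows "mon_deg dx dy (e + f, S |\<union>| T) = mon_deg dx dy (e, S) + mon_deg dx dy (f, T)"
proof -
  define A where "A = Poly_Mapping.keys e \<union> Poly_Mapping.keys f"
  have *: "(\<Sum>x\<in>Poly_Mapping.keys g. Poly_Mapping.lookup g x * dx x) =
      (\<Sum>x\<in>A. Poly_Mapping.lookup g x * dx x)" if "Poly_Mapping.keys g \<subseteq> A" for g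
    using that by (intro sum.mono_neutral_left) (auto simp: in_keys_iff A_def)
  have "fset S \<inter> fset T = {}"
    using assms by (metis bot_fset.rep_eq inf_fset.rep_eq)
  then have "(\<Sum>y\<in>fset (S |\<union>| T). dy y) = (\<Sum>y\<in>fset S. dy y) + (\<Sum>y\<in>fset T. dy y)"
    by (simp add: sum.union_disjoint)
  moreover have "Poly_Mapping.keys (e + f) \<subseteq> A" "Poly_Mapping.keys e \<subseteq> A"
    "Poly_Mapping.keys f \<subseteq> A"
    by (auto simp: A_def keys_add)
  ultimately show ?thesis
    by (simp only: mon_deg.simps *) (simp add: lookup_add sum.distrib distrib_right)
qed

lemma tens_simps [simp]:
  "tens (Poly_Mapping.single a x) (Poly_Mapping.single b y) = Poly_Mapping.single (a, b) (x * y)"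
  "tens 0 q = 0" "tens p 0 = 0"
  by (simp_all add: tens_def extend2_def)

lemma sdeg_mult:
  assumes "S |\<inter>| T = {||}"
  shows "sdeg (e + f, S |\<union>| T) = sdeg (e, S) + sdeg (f, T)"
  using assms unfolding sdeg_def by (rule mon_deg_mult)

lemma steenrod2_ring: "ring steenrod2"
  unfolding steenrod2_def
proof (rule basis_algebra_ring, goal_cases)
  case (5 a b c)
  obtain e S e' S' where a: "a = ((e, S), (e', S'))" by (metis surj_pair)
  obtain f T f' T' where b: "b = ((f, T), (f', T'))" by (metis surj_pair)
  obtain g U g' U' where c: "c = ((g, U), (g', U'))" by (metis surj_pair)
  show ?case
    unfolding a b c
    by (cases "S |\<inter>| T = {||}"; cases "S |\<inter>| U = {||}"; cases "T |\<inter>| U = {||}";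
        cases "S' |\<inter>| T' = {||}"; cases "S' |\<inter>| U' = {||}"; cases "T' |\<inter>| U' = {||}")
      (simp_all add: sdeg_mult crossings_union_left crossings_union_right inf_sup_distrib1
        inf_sup_distrib2 add.assoc sup_assoc power_add mult_ac distrib_left distrib_right)
qed (auto simp: sdeg_def)

end

(* Modulo the ideal, all xi_n with n >= 2 and all tau_m with m >= 3 vanish, so the cobar complex of
   Gamma is a free algebra T on the 23 monomials xi_1^a tau_0^x0 tau_1^x1 tau_2^x2 other than 1.
   The Cartan-Eilenberg picture is that Ext is the cohomology of F3[xi_1]/(xi_1^3) with coefficients
   in F3[v_0, v_1, v_2], on which the operation dual to xi_1 acts as P = v_0 d/dv_1; the periodic
   resolution computes it by a complex M with differentials P, P^2, P, ... in which the powers of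
   beta and the elements alpha and 1 index the periods. M is a differential left T-module
   generated by its unit, and multiplying the unit gives a surjection T -> M.

   The kernel K of T -> M is acyclic: a cycle of K yields a cycle of the twisted tensor product
   of Gamma and M, which is contractible by a perturbation of a tensor product of Koszul complexes;
   what remains is removed letter by letter, by induction on the internal degree. So the cohomology
   of T is that of M, where every monomial is either sent to a multiple of a monomial or to 0. Its
   products are read off from the action of explicit cocycles v_0, v_2, alpha_1, alpha_2, beta, c_6
   of T on M. *)

theory Submission
  imports "HOL-Algebra.Subrings" Defs
begin

section \<open>Linear maps on free vector spaces\<close>

text \<open>P^2 is not a derivation, so polynomial multiplication does not make M a differential
  algebra, and products cannot be computed inside M. A left T-module is enough: the image of a
  product p q in M is p acting on the image of q. As T is free, such a structure is one operator per
  letter, and its compatibility with the differential is one identity per letter. The generators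
  reflect P in characteristic 3. P(v_1) = v_0, but P(v_1^3) = 0, which gives c_6. P^2(v_1) = 0, so
  v_1 alpha is a cycle, which up to sign gives alpha_2. The relations come from v_0 alpha = d(v_1),
  v_0 v_1 alpha = d(-v_1^2) and xi_1 (v_1 alpha) = -v_0 beta. The internal degree makes both
  inductions end: it bounds the powers of v_0 that the perturbation can create, and it drops when a
  letter is removed. Monomials in xi and tau replace those in the conjugates. The ideal is the span
  of the same forbidden monomials, and the formulas for the coproduct apply directly.\<close>

lemma three_eq_0 [simp]: "(3::F3) = 0"
  by simp

lemma F3_cases: "(c::F3) = 0 \<or> c = 1 \<or> c = - 1"
proof -
  obtain z where "c = of_int z" "0 \<le> z" "z < 3"
    by (cases c) auto
  then have "z = 0 \<or> z = 1 \<or> z = 2" by arith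
  then show ?thesis using \<open>c = of_int z\<close> by auto
qed

lemma F3_square: "(c::F3) \<noteq> 0 \<Longrightarrow> c * c = 1"
  using F3_cases[of c] by auto

lemma of_nat_F3_eq_0: "(of_nat n :: F3) = 0 \<longleftrightarrow> 3 dvd n"
proof -
  have "(of_nat (3 * (n div 3) + n mod 3) :: F3) = of_nat (n mod 3)"
    unfolding of_nat_add of_nat_mult of_nat_numeral three_eq_0 by simp
  then have "(of_nat n :: F3) = of_nat (n mod 3)"
    by simp
  moreover have "n mod 3 = 0 \<or> n mod 3 = 1 \<or> n mod 3 = 2" by arith
  ultimately show ?thesis by (auto simp: dvd_eq_mod_eq_0)
qed

lemma single_eq_scale: "Poly_Mapping.single b c = scale c (basis b)"
  by simp

lemma scale_minus [simp]: "scale c (- p) = - scale c p" "scale (- c) p = - scale c p"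
  by (auto intro!: poly_mapping_eqI simp: lookup_scale)

lemma scale_diff: "scale c (p - q) = scale c p - scale c q"
  by (simp add: scale_add flip: scale_minus(1) add_uminus_conv_diff)

lemma extend_minus [simp]: "extend f (- p) = - extend f p"
  using extend_scale[of f "-1" p] by simp

lemma extend_diff: "extend f (p - q) = extend f p - extend f q"
  by (simp add: extend_add flip: add_uminus_conv_diff)

lemma extend_fun_minus: "extend (\<lambda>b. - f b) p = - extend f p"
  using extend_fun_scale[of "-1" f p] by simp

lemma extend_fun_diff: "extend (\<lambda>b. f b - g b) p = extend f p - extend g p"
  by (simp add: extend_fun_add extend_fun_minus flip: add_uminus_conv_diff)

text \<open>For showing that values of a linear map lie in an ideal or among the boundaries;
  \<open>p\<close> enters through an equation so that it may be a compound term.\<close>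

lemma extend_eq_induct:
  assumes "p = extend f q" "P 0" "\<And>p q. P p \<Longrightarrow> P q \<Longrightarrow> P (p + q)"
    "\<And>c p. P p \<Longrightarrow> P (scale c p)" "\<And>b. b \<in> Poly_Mapping.keys q \<Longrightarrow> P (f b)"
  shows "P p"
proof -
  have "P (\<Sum>b\<in>A. scale (Poly_Mapping.lookup q b) (f b))" if "A \<subseteq> Poly_Mapping.keys q" for A
    using that by (induction A rule: infinite_finite_induct) (auto intro: assms(2-))
  then show ?thesis using assms(1) by (simp add: extend_def)
qed

lemma lin_induct [consumes 1, case_names zero add scale basis]:
  assumes "Poly_Mapping.keys p \<subseteq> C" "P 0" "\<And>p q. P p \<Longrightarrow> P q \<Longrightarrow> P (p + q)"
    "\<And>c p. P p \<Longrightarrow> P (scale c p)" "\<And>b. b \<in> C \<Longrightarrow> P (basis b)"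
  shows "P p"
  by (rule extend_eq_induct[of p basis p]) (use assms in auto)

text \<open>Degree conditions, words without the unit letter and bounds on first letters are all
  expressed as supports, since these are preserved by linear operations.\<close>

definition supp :: "'b set \<Rightarrow> 'b lin set"
  where "supp C = {p. Poly_Mapping.keys p \<subseteq> C}"

lemma supp_iff: "p \<in> supp C \<longleftrightarrow> (\<forall>b. b \<notin> C \<longrightarrow> Poly_Mapping.lookup p b = 0)"
  by (auto simp: supp_def in_keys_iff)

lemma supp_closed [intro, simp]:
  "0 \<in> supp C"
  "p \<in> supp C \<Longrightarrow> q \<in> supp C \<Longrightarrow> p + q \<in> supp C"
  "p \<in> supp C \<Longrightarrow> q \<in> supp C \<Longrightarrow> p - q \<in> supp C"
  "p \<in> supp C \<Longrightarrow> - p \<in> supp C"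
  "p \<in> supp C \<Longrightarrow> scale c p \<in> supp C"
  "b \<in> C \<Longrightarrow> Poly_Mapping.single b c \<in> supp C"
  by (auto simp: supp_iff lookup_add lookup_minus lookup_scale lookup_single when_def)

lemma supp_mono: "p \<in> supp C \<Longrightarrow> C \<subseteq> D \<Longrightarrow> p \<in> supp D"
  by (auto simp: supp_def)

lemma supp_UNIV [simp]: "p \<in> supp UNIV"
  by (simp add: supp_def)

lemma supp_extend:
  assumes "p \<in> supp C" "\<And>b. b \<in> C \<Longrightarrow> f b \<in> supp D"
  shows "extend f p \<in> supp D"
  using assms keys_extend[of p f D] by (auto simp: supp_def)

lemma extend_cong_supp:
  assumes "p \<in> supp C" "\<And>b. b \<in> C \<Longrightarrow> f b = g b"
  shows "extend f p = extend g p"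
  using assms by (intro extend_cong) (auto simp: supp_def)

lemma extend_lookup:
  "Poly_Mapping.lookup (extend f p) c =
    (\<Sum>b\<in>Poly_Mapping.keys p. Poly_Mapping.lookup p b * Poly_Mapping.lookup (f b) c)"
  by (simp add: extend_def lookup_sum lookup_scale)


section \<open>Explicit linear combinations\<close>

text \<open>Coefficients are integers rather than elements of \<open>F3\<close>, so that
  \<open>code_simp\<close> can evaluate combinations.\<close>

fun lc :: "(int \<times> 'a) list \<Rightarrow> 'a lin"
  where
    "lc [] = 0"
  | "lc ((c, a) # xs) = Poly_Mapping.single a (of_int c) + lc xs"

section \<open>Collecting like terms by evaluation\<close>

datatype 'a sum_tree = Leaf | Node "'a sum_tree" int int 'a "'a sum_tree"

fun insert_term :: "int \<Rightarrow> int \<Rightarrow> 'a \<Rightarrow> 'a sum_tree \<Rightarrow> 'a sum_tree"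
  where
    "insert_term k c a Leaf = Node Leaf k c a Leaf"
  | "insert_term k c a (Node l k' d b r) =
      (if k < k' then Node (insert_term k c a l) k' d b r
       else if k = k' \<and> a = b then Node l k' (c + d) b r
       else Node l k' d b (insert_term k c a r))"

fun terms :: "'a sum_tree \<Rightarrow> (int \<times> 'a) list"
  where
    "terms Leaf = []"
  | "terms (Node l k c a r) = terms l @ (if c mod 3 = 0 then [] else [(c, a)]) @ terms r"

text \<open>The key only steers the search tree: collecting terms is sound for any \<open>key\<close>.\<close>

definition collect :: "('a \<Rightarrow> int) \<Rightarrow> (int \<times> 'a) list \<Rightarrow> (int \<times> 'a) list"
  where "collect key xs = terms (foldr (\<lambda>(c, a). insert_term (key a) c a) xs Leaf)"

lemma of_int_F3_eq_0:
  assumes "z mod 3 = 0"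
  shows "(of_int z :: F3) = 0"
proof -
  obtain k where "z = 3 * k" using assms by (auto simp: mod_eq_0_iff_dvd elim: dvdE)
  then show ?thesis by (simp only: of_int_mult of_int_numeral three_eq_0 mult_zero_left)
qed

lemma lc_append [simp]: "lc (xs @ ys) = lc xs + lc ys"
  by (induction xs) (auto simp: add.assoc)

lemma lc_insert_term:
  "lc (terms (insert_term k c a t)) = Poly_Mapping.single a (of_int c) + lc (terms t)"
proof (induction t)
  case Leaf
  then show ?case using of_int_F3_eq_0[of c] by auto
next
  case (Node l k' d b r)
  have "Poly_Mapping.single b (of_int c :: F3) + Poly_Mapping.single b (of_int d) = 0" if "(c + d) mod 3 = 0"
    using of_int_F3_eq_0[OF that] by (simp flip: single_add)
  with Node show ?case using of_int_F3_eq_0[of d] by (auto simp: single_add add_ac)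
qed

lemma lc_collect [simp]: "lc (collect key xs) = lc xs"
  unfolding collect_def by (induction xs) (auto simp: lc_insert_term)

definition lext :: "('a \<Rightarrow> (int \<times> 'b) list) \<Rightarrow> (int \<times> 'a) list \<Rightarrow> (int \<times> 'b) list"
  where "lext f xs = concat (map (\<lambda>(c, a). map (\<lambda>(d, b). (c * d, b)) (f a)) xs)"

lemma lc_map_scale: "lc (map (\<lambda>(d, b). (c * d, b)) ys) = scale (of_int c) (lc ys)"
  by (induction ys) (auto simp: scale_add)

lemma lc_lext [simp]: "lc (lext f xs) = extend (\<lambda>a. lc (f a)) (lc xs)"
  by (induction xs) (auto simp: lext_def lc_map_scale extend_add)

lemma lc_eq_0: "collect key xs = [] \<Longrightarrow> lc xs = 0"
  by (metis lc_collect lc.simps(1))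

section \<open>The Hopf algebra in coordinates\<close>

datatype height = H0 | H1 | H2

text \<open>\<open>(a, x0, x1, x2)\<close> stands for the class of \<open>\<xi>\<^sub>1\<^sup>a \<tau>\<^sub>0\<^sup>x\<^sup>0 \<tau>\<^sub>1\<^sup>x\<^sup>1 \<tau>\<^sub>2\<^sup>x\<^sup>2\<close>.\<close>

type_synonym gam = "height \<times> bool \<times> bool \<times> bool"

abbreviation gunit :: gam
  where "gunit \<equiv> (H0, False, False, False)"

fun hnat :: "height \<Rightarrow> nat"
  where "hnat H0 = 0" | "hnat H1 = 1" | "hnat H2 = 2"

fun hadd :: "height \<Rightarrow> height \<Rightarrow> height option"
  where
    "hadd H0 a = Some a"
  | "hadd a H0 = Some a"
  | "hadd H1 H1 = Some H2"
  | "hadd a b = None"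

fun gdeg :: "gam \<Rightarrow> nat"
  where "gdeg (a, x0, x1, x2) = 4 * hnat a + of_bool x0 + 5 * of_bool x1 + 17 * of_bool x2"

definition sg :: "bool \<Rightarrow> int"
  where "sg b = (if b then -1 else 1)"

fun gpar :: "gam \<Rightarrow> bool"
  where "gpar (a, x0, x1, x2) \<longleftrightarrow> x0 \<noteq> (x1 \<noteq> x2)"

text \<open>The sign counts odd generators that pass each other: \<open>y0\<close> moves past
  \<open>x1\<close> and \<open>x2\<close>, and \<open>y1\<close> past \<open>x2\<close>.\<close>

fun gmul :: "gam \<Rightarrow> gam \<Rightarrow> (int \<times> gam) list"
  where "gmul (a, x0, x1, x2) (b, y0, y1, y2) =
    (case hadd a b of
      None \<Rightarrow> []
    | Some c \<Rightarrow> if x0 \<and> y0 \<or> x1 \<and> y1 \<or> x2 \<and> y2 then []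
        else [(sg ((x1 \<and> y0) \<noteq> ((x2 \<and> y0) \<noteq> (x2 \<and> y1))), (c, x0 \<or> y0, x1 \<or> y1, x2 \<or> y2))])"

fun gmul2 :: "gam \<times> gam \<Rightarrow> gam \<times> gam \<Rightarrow> (int \<times> gam \<times> gam) list"
  where "gmul2 (a, b) (c, d) =
    [(sg (gpar b \<and> gpar c) * s * t, (x, y)). (s, x) \<leftarrow> gmul a c, (t, y) \<leftarrow> gmul b d]"

definition lmul2 :: "(int \<times> gam \<times> gam) list \<Rightarrow> (int \<times> gam \<times> gam) list \<Rightarrow> (int \<times> gam \<times> gam) list"
  where "lmul2 xs ys = lext (\<lambda>a. lext (gmul2 a) ys) xs"

definition gxi :: gam where "gxi = (H1, False, False, False)"
definition gxi2 :: gam where "gxi2 = (H2, False, False, False)"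
definition gtau0 :: gam where "gtau0 = (H0, True, False, False)"
definition gtau1 :: gam where "gtau1 = (H0, False, True, False)"
definition gtau2 :: gam where "gtau2 = (H0, False, False, True)"

text \<open>Numbers the 24 monomials from 0 to 23, so that base 24 in the keys separates pairs, and
  words of equal length.\<close>

fun gcode :: "gam \<Rightarrow> int"
  where "gcode (a, x0, x1, x2) =
    int (hnat a) + 3 * (if x0 then 1 else 0) + 6 * (if x1 then 1 else 0) + 12 * (if x2 then 1 else 0)"

fun pair_key :: "gam \<times> gam \<Rightarrow> int"
  where "pair_key (a, b) = 24 * gcode a + gcode b"

definition word_key :: "gam list \<Rightarrow> int"
  where "word_key w = foldr (\<lambda>g n. 24 * n + gcode g) w 0"

definition cop_xi :: "(int \<times> gam \<times> gam) list"
  where "cop_xi = [(1, (gxi, gunit)), (1, (gunit, gxi))]"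

text \<open>In Gamma both xi_2 and xi_1^3 vanish, so the terms of the coproduct of tau_2 that
  contain them drop out and tau_2 is primitive.\<close>

definition cop_tau :: "nat \<Rightarrow> (int \<times> gam \<times> gam) list"
  where "cop_tau n =
    (if n = 0 then [(1, (gtau0, gunit)), (1, (gunit, gtau0))]
     else if n = 1 then [(1, (gtau1, gunit)), (1, (gxi, gtau0)), (1, (gunit, gtau1))]
     else [(1, (gtau2, gunit)), (1, (gunit, gtau2))])"

fun cop :: "gam \<Rightarrow> (int \<times> gam \<times> gam) list"
  where "cop (a, x0, x1, x2) = collect pair_key (foldr lmul2
    (replicate (hnat a) cop_xi @
      map cop_tau ((if x0 then [0] else []) @ (if x1 then [1] else []) @ (if x2 then [2] else [])))
    [(1, (gunit, gunit))])"

text \<open>The reduced coproduct is tabulated so that it can be used for rewriting; the table is checked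
  against \<^const>\<open>cop\<close> in \<open>collect_cop_red\<close>.\<close>

fun red :: "gam \<Rightarrow> (int \<times> gam \<times> gam) list"
  where
    "red (H0, False, False, False) = []"
  | "red (H0, False, False, True) = []"
  | "red (H0, False, True, False) = [(1, (H1, False, False, False), (H0, True, False, False))]"
  | "red (H0, False, True, True) = [(1, (H0, False, True, False), (H0, False, False, True)), (-1,
      (H1, False, False, True), (H0, True, False, False)), (1, (H1, False, False, False), (H0, True,
      False, True)), (-1, (H0, False, False, True), (H0, False, True, False))]"
  | "red (H0, True, False, False) = []"
  | "red (H0, True, False, True) = [(1, (H0, True, False, False), (H0, False, False, True)), (-1,
      (H0, False, False, True), (H0, True, False, False))]"
  | "red (H0, True, True, False) = [(1, (H1, True, False, False), (H0, True, False, False)), (1,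
      (H0, True, False, False), (H0, False, True, False)), (-1, (H0, False, True, False), (H0, True,
      False, False))]"
  | "red (H0, True, True, True) = [(1, (H0, True, True, False), (H0, False, False, True)), (-1,
      (H1, True, False, True), (H0, True, False, False)), (1, (H1, True, False, False), (H0, True,
      False, True)), (-1, (H0, True, False, True), (H0, False, True, False)), (1, (H0, True, False,
      False), (H0, False, True, True)), (1, (H0, False, True, True), (H0, True, False, False)), (-1,
      (H0, False, True, False), (H0, True, False, True)), (1, (H0, False, False, True), (H0, True,
      True, False))]"
  | "red (H1, False, False, False) = []"
  | "red (H1, False, False, True) = [(1, (H1, False, False, False), (H0, False, False, True)), (1,
      (H0, False, False, True), (H1, False, False, False))]"
  | "red (H1, False, True, False) = [(1, (H2, False, False, False), (H0, True, False, False)), (1,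
      (H1, False, False, False), (H0, False, True, False)), (1, (H0, False, True, False), (H1, False,
      False, False)), (1, (H1, False, False, False), (H1, True, False, False))]"
  | "red (H1, False, True, True) = [(1, (H1, False, True, False), (H0, False, False, True)), (-1,
      (H2, False, False, True), (H0, True, False, False)), (1, (H2, False, False, False), (H0, True,
      False, True)), (-1, (H1, False, False, True), (H0, False, True, False)), (1, (H1, False, False,
      False), (H0, False, True, True)), (1, (H0, False, True, True), (H1, False, False, False)), (1,
      (H0, False, True, False), (H1, False, False, True)), (-1, (H1, False, False, True), (H1, True,
      False, False)), (1, (H1, False, False, False), (H1, True, False, True)), (-1, (H0, False,
      False, True), (H1, False, True, False))]"
  | "red (H1, True, False, False) = [(1, (H1, False, False, False), (H0, True, False, False)), (1,
      (H0, True, False, False), (H1, False, False, False))]"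
  | "red (H1, True, False, True) = [(1, (H1, True, False, False), (H0, False, False, True)), (-1,
      (H1, False, False, True), (H0, True, False, False)), (1, (H1, False, False, False), (H0, True,
      False, True)), (1, (H0, True, False, True), (H1, False, False, False)), (1, (H0, True, False,
      False), (H1, False, False, True)), (-1, (H0, False, False, True), (H1, True, False, False))]"
  | "red (H1, True, True, False) = [(1, (H2, True, False, False), (H0, True, False, False)), (1,
      (H1, True, False, False), (H0, False, True, False)), (-1, (H1, False, True, False), (H0, True,
      False, False)), (1, (H1, False, False, False), (H0, True, True, False)), (1, (H0, True, True,
      False), (H1, False, False, False)), (1, (H1, True, False, False), (H1, True, False, False)),
      (1, (H0, True, False, False), (H1, False, True, False)), (-1, (H0, False, True, False), (H1,
      True, False, False))]"
  | "red (H1, True, True, True) = [(1, (H1, True, True, False), (H0, False, False, True)), (-1,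
      (H2, True, False, True), (H0, True, False, False)), (1, (H2, True, False, False), (H0, True,
      False, True)), (-1, (H1, True, False, True), (H0, False, True, False)), (1, (H1, True, False,
      False), (H0, False, True, True)), (1, (H1, False, True, True), (H0, True, False, False)), (-1,
      (H1, False, True, False), (H0, True, False, True)), (1, (H1, False, False, True), (H0, True,
      True, False)), (1, (H1, False, False, False), (H0, True, True, True)), (1, (H0, True, True,
      True), (H1, False, False, False)), (1, (H0, True, True, False), (H1, False, False, True)), (-1,
      (H1, True, False, True), (H1, True, False, False)), (1, (H1, True, False, False), (H1, True,
      False, True)), (-1, (H0, True, False, True), (H1, False, True, False)), (1, (H0, True, False,
      False), (H1, False, True, True)), (1, (H0, False, True, True), (H1, True, False, False)), (-1,
      (H0, False, True, False), (H1, True, False, True)), (1, (H0, False, False, True), (H1, True,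
      True, False))]"
  | "red (H2, False, False, False) = [(-1, (H1, False, False, False), (H1, False, False, False))]"
  | "red (H2, False, False, True) = [(1, (H2, False, False, False), (H0, False, False, True)), (-1,
      (H1, False, False, True), (H1, False, False, False)), (-1, (H1, False, False, False), (H1,
      False, False, True)), (1, (H0, False, False, True), (H2, False, False, False))]"
  | "red (H2, False, True, False) = [(1, (H2, False, False, False), (H0, False, True, False)), (-1,
      (H1, False, True, False), (H1, False, False, False)), (-1, (H2, False, False, False), (H1,
      True, False, False)), (-1, (H1, False, False, False), (H1, False, True, False)), (1, (H0,
      False, True, False), (H2, False, False, False)), (1, (H1, False, False, False), (H2, True,
      False, False))]"
  | "red (H2, False, True, True) = [(1, (H2, False, True, False), (H0, False, False, True)), (-1,
      (H2, False, False, True), (H0, False, True, False)), (1, (H2, False, False, False), (H0, False,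
      True, True)), (-1, (H1, False, True, True), (H1, False, False, False)), (-1, (H1, False, True,
      False), (H1, False, False, True)), (1, (H2, False, False, True), (H1, True, False, False)),
      (-1, (H2, False, False, False), (H1, True, False, True)), (1, (H1, False, False, True), (H1,
      False, True, False)), (-1, (H1, False, False, False), (H1, False, True, True)), (1, (H0, False,
      True, True), (H2, False, False, False)), (1, (H0, False, True, False), (H2, False, False,
      True)), (-1, (H1, False, False, True), (H2, True, False, False)), (1, (H1, False, False,
      False), (H2, True, False, True)), (-1, (H0, False, False, True), (H2, False, True, False))]"
  | "red (H2, True, False, False) = [(1, (H2, False, False, False), (H0, True, False, False)), (-1,
      (H1, True, False, False), (H1, False, False, False)), (-1, (H1, False, False, False), (H1,
      True, False, False)), (1, (H0, True, False, False), (H2, False, False, False))]"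
  | "red (H2, True, False, True) = [(1, (H2, True, False, False), (H0, False, False, True)), (-1,
      (H2, False, False, True), (H0, True, False, False)), (1, (H2, False, False, False), (H0, True,
      False, True)), (-1, (H1, True, False, True), (H1, False, False, False)), (-1, (H1, True, False,
      False), (H1, False, False, True)), (1, (H1, False, False, True), (H1, True, False, False)),
      (-1, (H1, False, False, False), (H1, True, False, True)), (1, (H0, True, False, True), (H2,
      False, False, False)), (1, (H0, True, False, False), (H2, False, False, True)), (-1, (H0,
      False, False, True), (H2, True, False, False))]"
  | "red (H2, True, True, False) = [(1, (H2, True, False, False), (H0, False, True, False)), (-1,
      (H2, False, True, False), (H0, True, False, False)), (1, (H2, False, False, False), (H0, True,
      True, False)), (-1, (H1, True, True, False), (H1, False, False, False)), (-1, (H2, True, False,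
      False), (H1, True, False, False)), (-1, (H1, True, False, False), (H1, False, True, False)),
      (1, (H1, False, True, False), (H1, True, False, False)), (-1, (H1, False, False, False), (H1,
      True, True, False)), (1, (H0, True, True, False), (H2, False, False, False)), (1, (H1, True,
      False, False), (H2, True, False, False)), (1, (H0, True, False, False), (H2, False, True,
      False)), (-1, (H0, False, True, False), (H2, True, False, False))]"
  | "red (H2, True, True, True) = [(1, (H2, True, True, False), (H0, False, False, True)), (-1,
      (H2, True, False, True), (H0, False, True, False)), (1, (H2, True, False, False), (H0, False,
      True, True)), (1, (H2, False, True, True), (H0, True, False, False)), (-1, (H2, False, True,
      False), (H0, True, False, True)), (1, (H2, False, False, True), (H0, True, True, False)), (1,
      (H2, False, False, False), (H0, True, True, True)), (-1, (H1, True, True, True), (H1, False,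
      False, False)), (-1, (H1, True, True, False), (H1, False, False, True)), (1, (H2, True, False,
      True), (H1, True, False, False)), (-1, (H2, True, False, False), (H1, True, False, True)), (1,
      (H1, True, False, True), (H1, False, True, False)), (-1, (H1, True, False, False), (H1, False,
      True, True)), (-1, (H1, False, True, True), (H1, True, False, False)), (1, (H1, False, True,
      False), (H1, True, False, True)), (-1, (H1, False, False, True), (H1, True, True, False)), (-1,
      (H1, False, False, False), (H1, True, True, True)), (1, (H0, True, True, True), (H2, False,
      False, False)), (1, (H0, True, True, False), (H2, False, False, True)), (-1, (H1, True, False,
      True), (H2, True, False, False)), (1, (H1, True, False, False), (H2, True, False, True)), (-1,
      (H0, True, False, True), (H2, False, True, False)), (1, (H0, True, False, False), (H2, False,
      True, True)), (1, (H0, False, True, True), (H2, True, False, False)), (-1, (H0, False, True,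
      False), (H2, True, False, True)), (1, (H0, False, False, True), (H2, True, True, False))]"

definition dlist :: "gam \<Rightarrow> (int \<times> gam list) list"
  where "dlist g = map (\<lambda>(c, a, b). (sg (gpar a) * c, [a, b])) (red g)"

fun dwlist :: "gam list \<Rightarrow> (int \<times> gam list) list"
  where
    "dwlist [] = []"
  | "dwlist (g # w) = map (\<lambda>(c, v). (c, v @ w)) (dlist g) @
      map (\<lambda>(c, v). (- sg (gpar g) * c, g # v)) (dwlist w)"

definition gams :: "gam list"
  where "gams = List.product [H0, H1, H2]
    (List.product [False, True] (List.product [False, True] [False, True]))"

lemma gams_complete: "g \<in> set gams"
proof (cases g)
  case (fields a x0 x1 x2)
  show ?thesis unfolding fields by (cases a; cases x0; cases x1; cases x2) (simp_all add: gams_def)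
qed

lemma gam_all: "(\<forall>g. P g) \<longleftrightarrow> list_all P gams"
  by (auto simp: list_all_iff gams_complete)

lemma red_props:
  "list_all (\<lambda>(c, a, b). a \<noteq> gunit \<and> b \<noteq> gunit \<and> gdeg a + gdeg b = gdeg g \<and>
    gpar g = (gpar a \<noteq> gpar b)) (red g)"
proof -
  have "\<forall>g. list_all (\<lambda>(c, a, b). a \<noteq> gunit \<and> b \<noteq> gunit \<and> gdeg a + gdeg b = gdeg g \<and>
    gpar g = (gpar a \<noteq> gpar b)) (red g)"
    unfolding gam_all by code_simp
  then show ?thesis by blast
qed

lemma collect_cop_red:
  "collect pair_key (filter (\<lambda>(c, a, b). a \<noteq> gunit \<and> b \<noteq> gunit) (cop g) @
    map (\<lambda>(c, x). (- c, x)) (red g)) = []"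
proof -
  have "\<forall>g. collect pair_key (filter (\<lambda>(c, a, b). a \<noteq> gunit \<and> b \<noteq> gunit) (cop g) @
    map (\<lambda>(c, x). (- c, x)) (red g)) = []"
    unfolding gam_all by code_simp
  then show ?thesis by blast
qed

text \<open>Coassociativity of the reduced coproduct, in the form d^2 = 0 on single letters.\<close>

lemma collect_dwlist_dlist: "collect word_key (lext dwlist (dlist g)) = []"
proof -
  have "\<forall>g. collect word_key (lext dwlist (dlist g)) = []"
    unfolding gam_all by code_simp
  then show ?thesis by blast
qed

section \<open>The cobar complex in coordinates\<close>

definition conc :: "'a list lin \<Rightarrow> 'a list lin \<Rightarrow> 'a list lin"
  where "conc = extend2 (\<lambda>v w. basis (v @ w))"

lemma conc_basis [simp]: "conc (basis v) (basis w) = basis (v @ w)"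
  by (simp add: conc_def extend2_def)

lemma conc_add: "conc (p + q) r = conc p r + conc q r" "conc r (p + q) = conc r p + conc r q"
  by (simp_all add: conc_def extend2_def extend_add extend_fun_add)

lemma conc_scale: "conc (scale c p) q = scale c (conc p q)" "conc p (scale c q) = scale c (conc p q)"
  by (simp_all add: conc_def extend2_def extend_scale extend_fun_scale)

lemma conc_minus: "conc (- p) q = - conc p q" "conc p (- q) = - conc p q"
  by (simp_all add: conc_def extend2_def extend_fun_minus)

lemma conc_diff: "conc (p - q) r = conc p r - conc q r" "conc r (p - q) = conc r p - conc r q"
  by (simp_all add: conc_def extend2_def extend_diff extend_fun_diff)

lemma conc_zero [simp]: "conc 0 p = 0" "conc p 0 = 0"
  by (simp_all add: conc_def extend2_def)

lemma conc_extend: "conc p (basis w) = extend (\<lambda>v. basis (v @ w)) p"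
  "conc (basis v) q = extend (\<lambda>w. basis (v @ w)) q"
  by (simp_all add: conc_def extend2_def)

lemma conc_extend_left: "conc (extend f p) q = extend (\<lambda>b. conc (f b) q) p"
  by (simp add: conc_def extend2_def extend_extend)

lemma conc_extend_right: "conc p (extend f q) = extend (\<lambda>b. conc p (f b)) q"
  unfolding conc_def extend2_def extend_extend by (rule extend_swap)

lemma conc_assoc: "conc (conc p q) r = conc p (conc q r)"
proof -
  have *: "conc (conc (basis u) (basis v)) r = conc (basis u) (conc (basis v) r)" for u v
    by (simp add: conc_extend extend_extend)
  have "conc (conc (basis u) q) r = conc (basis u) (conc q r)" for u
    using supp_UNIV[of q, unfolded supp_def mem_Collect_eq]
    by (induction q rule: lin_induct) (simp_all only: * conc_add conc_scale conc_zero)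
  note ** = this
  show ?thesis
    using supp_UNIV[of p, unfolded supp_def mem_Collect_eq]
    by (induction p rule: lin_induct) (simp_all only: ** conc_add conc_scale conc_zero)
qed

lemma conc_Cons: "conc (basis (g # v)) q = conc (basis [g]) (conc (basis v) q)"
  by (simp flip: conc_assoc)

lemma conc_Nil [simp]: "conc p (basis []) = p" "conc (basis []) p = p"
  by (simp_all add: conc_extend)

definition gs :: "gam \<Rightarrow> F3"
  where "gs g = of_int (sg (gpar g))"

lemma gs_square [simp]: "gs g * gs g = 1"
  by (simp add: gs_def sg_def)

definition dl :: "gam \<Rightarrow> gam list lin"
  where "dl g = lc (dlist g)"

fun dw :: "gam list \<Rightarrow> gam list lin"
  where
    "dw [] = 0"
  | "dw (g # w) = conc (dl g) (basis w) - scale (gs g) (conc (basis [g]) (dw w))"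

definition dT :: "gam list lin \<Rightarrow> gam list lin"
  where "dT = extend dw"

lemma dT_simps [simp]:
  "dT 0 = 0" "dT (p + q) = dT p + dT q" "dT (p - q) = dT p - dT q" "dT (- p) = - dT p"
  "dT (scale c p) = scale c (dT p)" "dT (Poly_Mapping.single w c) = scale c (dw w)"
  by (simp_all add: dT_def extend_add extend_diff extend_scale)

lemma lc_map_image: "lc (map (\<lambda>(c, v). (k * c, h v)) xs) = scale (of_int k) (extend (\<lambda>v. basis (h v)) (lc xs))"
  by (induction xs) (auto simp: extend_add scale_add)

lemma lc_dwlist: "lc (dwlist w) = dw w"
proof (induction w)
  case (Cons g w)
  have "lc (map (\<lambda>(c, v). (c, v @ w)) (dlist g)) = conc (dl g) (basis w)"
    using lc_map_image[of 1 "\<lambda>v. v @ w" "dlist g"] by (simp add: conc_extend dl_def)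
  moreover have "lc (map (\<lambda>(c, v). (- sg (gpar g) * c, g # v)) (dwlist w)) =
      - scale (gs g) (conc (basis [g]) (dw w))"
    using lc_map_image[of "- sg (gpar g)" "\<lambda>v. g # v" "dwlist w"] Cons
    by (simp add: conc_extend gs_def)
  ultimately show ?case by simp
qed simp

lemma dT_dl: "dT (dl g) = 0"
proof -
  have "lc (lext dwlist (dlist g)) = 0"
    by (rule lc_eq_0[OF collect_dwlist_dlist])
  then show ?thesis by (simp add: lc_dwlist dT_def dl_def)
qed

text \<open>The parity of the total degree, in which a letter g counts |g| - 1; hence one minus sign
  per letter.\<close>

definition wsgn :: "gam list \<Rightarrow> F3"
  where "wsgn w = (\<Prod>g\<leftarrow>w. - gs g)"

definition sigma :: "gam list lin \<Rightarrow> gam list lin"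
  where "sigma = extend (\<lambda>v. Poly_Mapping.single v (wsgn v))"

lemma dw_append: "dw (v @ w) = conc (dw v) (basis w) + scale (wsgn v) (conc (basis v) (dw w))"
proof (induction v)
  case (Cons g v)
  then show ?case
    by (simp add: conc_Cons[of g v] conc_diff conc_assoc conc_add conc_scale scale_diff scale_add
        wsgn_def conc_minus)
qed (simp add: wsgn_def)

lemma dT_conc: "dT (conc p q) = conc (dT p) q + conc (sigma p) (dT q)"
proof -
  have *: "dT (conc (basis v) q) = conc (dw v) q + conc (sigma (basis v)) (dT q)" for v
    using supp_UNIV[of q, unfolded supp_def mem_Collect_eq]
  proof (induction q rule: lin_induct)
    case (basis w)
    then show ?case
      by (simp add: dw_append sigma_def single_eq_scale[of _ "wsgn v"] conc_scale del: scale_simps(5))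
  qed (simp_all add: conc_add conc_scale scale_add)
  show ?thesis
    using supp_UNIV[of p, unfolded supp_def mem_Collect_eq]
  proof (induction p rule: lin_induct)
    case (basis v)
    then show ?case using * by simp
  qed (simp_all add: conc_add conc_scale scale_add sigma_def extend_add extend_scale)
qed

lemma dlist_props:
  assumes "(c, v) \<in> set (dlist g)"
  obtains a b where "v = [a, b]" "a \<noteq> gunit" "b \<noteq> gunit" "gdeg a + gdeg b = gdeg g"
    "gs a * gs b = gs g"
proof -
  obtain c' a b where "v = [a, b]" "(c', a, b) \<in> set (red g)"
    using assms by (auto simp: dlist_def)
  moreover have "a \<noteq> gunit \<and> b \<noteq> gunit \<and> gdeg a + gdeg b = gdeg g \<and> gpar g = (gpar a \<noteq> gpar b)"
    using red_props[of g] \<open>(c', a, b) \<in> set (red g)\<close> by (auto simp: list_all_iff)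
  moreover from this have "gs a * gs b = gs g"
    by (auto simp: gs_def sg_def)
  ultimately show ?thesis using that by blast
qed

lemma supp_lc:
  assumes "\<And>c a. (c, a) \<in> set xs \<Longrightarrow> a \<in> C"
  shows "lc xs \<in> supp C"
  using assms by (induction xs rule: lc.induct) (simp_all, metis supp_closed(2,6))

lemma dl_supp: "dl g \<in> supp {[a, b] |a b. a \<noteq> gunit \<and> b \<noteq> gunit \<and> gdeg a + gdeg b = gdeg g \<and>
    gs a * gs b = gs g}"
  unfolding dl_def
proof (rule supp_lc)
  fix c v assume "(c, v) \<in> set (dlist g)"
  then obtain a b where "v = [a, b]" "a \<noteq> gunit" "b \<noteq> gunit" "gdeg a + gdeg b = gdeg g"
    "gs a * gs b = gs g"
    by (rule dlist_props)
  then show "v \<in> {[a, b] |a b. a \<noteq> gunit \<and> b \<noteq> gunit \<and> gdeg a + gdeg b = gdeg g \<and>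
    gs a * gs b = gs g}" by blast
qed

lemma sigma_dl: "sigma (dl g) = scale (gs g) (dl g)"
proof -
  have "sigma (dl g) = extend (\<lambda>v. scale (gs g) (basis v)) (dl g)"
    unfolding sigma_def by (rule extend_cong_supp[OF dl_supp]) (auto simp: wsgn_def)
  then show ?thesis by (simp only: extend_fun_scale extend_basis)
qed

text \<open>By the Leibniz rule only d^2 on single letters remains: the two mixed terms cancel,
  since splitting a letter preserves the parity of its internal degree.\<close>

lemma dT_dw [simp]: "dT (dw w) = 0"
proof (induction w)
  case (Cons g w)
  have "sigma (basis [g]) = - scale (gs g) (basis [g])"
    by (simp add: sigma_def wsgn_def single_uminus)
  with Cons show ?case
    by (simp add: dT_conc dT_dl sigma_dl conc_scale conc_minus)
qed simp

lemma dT_dT [simp]: "dT (dT p) = 0"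
  using supp_UNIV[of p, unfolded supp_def mem_Collect_eq] by (induction p rule: lin_induct) auto

section \<open>A small differential module over the cobar complex\<close>

text \<open>\<open>(n0, n1, n2, k, e)\<close> stands for \<open>v\<^sub>0\<^sup>n\<^sup>0 v\<^sub>1\<^sup>n\<^sup>1 v\<^sub>2\<^sup>n\<^sup>2 \<beta>\<^sup>k \<alpha>\<^sup>e\<close>. The primitive operation dual to \<open>\<xi>\<^sub>1\<close>
  acts on \<open>F3[v\<^sub>0, v\<^sub>1, v\<^sub>2]\<close> as \<open>P = v\<^sub>0 \<partial>/\<partial>v\<^sub>1\<close>, and the differential is the periodic complex with
  maps \<open>P\<close> and \<open>P\<^sup>2\<close> alternately.\<close>

type_synonym mb = "nat \<times> nat \<times> nat \<times> nat \<times> bool"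

abbreviation munit :: mb
  where "munit \<equiv> (0, 0, 0, 0, False)"

text \<open>Choose xi_1 f = f alpha, xi_1^2 f = 0 and xi_1^2 (f alpha) = f beta. Then d[xi_1^2] =
  -[xi_1|xi_1] together with d f = P(f) alpha forces xi_1 (f alpha) = -P(f) beta.\<close>

fun act :: "gam \<Rightarrow> mb \<Rightarrow> mb lin"
  where "act g (n0, n1, n2, k, e) =
    (if g = gtau0 then basis (Suc n0, n1, n2, k, e)
     else if g = gtau1 then basis (n0, Suc n1, n2, k, e)
     else if g = gtau2 then basis (n0, n1, Suc n2, k, e)
     else if g = gxi then
       if e then Poly_Mapping.single (Suc n0, n1 - 1, n2, Suc k, False) (- of_nat n1)
       else basis (n0, n1, n2, k, True)
     else if g = gxi2 \<and> e then basis (n0, n1, n2, Suc k, False)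
     else 0)"

text \<open>Wherever \<open>n1 - 1\<close> or \<open>n1 - 2\<close> truncates, the coefficient is
  0.\<close>

fun dmb :: "mb \<Rightarrow> mb lin"
  where "dmb (n0, n1, n2, k, e) =
    (if e then Poly_Mapping.single (Suc (Suc n0), n1 - 2, n2, Suc k, False) (of_nat n1 * of_nat (n1 - 1))
     else Poly_Mapping.single (Suc n0, n1 - 1, n2, k, True) (of_nat n1))"

definition dM :: "mb lin \<Rightarrow> mb lin"
  where "dM = extend dmb"

lemma dM_simps [simp]:
  "dM 0 = 0" "dM (p + q) = dM p + dM q" "dM (p - q) = dM p - dM q" "dM (- p) = - dM p"
  "dM (scale c p) = scale c (dM p)" "dM (Poly_Mapping.single w c) = scale c (dmb w)"
  by (simp_all add: dM_def extend_add extend_diff extend_scale)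

fun actw :: "gam list \<Rightarrow> mb lin \<Rightarrow> mb lin"
  where
    "actw [] m = m"
  | "actw (g # w) m = extend (act g) (actw w m)"

definition actT :: "gam list lin \<Rightarrow> mb lin \<Rightarrow> mb lin"
  where "actT p m = extend (\<lambda>w. actw w m) p"

lemma actw_simps [simp]:
  "actw w 0 = 0" "actw w (m + n) = actw w m + actw w n" "actw w (scale c m) = scale c (actw w m)"
  by (induction w) (simp_all add: extend_add extend_scale)

lemma actw_append [simp]: "actw (v @ w) m = actw v (actw w m)"
  by (induction v) simp_all

lemma actT_simps [simp]:
  "actT 0 m = 0" "actT (p + q) m = actT p m + actT q m" "actT (p - q) m = actT p m - actT q m"
  "actT (- p) m = - actT p m" "actT (scale c p) m = scale c (actT p m)"
  "actT (Poly_Mapping.single w c) m = scale c (actw w m)"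
  by (simp_all add: actT_def extend_add extend_diff extend_scale)

lemma actT_simps_right [simp]:
  "actT p 0 = 0" "actT p (m + n) = actT p m + actT p n" "actT p (scale c m) = scale c (actT p m)"
  by (simp_all add: actT_def extend_fun_add extend_fun_scale)

lemma actT_minus_right [simp]: "actT p (- m) = - actT p m" "actT p (m - n) = actT p m - actT p n"
proof -
  show *: "actT p (- m) = - actT p m" for m
    using actT_simps_right(3)[of p "-1" m] by simp
  show "actT p (m - n) = actT p m - actT p n"
    using actT_simps_right(2)[of p m "- n"] by (simp add: *)
qed

lemma actT_conc [simp]: "actT (conc p q) m = actT p (actT q m)"
proof -
  have *: "actT (conc (basis v) q) m = actT (basis v) (actT q m)" for v
    using supp_UNIV[of q, unfolded supp_def mem_Collect_eq]
  proof (induction q rule: lin_induct)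
    case (basis w)
    show ?case by simp
  qed (simp_all add: conc_add conc_scale del: actT_simps(6))
  show ?thesis
    using supp_UNIV[of p, unfolded supp_def mem_Collect_eq]
  proof (induction p rule: lin_induct)
    case (basis v)
    show ?case by (rule *)
  qed (simp_all add: conc_add conc_scale)
qed

lemma F3_double: "(c::F3) + c = - c" "(2::F3) = - 1"
  using F3_cases[of c] by auto

lemmas gen_defs = gtau0_def gtau1_def gtau2_def gxi_def gxi2_def

text \<open>The only compatibility to be checked by cases; words follow letter by letter because T
  is free. The exponent \<open>n1\<close> is split into 0, 1 and larger to resolve the truncated
  subtractions.\<close>

lemma dM_act: "dM (act g b) = actT (dl g) (basis b) - scale (gs g) (extend (act g) (dmb b))"
proof -
  obtain n0 n1 n2 k e where b: "b = (n0, n1, n2, k, e)" by (cases b)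
  obtain a x0 x1 x2 where g: "g = (a, x0, x1, x2)" by (cases g)
  have "n1 = 0 \<or> n1 = Suc 0 \<or> (\<exists>m. n1 = Suc (Suc m))"
    by (metis not0_implies_Suc)
  then show ?thesis
    unfolding b g
    by (elim disjE exE; cases a; cases x0; cases x1; cases x2; cases e,
        simp_all add: dl_def dlist_def gen_defs sg_def gs_def single_uminus F3_double)
      (simp_all flip: single_add single_diff single_uminus add: F3_double algebra_simps)
qed

lemma dM_extend_act:
  "dM (extend (act g) m) = actT (dl g) m - scale (gs g) (extend (act g) (dM m))"
  using supp_UNIV[of m, unfolded supp_def mem_Collect_eq]
proof (induction m rule: lin_induct)
  case (basis b)
  show ?case by (simp add: dM_act del: act.simps dmb.simps)
qed (simp_all add: extend_add extend_scale scale_add scale_diff mult.commute)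

lemma dM_actw: "dM (actw w m) = actT (dw w) m + scale (wsgn w) (actw w (dM m))"
  by (induction w)
    (simp_all add: wsgn_def dM_extend_act extend_add extend_scale scale_add)

lemma dM_actT: "dM (actT p m) = actT (dT p) m + actT (sigma p) (dM m)"
  using supp_UNIV[of p, unfolded supp_def mem_Collect_eq]
proof (induction p rule: lin_induct)
  case (basis w)
  show ?case by (simp add: dM_actw sigma_def)
qed (simp_all add: sigma_def extend_add extend_scale scale_add)

definition ev :: "gam list lin \<Rightarrow> mb lin"
  where "ev p = actT p (basis munit)"

lemma dM_ev: "dM (ev p) = ev (dT p)"
  by (simp add: ev_def dM_actT)

lemma ev_simps [simp]:
  "ev 0 = 0" "ev (p + q) = ev p + ev q" "ev (p - q) = ev p - ev q"
  "ev (- p) = - ev p" "ev (scale c p) = scale c (ev p)" "ev (conc p q) = actT p (ev q)"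
  by (simp_all add: ev_def)

fun ms :: "mb \<Rightarrow> nat"
  where "ms (n0, n1, n2, k, e) = n0 + n1 + n2 + 2 * k + of_bool e"

fun mt :: "mb \<Rightarrow> nat"
  where "mt (n0, n1, n2, k, e) = n0 + 5 * n1 + 17 * n2 + 12 * k + 4 * of_bool e"

definition wdeg :: "gam list \<Rightarrow> nat"
  where "wdeg w = sum_list (map gdeg w)"

lemma act_supp: "act g b \<in> supp {b'. ms b' = Suc (ms b) \<and> mt b' = mt b + gdeg g}"
proof -
  obtain n0 n1 n2 k e where b: "b = (n0, n1, n2, k, e)" by (cases b)
  show ?thesis unfolding b by (cases n1) (auto simp: gen_defs intro!: supp_closed(6))
qed

lemma dmb_supp: "dmb b \<in> supp {b'. ms b' = Suc (ms b) \<and> mt b' = mt b}"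
proof -
  obtain n0 n1 n2 k e where b: "b = (n0, n1, n2, k, e)" by (cases b)
  have "n1 = 0 \<or> n1 = Suc 0 \<or> (\<exists>m. n1 = Suc (Suc m))"
    by (metis not0_implies_Suc)
  then show ?thesis unfolding b by (elim disjE exE; cases e) simp_all
qed

lemma actw_supp:
  "m \<in> supp {b. ms b = s \<and> mt b = t} \<Longrightarrow>
    actw w m \<in> supp {b. ms b = length w + s \<and> mt b = wdeg w + t}"
proof (induction w)
  case (Cons g w)
  show ?case
    unfolding actw.simps
    by (rule supp_extend[OF Cons.IH[OF Cons.prems]], rule supp_mono[OF act_supp])
      (auto simp: wdeg_def)
qed (simp add: wdeg_def)

lemma dw_supp:
  assumes "w \<in> lists (- {gunit})"
  shows "dw w \<in> supp {v \<in> lists (- {gunit}). length v = Suc (length w) \<and> wdeg v = wdeg w}"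
  using assms
proof (induction w rule: list.induct)
  case (Cons g w)
  let ?C = "{v \<in> lists (- {gunit}). length v = Suc (length (g # w)) \<and> wdeg v = wdeg (g # w)}"
  have w: "g \<noteq> gunit" "gunit \<notin> set w"
    using Cons.prems by auto
  have "conc (dl g) (basis w) \<in> supp ?C"
    unfolding conc_extend
  proof (rule supp_extend[OF dl_supp], rule supp_closed(6))
    fix v assume "v \<in> {[a, b] |a b. a \<noteq> gunit \<and> b \<noteq> gunit \<and> gdeg a + gdeg b = gdeg g \<and> gs a * gs b = gs g}"
    then obtain a b where "v = [a, b]" "a \<noteq> gunit" "b \<noteq> gunit" "gdeg a + gdeg b = gdeg g" by blast
    then show "v @ w \<in> ?C" using w by (simp add: wdeg_def in_lists_conv_set) (metis w(2))
  qed
  moreover have "conc (basis [g]) (dw w) \<in> supp ?C"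
    unfolding conc_extend
  proof (rule supp_extend[OF Cons.IH], goal_cases)
    case (2 v)
    with w show ?case by (intro supp_closed(6)) (auto simp: wdeg_def)
  qed (use Cons.prems in auto)
  ultimately show ?case by simp
qed simp

section \<open>The twisted tensor product with the Hopf algebra\<close>

definition tn :: "gam \<Rightarrow> mb lin \<Rightarrow> (gam \<times> mb) lin"
  where "tn g m = extend (\<lambda>b. basis (g, b)) m"

lemma tn_simps [simp]:
  "tn g 0 = 0" "tn g (m + n) = tn g m + tn g n" "tn g (m - n) = tn g m - tn g n"
  "tn g (- m) = - tn g m" "tn g (scale c m) = scale c (tn g m)"
  "tn g (Poly_Mapping.single b c) = Poly_Mapping.single (g, b) c"
  by (simp_all add: tn_def extend_add extend_diff extend_scale)

text \<open>Nonempty words form the tensor product of the coideal of Gamma with T; this map lets the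
  second factor act on \<open>m\<close>. The empty word lies outside that tensor product.\<close>

fun qw :: "gam list \<Rightarrow> mb lin \<Rightarrow> (gam \<times> mb) lin"
  where
    "qw [] m = 0"
  | "qw (g # w) m = tn g (actw w m)"

definition qT :: "gam list lin \<Rightarrow> mb lin \<Rightarrow> (gam \<times> mb) lin"
  where "qT p m = extend (\<lambda>w. qw w m) p"

lemma qw_simps [simp]:
  "qw w 0 = 0" "qw w (m + n) = qw w m + qw w n" "qw w (scale c m) = scale c (qw w m)"
  by (cases w; simp)+

lemma qT_simps [simp]:
  "qT 0 m = 0" "qT (p + q) m = qT p m + qT q m" "qT (p - q) m = qT p m - qT q m"
  "qT (- p) m = - qT p m" "qT (scale c p) m = scale c (qT p m)"
  "qT (Poly_Mapping.single w c) m = scale c (qw w m)"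
  by (simp_all add: qT_def extend_add extend_diff extend_scale)

lemma qT_simps_right [simp]:
  "qT p 0 = 0" "qT p (m + n) = qT p m + qT p n" "qT p (scale c m) = scale c (qT p m)"
  by (simp_all add: qT_def extend_fun_add extend_fun_scale)

lemma qT_conc_letter: "qT (conc (basis [g]) p) m = tn g (actT p m)"
  using supp_UNIV[of p, unfolded supp_def mem_Collect_eq]
  by (induction p rule: lin_induct) (simp_all add: conc_add conc_scale)

lemma qT_conc_dl: "qT (conc (dl g) (basis w)) m = qT (dl g) (actw w m)"
proof -
  have "extend (\<lambda>v. qw (v @ w) m) (dl g) = extend (\<lambda>v. qw v (actw w m)) (dl g)"
    by (rule extend_cong_supp[OF dl_supp]) auto
  then show ?thesis by (simp add: conc_extend qT_def extend_extend)
qed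

text \<open>The signs are chosen so that \<open>qe\<close> below anticommutes with the differentials up to a term
  supported on the unit of the Hopf algebra.\<close>

definition Db :: "gam \<times> mb \<Rightarrow> (gam \<times> mb) lin"
  where "Db = (\<lambda>(g, b). scale (gs g) (tn g (dmb b)) - tn gunit (act g b) - qT (dl g) (basis b))"

definition D :: "(gam \<times> mb) lin \<Rightarrow> (gam \<times> mb) lin"
  where "D = extend Db"

lemma D_simps [simp]:
  "D 0 = 0" "D (p + q) = D p + D q" "D (p - q) = D p - D q" "D (- p) = - D p"
  "D (scale c p) = scale c (D p)" "D (Poly_Mapping.single w c) = scale c (Db w)"
  by (simp_all add: D_def extend_add extend_diff extend_scale)

lemma D_tn: "D (tn g m) = scale (gs g) (tn g (dM m)) - tn gunit (extend (act g) m) - qT (dl g) m"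
  using supp_UNIV[of m, unfolded supp_def mem_Collect_eq]
proof (induction m rule: lin_induct)
  case (basis b)
  show ?case by (simp add: Db_def del: act.simps dmb.simps)
qed (simp_all add: extend_add extend_scale scale_add scale_diff mult.commute)

definition qe :: "gam list lin \<Rightarrow> (gam \<times> mb) lin"
  where "qe p = qT p (basis munit)"

lemma qe_simps [simp]:
  "qe 0 = 0" "qe (p + q) = qe p + qe q" "qe (p - q) = qe p - qe q"
  "qe (- p) = - qe p" "qe (scale c p) = scale c (qe p)"
  by (simp_all add: qe_def)

lemma qe_letter: "qe (conc (basis [g]) p) = tn g (ev p)"
  by (simp add: qe_def qT_conc_letter ev_def)

text \<open>On a word g v, the unit term of \<open>Db\<close> is g acting on \<open>ev v\<close>,
  which is the image of g v. The other two terms are the two halves of d(g v), splitting g and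
  differentiating v, with reversed sign.\<close>

lemma D_qe:
  assumes "p \<in> supp (- {[]})"
  shows "D (qe p) = - tn gunit (ev p) - qe (dT p)"
  using assms unfolding supp_def mem_Collect_eq
proof (induction p rule: lin_induct)
  case (basis w)
  then obtain g v where w: "w = g # v" by (cases w) auto
  have "dM (actw v (basis munit)) = actT (dw v) (basis munit)"
    by (simp add: dM_actw)
  then show ?case
    unfolding w by (simp add: qe_def ev_def D_tn qT_conc_dl qT_conc_letter algebra_simps)
qed (simp_all add: scale_add scale_diff)

text \<open>A word for each monomial of M. The letters xi_1^2, xi_1 produce beta because xi_1
  creates alpha, which xi_1^2 turns into beta.\<close>

fun lift :: "mb \<Rightarrow> gam list"
  where "lift (n0, n1, n2, k, e) = replicate n0 gtau0 @ replicate n1 gtau1 @ replicate n2 gtau2 @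
    (if e then [gxi] else []) @ concat (replicate k [gxi2, gxi])"

lemma ev_lift: "actw (lift b) (basis munit) = basis b"
proof -
  have "actw (concat (replicate k [gxi2, gxi])) (basis munit) = basis (0, 0, 0, k, False)" for k
    by (induction k) (simp_all add: gen_defs)
  moreover have "actw (replicate n gtau2) (basis (0, 0, 0, k, e)) = basis (0, 0, n, k, e)" for n k e
    by (induction n) (simp_all add: gen_defs)
  moreover have "actw (replicate n gtau1) (basis (0, 0, n2, k, e)) = basis (0, n, n2, k, e)" for n n2 k e
    by (induction n) (simp_all add: gen_defs)
  moreover have "actw (replicate n gtau0) (basis (0, n1, n2, k, e)) = basis (n, n1, n2, k, e)" for n n1 n2 k e
    by (induction n) (simp_all add: gen_defs)
  ultimately show ?thesis
    by (cases b) (auto simp: gen_defs)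
qed

lemma wdeg_lift: "wdeg (lift b) = mt b"
proof -
  have "sum_list (map gdeg (concat (replicate k [gxi2, gxi]))) = 12 * k" for k
    by (induction k) (simp_all add: gen_defs)
  then show ?thesis
    by (cases b) (simp add: wdeg_def gen_defs sum_list_replicate)
qed

lemma lift_letters: "lift b \<in> lists (- {gunit})"
  by (cases b) (auto simp: gen_defs set_replicate_conv_if split: if_splits)

definition liftL :: "(gam \<times> mb) lin \<Rightarrow> gam list lin"
  where "liftL = extend (\<lambda>(g, b). if g = gunit then 0 else basis (g # lift b))"

definition lift0 :: "(gam \<times> mb) lin \<Rightarrow> gam list lin"
  where "lift0 = extend (\<lambda>(g, b). if g = gunit then basis (lift b) else 0)"

text \<open>Every element of Gamma tensor M comes from words, apart from its part over the unit of
  Gamma. A bounding chain found there can thus be carried back to T.\<close>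

lemma lift_decomp: "y = tn gunit (ev (lift0 y)) + qe (liftL y)"
  using supp_UNIV[of y, unfolded supp_def mem_Collect_eq]
proof (induction y rule: lin_induct)
  case (basis y)
  show ?case
    by (cases y) (auto simp: lift0_def liftL_def qe_def ev_def ev_lift simp del: lift.simps)
next
  case (scale c p)
  have "tn gunit (ev (lift0 (scale c p))) + qe (liftL (scale c p)) =
    scale c (tn gunit (ev (lift0 p)) + qe (liftL p))"
    by (simp add: lift0_def liftL_def extend_scale scale_add)
  then show ?case by (simp only: scale[symmetric])
qed (simp_all add: lift0_def liftL_def extend_add add_ac)

lemma liftL_nonempty: "liftL y \<in> supp (- {[]})"
  unfolding liftL_def by (rule supp_extend[of y UNIV]) auto

lemma dT_nonempty: "p \<in> supp (lists (- {gunit})) \<Longrightarrow> dT p \<in> supp (- {[]})"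
  unfolding dT_def by (rule supp_extend, assumption, rule supp_mono[OF dw_supp]) auto

lemma D_tn_unit: "D (tn gunit m) = tn gunit (dM m)"
proof -
  have "extend (act gunit) m = 0"
    using supp_UNIV[of m, unfolded supp_def mem_Collect_eq]
    by (induction m rule: lin_induct) (auto simp: extend_add extend_scale gen_defs)
  then show ?thesis
    by (simp add: D_tn gs_def sg_def dl_def dlist_def)
qed

lemma liftL_letters: "liftL y \<in> supp (lists (- {gunit}))"
  unfolding liftL_def by (rule supp_extend[of y UNIV]) (auto simp: lift_letters simp del: lift.simps)

lemma lift0_letters: "lift0 y \<in> supp (lists (- {gunit}))"
  unfolding lift0_def by (rule supp_extend[of y UNIV]) (auto simp: lift_letters simp del: lift.simps)

lemma D_decomp: "D y = tn gunit (ev (dT (lift0 y) - liftL y)) - qe (dT (liftL y))"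
proof -
  have "D y = D (tn gunit (ev (lift0 y)) + qe (liftL y))"
    using lift_decomp[of y] by simp
  also have "\<dots> = tn gunit (ev (dT (lift0 y) - liftL y)) - qe (dT (liftL y))"
    unfolding D_simps(2) D_tn_unit D_qe[OF liftL_nonempty] by (simp add: dM_ev)
  finally show ?thesis .
qed

text \<open>Inherited from d^2 = 0 on words, since \<open>D_decomp\<close> expresses
  \<open>D y\<close> through words; the two terms over the unit cancel.\<close>

lemma D_D [simp]: "D (D y) = 0"
  unfolding D_decomp[of y] D_simps D_tn_unit
  by (simp add: dM_ev D_qe[OF dT_nonempty[OF liftL_letters]])

text \<open>The leading part of the differential \<^const>\<open>D\<close>: a tensor product of three Koszul complexes
  and of the periodic complex.\<close>

fun D0b :: "gam \<times> mb \<Rightarrow> (gam \<times> mb) lin"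
  where "D0b ((a, x0, x1, x2), (n0, n1, n2, k, e)) =
    (if x0 then - basis ((a, False, x1, x2), (Suc n0, n1, n2, k, e)) else 0)
    + (if x1 then Poly_Mapping.single ((a, x0, False, x2), (n0, Suc n1, n2, k, e)) (- of_int (sg x0)) else 0)
    + (if x2 then Poly_Mapping.single ((a, x0, x1, False), (n0, n1, Suc n2, k, e)) (- of_int (sg (x0 \<noteq> x1))) else 0)
    + (if e then if a = H2 then Poly_Mapping.single ((H0, x0, x1, x2), (n0, n1, n2, Suc k, False))
           (- of_int (sg (x0 \<noteq> (x1 \<noteq> x2)))) else 0
       else if a = H0 then 0
       else Poly_Mapping.single ((if a = H2 then H1 else H0, x0, x1, x2), (n0, n1, n2, k, True))
           (of_int (sg ((a = H2) = (x0 \<noteq> (x1 \<noteq> x2))))))"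

text \<open>The usual contraction of a tensor product: the first factor not at its unit is
  contracted, in the order tau_0, tau_1, tau_2, xi_1. One v_i is traded for tau_i without dividing
  by the exponent, so it works in characteristic 3.\<close>

fun Sb :: "gam \<times> mb \<Rightarrow> (gam \<times> mb) lin"
  where "Sb ((a, x0, x1, x2), (n0, n1, n2, k, e)) =
    (if x0 then 0
     else if n0 \<noteq> 0 then - basis ((a, True, x1, x2), (n0 - 1, n1, n2, k, e))
     else if x1 then 0
     else if n1 \<noteq> 0 then - basis ((a, False, True, x2), (0, n1 - 1, n2, k, e))
     else if x2 then 0
     else if n2 \<noteq> 0 then - basis ((a, False, False, True), (0, 0, n2 - 1, k, e))
     else if e then
       if a = H0 then - basis ((H1, False, False, False), (0, 0, 0, k, False))
       else if a = H1 then basis ((H2, False, False, False), (0, 0, 0, k, False))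
       else 0
     else if a = H0 \<and> k \<noteq> 0 then - basis ((H2, False, False, False), (0, 0, 0, k - 1, True))
     else 0)"

text \<open>The leading part trades tau_0 for v_0 and preserves this weight. The remaining terms
  come from xi_1 tensor tau_0 in the coproduct of tau_1 or from P, and each creates a new
  v_0.\<close>

fun wt :: "gam \<times> mb \<Rightarrow> nat"
  where "wt ((a, x0, x1, x2), (n0, n1, n2, k, e)) = of_bool x0 + n0"

fun td :: "gam \<times> mb \<Rightarrow> nat"
  where "td (g, b) = gdeg g + mt b"

text \<open>The one monomial that \<open>Sb\<close> does not contract.\<close>

definition yunit :: "gam \<times> mb"
  where "yunit = (gunit, munit)"

lemma wt_yunit [simp]: "wt yunit = 0"
  by (simp add: yunit_def)

lemma D0b_Sb:
  assumes "y \<noteq> yunit"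
  shows "extend D0b (Sb y) + extend Sb (D0b y) = basis y"
proof -
  obtain a x0 x1 x2 n0 n1 n2 k e where y: "y = ((a, x0, x1, x2), (n0, n1, n2, k, e))"
    by (metis prod.exhaust)
  \<comment> \<open>The cases follow the branches of \<open>Sb\<close>.\<close>
  consider "x0" | "\<not> x0" "n0 \<noteq> 0" | "\<not> x0" "n0 = 0" "x1" | "\<not> x0" "n0 = 0" "\<not> x1" "n1 \<noteq> 0"
    | "\<not> x0" "n0 = 0" "\<not> x1" "n1 = 0" "x2" | "\<not> x0" "n0 = 0" "\<not> x1" "n1 = 0" "\<not> x2" "n2 \<noteq> 0"
    | "\<not> x0" "n0 = 0" "\<not> x1" "n1 = 0" "\<not> x2" "n2 = 0"
    by blast
  then show ?thesis
  proof cases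
    case 1
    then show ?thesis unfolding y by (simp add: extend_add extend_diff sg_def single_uminus)
  next
    case 2
    then show ?thesis unfolding y by (simp add: extend_add extend_diff sg_def single_uminus)
  next
    case 3
    then show ?thesis unfolding y by (simp add: extend_add extend_diff sg_def single_uminus)
  next
    case 4
    then show ?thesis unfolding y by (simp add: extend_add extend_diff sg_def single_uminus)
  next
    case 5
    then show ?thesis unfolding y by (simp add: extend_add extend_diff sg_def single_uminus)
  next
    case 6
    then show ?thesis unfolding y by (simp add: extend_add extend_diff sg_def single_uminus)
  next
    case 7
    then show ?thesis using assms unfolding y by (cases a) (auto simp: yunit_def extend_add extend_diff sg_def single_uminus)
  qed
qed

lemma Sb_supp: "Sb y \<in> supp {z. wt z = wt y \<and> td z = td y}"
proof -
  obtain a x0 x1 x2 n0 n1 n2 k e where y: "y = ((a, x0, x1, x2), (n0, n1, n2, k, e))"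
    by (metis prod.exhaust)
  show ?thesis unfolding y by (auto intro!: supp_closed(4,6))
qed

lemma Db_D0b: "Db y - D0b y \<in> supp {z. wt y < wt z}"
proof -
  obtain a x0 x1 x2 n0 n1 n2 k e where y: "y = ((a, x0, x1, x2), (n0, n1, n2, k, e))"
    by (metis prod.exhaust)
  show ?thesis unfolding y
    by (cases a; cases x0; cases x1; cases x2; cases e)
      (simp_all add: Db_def dl_def dlist_def gen_defs sg_def gs_def single_uminus F3_double)
qed

lemma tn_supp: "m \<in> supp {b. mt b = t} \<Longrightarrow> tn g m \<in> supp {z. td z = gdeg g + t}"
  unfolding tn_def by (erule supp_extend) auto

lemma Db_supp: "Db y \<in> supp {z. td z = td y}"
proof -
  obtain g b where y: "y = (g, b)" by (cases y)
  have "dmb b \<in> supp {b'. mt b' = mt b}"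
    by (rule supp_mono[OF dmb_supp]) auto
  from tn_supp[OF this, of g] have 1: "tn g (dmb b) \<in> supp {z. td z = td y}"
    by (simp add: y)
  have "act g b \<in> supp {b'. mt b' = gdeg g + mt b}"
    by (rule supp_mono[OF act_supp]) auto
  from tn_supp[OF this, of gunit] have 2: "tn gunit (act g b) \<in> supp {z. td z = td y}"
    by (simp add: y)
  have 3: "qT (dl g) (basis b) \<in> supp {z. td z = td y}"
    unfolding qT_def
  proof (rule supp_extend[OF dl_supp])
    fix w assume "w \<in> {[a, b] |a b. a \<noteq> gunit \<and> b \<noteq> gunit \<and> gdeg a + gdeg b = gdeg g \<and> gs a * gs b = gs g}"
    then obtain a c where w: "w = [a, c]" "gdeg a + gdeg c = gdeg g" by blast
    have "act c b \<in> supp {b'. mt b' = gdeg c + mt b}"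
      by (rule supp_mono[OF act_supp]) auto
    moreover have "gdeg a + (gdeg c + mt b) = td y" using w by (simp add: y)
    ultimately show "qw w (basis b) \<in> supp {z. td z = td y}"
      using tn_supp[of "act c b" "gdeg c + mt b" a] by (simp add: w)
  qed
  show ?thesis using 1 2 3 by (simp add: y Db_def)
qed

lemma wt_le_td: "wt y \<le> td y"
  by (cases y rule: wt.cases) simp

text \<open>Since \<open>Sb\<close> contracts the leading part exactly, the defect comes from
  \<open>Db\<close> minus \<open>D0b\<close> and raises \<open>wt\<close>. Positive weight also
  keeps it away from \<open>yunit\<close>.\<close>

lemma homotopy_supp:
  assumes "y \<in> supp {z. z \<noteq> yunit \<and> w \<le> wt z \<and> td z \<le> t}"
  shows "D (extend Sb y) + extend Sb (D y) - y \<in> supp {z. z \<noteq> yunit \<and> Suc w \<le> wt z \<and> td z \<le> t}"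
proof -
  let ?N = "\<lambda>z. D (Sb z) + extend Sb (Db z) - basis z"
  have N: "?N z \<in> supp {z. z \<noteq> yunit \<and> Suc w \<le> wt z \<and> td z \<le> t}"
    if "z \<noteq> yunit" "w \<le> wt z" "td z \<le> t" for z
  proof -
    let ?W = "{z'. wt z < wt z'}" and ?T = "{z'. td z' = td z}"
    have "?N z = extend (\<lambda>b. Db b - D0b b) (Sb z) + extend Sb (Db z - D0b z)"
      using D0b_Sb[OF that(1)] by (simp add: D_def extend_fun_diff extend_diff algebra_simps)
    moreover have "extend (\<lambda>b. Db b - D0b b) (Sb z) \<in> supp ?W"
      by (rule supp_extend[OF Sb_supp], rule supp_mono[OF Db_D0b]) auto
    moreover have "extend Sb (Db z - D0b z) \<in> supp ?W"
      by (rule supp_extend[OF Db_D0b], rule supp_mono[OF Sb_supp]) auto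
    ultimately have W: "?N z \<in> supp ?W" by simp
    have "D (Sb z) \<in> supp ?T"
      unfolding D_def by (rule supp_extend[OF Sb_supp], rule supp_mono[OF Db_supp]) auto
    moreover have "extend Sb (Db z) \<in> supp ?T"
      by (rule supp_extend[OF Db_supp], rule supp_mono[OF Sb_supp]) auto
    ultimately have T: "?N z \<in> supp ?T" by simp
    have "?N z \<in> supp (?W \<inter> ?T)"
      using W T by (simp only: supp_iff) blast
    then show ?thesis by (rule supp_mono) (use that in \<open>auto simp del: wt.simps td.simps\<close>)
  qed
  have "extend ?N y \<in> supp {z. z \<noteq> yunit \<and> Suc w \<le> wt z \<and> td z \<le> t}"
    by (rule supp_extend[OF assms], rule N) blast+
  moreover have "extend ?N y = D (extend Sb y) + extend Sb (D y) - y"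
    by (simp add: extend_fun_add extend_fun_diff D_def extend_extend)
  ultimately show ?thesis by simp
qed

text \<open>Each step of the homotopy pushes a cycle into higher powers of \<open>v\<^sub>0\<close>, which are bounded by
  the internal degree.\<close>

lemma D_acyclic:
  assumes "y \<in> supp {z. z \<noteq> yunit \<and> w \<le> wt z \<and> td z \<le> t}" "D y = 0"
  obtains x where "x \<in> supp {z. td z \<le> t}" "D x = y"
proof -
  have "\<exists>x\<in>supp {z. td z \<le> t}. D x = y"
    using assms
  proof (induction "Suc t - w" arbitrary: w y)
    case 0
    have "{z. z \<noteq> yunit \<and> w \<le> wt z \<and> td z \<le> t} = {}"
    proof -
      have "\<not> (w \<le> wt z \<and> td z \<le> t)" for z
        using 0(1) wt_le_td[of z] by linarith
      then show ?thesis by blast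
    qed
    with 0(2) have "y = 0" by (simp add: supp_def)
    then show ?case by (intro bexI[of _ 0]) auto
  next
    case (Suc n)
    let ?N = "D (extend Sb y) - y"
    have "?N \<in> supp {z. z \<noteq> yunit \<and> Suc w \<le> wt z \<and> td z \<le> t}"
      using homotopy_supp[OF Suc.prems(1)] Suc.prems(2) by simp
    moreover have "n = Suc t - Suc w" using Suc.hyps(2) by arith
    moreover have "D ?N = 0" using Suc.prems(2) by simp
    ultimately obtain x where x: "x \<in> supp {z. td z \<le> t}" "D x = ?N"
      using Suc.hyps(1)[of "Suc w" ?N] \<open>n = Suc t - Suc w\<close> by blast
    have "extend Sb y \<in> supp {z. td z \<le> t}"
      by (rule supp_extend[OF Suc.prems(1)], rule supp_mono[OF Sb_supp]) auto
    with x show ?case by (intro bexI[of _ "extend Sb y - x"]) auto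
  qed
  then show ?thesis using that by blast
qed

section \<open>Acyclicity of the kernel of the evaluation\<close>

definition LT :: "gam list set"
  where "LT = lists (- {gunit})"

text \<open>An ordering in which splitting a letter yields a smaller first letter. Degree alone has
  ties, such as xi_1 tau_0 and tau_1 in degree 5. The power of xi_1, at most 2, breaks them, and the
  factor 3 keeps degree dominant.\<close>

definition rank :: "gam \<Rightarrow> nat"
  where "rank g = 3 * gdeg g + hnat (fst g)"

lemma rank_inj: "rank g = rank h \<Longrightarrow> g = h"
proof -
  have "distinct (map rank gams)" unfolding rank_def gams_def by code_simp
  then show "rank g = rank h \<Longrightarrow> g = h"
    using gams_complete by (auto simp: distinct_map inj_on_def)
qed

lemma gdeg_pos: "g \<noteq> gunit \<Longrightarrow> 0 < gdeg g"
proof (cases g)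
  case (fields a x0 x1 x2)
  then show "g \<noteq> gunit \<Longrightarrow> ?thesis" by (cases a; cases x0; cases x1; cases x2) simp_all
qed

lemma wdeg_pos: "w \<in> LT \<Longrightarrow> w \<noteq> [] \<Longrightarrow> 0 < wdeg w"
  unfolding LT_def using gdeg_pos by (cases w) (auto simp: wdeg_def)

lemma dl_heads: "dl g \<in> supp {[a, b] |a b. b \<noteq> gunit \<and> a \<noteq> gunit \<and> rank a < rank g \<and> gdeg a + gdeg b = gdeg g}"
proof (rule supp_mono[OF dl_supp])
  have "rank a < rank g" if "b \<noteq> gunit" "gdeg a + gdeg b = gdeg g" for a b
  proof -
    have "hnat (fst a) \<le> 2" by (cases "fst a") auto
    with gdeg_pos[OF that(1)] that(2) show ?thesis by (simp add: rank_def)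
  qed
  then show "{[a, b] |a b. a \<noteq> gunit \<and> b \<noteq> gunit \<and> gdeg a + gdeg b = gdeg g \<and> gs a * gs b = gs g}
    \<subseteq> {[a, b] |a b. b \<noteq> gunit \<and> a \<noteq> gunit \<and> rank a < rank g \<and> gdeg a + gdeg b = gdeg g}" by blast
qed

text \<open>Nonempty words have positive degree, so only the empty word reaches the unit of M. An
  element of the kernel of \<open>ev\<close> therefore has no constant term.\<close>

lemma lookup_ev_munit:
  assumes "p \<in> supp LT"
  shows "Poly_Mapping.lookup (ev p) munit = Poly_Mapping.lookup p []"
  using assms unfolding supp_def mem_Collect_eq
proof (induction p rule: lin_induct)
  case (basis w)
  have "actw w (basis munit) \<in> supp {b. ms b = length w + 0 \<and> mt b = wdeg w + 0}"
    by (rule actw_supp) simp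
  then have "w \<noteq> [] \<Longrightarrow> Poly_Mapping.lookup (actw w (basis munit)) munit = 0"
    using wdeg_pos[OF basis] by (auto simp: supp_iff)
  then show ?case by (auto simp: ev_def lookup_single when_def)
qed (simp_all add: lookup_add lookup_scale)

lemma supp_disjoint: "p \<in> supp A \<Longrightarrow> p \<in> supp B \<Longrightarrow> A \<inter> B = {} \<Longrightarrow> p = 0"
  by (rule poly_mapping_eqI) (auto simp: supp_iff)

lemma tn_heads: "tn g m \<in> supp {z. fst z = g}"
  unfolding tn_def by (rule supp_extend[of m UNIV]) auto

lemma lookup_tn: "Poly_Mapping.lookup (tn g m) (g, b) = Poly_Mapping.lookup m b"
  using supp_UNIV[of m, unfolded supp_def mem_Collect_eq]
  by (induction m rule: lin_induct) (auto simp: lookup_add lookup_scale lookup_single when_def)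

lemma tn_eq_0: "tn g m = 0 \<longleftrightarrow> m = 0"
proof
  assume "tn g m = 0"
  then show "m = 0" by (intro poly_mapping_eqI) (metis lookup_tn lookup_zero)
qed simp

lemma qe_supp:
  assumes "p \<in> supp {w \<in> LT. w \<noteq> [] \<and> wdeg w \<le> t \<and> P (hd w)}"
  shows "qe p \<in> supp {z. fst z \<noteq> gunit \<and> P (fst z) \<and> td z \<le> t}"
  unfolding qe_def qT_def
proof (rule supp_extend[OF assms])
  fix w assume w: "w \<in> {w \<in> LT. w \<noteq> [] \<and> wdeg w \<le> t \<and> P (hd w)}"
  then obtain g v where gv: "w = g # v" by (cases w) auto
  have "actw v (basis munit) \<in> supp {b. ms b = length v + 0 \<and> mt b = wdeg v + 0}"
    by (rule actw_supp) simp
  then have "tn g (actw v (basis munit)) \<in> supp {z. fst z \<noteq> gunit \<and> P (fst z) \<and> td z \<le> t}"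
    unfolding tn_def using w gv
    by (elim supp_extend) (intro supp_closed(6), auto simp: wdeg_def LT_def)
  then show "qw w (basis munit) \<in> supp {z. fst z \<noteq> gunit \<and> P (fst z) \<and> td z \<le> t}"
    by (simp add: gv)
qed

section \<open>Splitting words at their first letter\<close>

definition strip :: "gam \<Rightarrow> gam list lin \<Rightarrow> gam list lin"
  where "strip g = extend (\<lambda>w. if w \<noteq> [] \<and> hd w = g then basis (tl w) else 0)"

lemma strip_simps [simp]:
  "strip g 0 = 0" "strip g (p + q) = strip g p + strip g q" "strip g (p - q) = strip g p - strip g q"
  "strip g (- p) = - strip g p" "strip g (scale c p) = scale c (strip g p)"
  by (simp_all add: strip_def extend_add extend_diff extend_scale)

lemma strip_letter: "strip g (conc (basis [g]) p) = p"
  by (simp add: strip_def conc_extend extend_extend)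

lemma strip_other:
  assumes "p \<in> supp {w. w \<noteq> [] \<longrightarrow> hd w \<noteq> g}"
  shows "strip g p = 0"
proof -
  have "strip g p = extend (\<lambda>w. 0) p"
    unfolding strip_def by (rule extend_cong_supp[OF assms]) auto
  then show ?thesis by simp
qed

lemma strip_split: "p - conc (basis [g]) (strip g p) \<in> supp {w. w \<in> Poly_Mapping.keys p \<and> (w \<noteq> [] \<longrightarrow> hd w \<noteq> g)}"
proof -
  have "p - conc (basis [g]) (strip g p) =
      extend (\<lambda>w. basis w - (if w \<noteq> [] \<and> hd w = g then basis w else 0)) p"
    unfolding extend_fun_diff extend_basis strip_def conc_extend extend_extend
    by (intro arg_cong2[of _ _ _ _ "(-)"] refl extend_cong) auto
  also have "\<dots> \<in> supp {w. w \<in> Poly_Mapping.keys p \<and> (w \<noteq> [] \<longrightarrow> hd w \<noteq> g)}"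
    by (rule supp_extend[of p "Poly_Mapping.keys p"]) (auto simp: supp_def)
  finally show ?thesis .
qed

lemma dw_heads: "dw w \<in> supp {v. v \<noteq> [] \<and> rank (hd v) \<le> rank (hd w)}"
proof (cases w)
  case (Cons g u)
  have "conc (dl g) (basis u) \<in> supp {v. v \<noteq> [] \<and> rank (hd v) \<le> rank (hd w)}"
    unfolding conc_extend by (rule supp_extend[OF dl_heads]) (auto simp: Cons)
  moreover have "conc (basis [g]) (dw u) \<in> supp {v. v \<noteq> [] \<and> rank (hd v) \<le> rank (hd w)}"
    unfolding conc_extend by (rule supp_extend[of _ UNIV]) (auto simp: Cons)
  ultimately show ?thesis by (simp add: Cons)
qed simp

lemma dT_letter: "dT (conc (basis [g]) p) = conc (dl g) p - scale (gs g) (conc (basis [g]) (dT p))"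
proof -
  have "sigma (basis [g]) = - scale (gs g) (basis [g])"
    by (simp add: sigma_def wsgn_def single_uminus)
  note sigma = this
  show ?thesis unfolding dT_conc sigma conc_minus conc_scale by simp
qed

definition LTd :: "nat \<Rightarrow> gam list lin set"
  where "LTd t = supp {w \<in> LT. wdeg w \<le> t}"

lemma dT_LTd: "p \<in> LTd t \<Longrightarrow> dT p \<in> LTd t"
  unfolding LTd_def dT_def
  by (erule supp_extend, rule supp_mono[OF dw_supp]) (auto simp: LT_def)

lemma LTd_closed [intro]:
  "0 \<in> LTd t" "p \<in> LTd t \<Longrightarrow> q \<in> LTd t \<Longrightarrow> p + q \<in> LTd t"
  "p \<in> LTd t \<Longrightarrow> q \<in> LTd t \<Longrightarrow> p - q \<in> LTd t" "p \<in> LTd t \<Longrightarrow> scale c p \<in> LTd t"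
  unfolding LTd_def by auto

lemma qe_conc_dl: "qe (conc (dl g) p) = qT (dl g) (ev p)"
  unfolding qe_def ev_def using supp_UNIV[of p, unfolded supp_def mem_Collect_eq]
  by (induction p rule: lin_induct) (simp_all add: conc_add conc_scale qT_conc_dl)

text \<open>The letters of largest rank are removed from the front one after the other; the
  complementary factor is a cycle of the kernel of smaller internal degree.\<close>

lemma peel:
  assumes IH: "\<And>t' c. t' < t \<Longrightarrow> c \<in> LTd t' \<Longrightarrow> dT c = 0 \<Longrightarrow> ev c = 0 \<Longrightarrow>
      \<exists>j\<in>LTd t'. dT j = c \<and> ev j = 0"
    and "c \<in> supp {w \<in> LT. w \<noteq> [] \<and> wdeg w \<le> t \<and> rank (hd w) < n}" "dT c = 0" "qe c = 0"
  shows "\<exists>j\<in>LTd t. dT j = c \<and> ev j = 0"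
  using assms(2-)
proof (induction n arbitrary: c)
  case 0
  then have "c = 0" by (simp add: supp_def)
  then show ?case by (intro bexI[of _ 0]) auto
next
  case (Suc n)
  let ?S = "\<lambda>n. {w \<in> LT. w \<noteq> [] \<and> wdeg w \<le> t \<and> rank (hd w) < n}"
  show ?case
  proof (cases "\<exists>g. g \<noteq> gunit \<and> rank g = n")
    case False
    have "?S (Suc n) \<subseteq> ?S n"
    proof
      fix w assume w: "w \<in> ?S (Suc n)"
      then have "hd w \<noteq> gunit" by (cases w) (auto simp: LT_def)
      with False have "rank (hd w) \<noteq> n" by blast
      with w show "w \<in> ?S n" by auto
    qed
    then show ?thesis using Suc.IH[OF supp_mono[OF Suc.prems(1)]] Suc.prems(2,3) by blast
  next
    case True
    then obtain g where g: "g \<noteq> gunit" "rank g = n" by blast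
    \<comment> \<open>As \<open>rank\<close> is injective, g is the only letter of rank n; hence c =
      g k + r with all words of r beginning with smaller letters.\<close>
    define k where "k = strip g c"
    define r where "r = c - conc (basis [g]) k"
    have c: "c = conc (basis [g]) k + r" by (simp add: r_def)
    have r: "r \<in> supp (?S n)"
    proof -
      have "r \<in> supp {w. w \<in> Poly_Mapping.keys c \<and> (w \<noteq> [] \<longrightarrow> hd w \<noteq> g)}"
        unfolding r_def k_def by (rule strip_split)
      then show ?thesis
      proof (rule supp_mono, intro subsetI)
        fix w assume w: "w \<in> {w. w \<in> Poly_Mapping.keys c \<and> (w \<noteq> [] \<longrightarrow> hd w \<noteq> g)}"
        then have "w \<in> ?S (Suc n)" using Suc.prems(1) unfolding supp_def by blast
        moreover from this w have "rank (hd w) \<noteq> n" using rank_inj[of "hd w" g] g by auto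
        ultimately show "w \<in> ?S n" by auto
      qed
    qed
    have k: "k \<in> supp {v \<in> LT. gdeg g + wdeg v \<le> t}"
      unfolding k_def strip_def
    proof (rule supp_extend[OF Suc.prems(1)])
      fix w assume "w \<in> ?S (Suc n)"
      then show "(if w \<noteq> [] \<and> hd w = g then basis (tl w) else 0) \<in> supp {v \<in> LT. gdeg g + wdeg v \<le> t}"
        by (cases w) (auto simp: LT_def wdeg_def)
    qed
    have qc: "tn g (ev k) + qe r = 0"
      using Suc.prems(3) by (simp add: c qe_letter)
    \<comment> \<open>The two summands of \<open>qc\<close> lie over different letters of Gamma, so
      each of them is 0.\<close>
    have "qe r \<in> supp {z. fst z \<noteq> gunit \<and> rank (fst z) < n \<and> td z \<le> t}"
      using qe_supp[of r t "\<lambda>g. rank g < n"] r by simp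
    moreover have "qe r \<in> supp {z. fst z = g}"
      using qc tn_heads[of g "ev k"] by (metis add.inverse_unique supp_closed(4))
    ultimately have qr: "qe r = 0"
      by (rule supp_disjoint) (use g in auto)
    then have ek: "ev k = 0" using qc by (simp add: tn_eq_0)
    have low: "conc (dl g) p \<in> supp {w. w \<noteq> [] \<longrightarrow> hd w \<noteq> g}" for p
      using supp_UNIV[of p, unfolded supp_def mem_Collect_eq]
    proof (induction p rule: lin_induct)
      case (basis w)
      show ?case
        unfolding conc_extend by (rule supp_extend[OF dl_heads]) auto
    qed (simp_all add: conc_add conc_scale)
    \<comment> \<open>Neither d of r nor the splitting of g begins with g, so the g-part of
      \<open>dT c = 0\<close> is, up to sign, d of k.\<close>
    have "strip g (dT r) = 0"
    proof (rule strip_other)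
      show "dT r \<in> supp {w. w \<noteq> [] \<longrightarrow> hd w \<noteq> g}"
        unfolding dT_def by (rule supp_extend[OF r], rule supp_mono[OF dw_heads]) (use g in auto)
    qed
    moreover have "strip g (conc (dl g) k) = 0" by (rule strip_other[OF low])
    moreover have "strip g (dT c) = 0" using Suc.prems(2) by simp
    ultimately have "scale (gs g) (dT k) = 0"
      unfolding c dT_simps dT_letter strip_simps strip_letter by simp
    then have dk: "dT k = 0"
      by (metis gs_square scale_simps(1,3,4))
    have "\<exists>j. j \<in> supp {v \<in> LT. gdeg g + wdeg v \<le> t} \<and> dT j = k \<and> ev j = 0"
    proof (cases "gdeg g \<le> t")
      case True
      have eq: "{v \<in> LT. gdeg g + wdeg v \<le> t} = {v \<in> LT. wdeg v \<le> t - gdeg g}"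
        using True by auto
      show ?thesis
        using IH[of "t - gdeg g" k] k dk ek gdeg_pos[OF g(1)] True unfolding LTd_def eq by auto
    next
      case False
      then have "k = 0" using k by (simp add: supp_def)
      then show ?thesis by (intro exI[of _ 0]) auto
    qed
    then obtain j where j: "j \<in> supp {v \<in> LT. gdeg g + wdeg v \<le> t}" "dT j = k" "ev j = 0" by blast
    \<comment> \<open>As d of j is k, the differential of e cancels g k and leaves only the
      splitting of g followed by j, whose words begin with smaller letters.\<close>
    define e where "e = scale (gs g) (conc (basis [g]) j)"
    have e: "e \<in> LTd t"
      unfolding e_def LTd_def conc_extend
      by (rule supp_closed(5), rule supp_extend[OF j(1)], rule supp_closed(6))
        (use g in \<open>auto simp: LT_def wdeg_def\<close>)
    have "c + dT e = r + scale (gs g) (conc (dl g) j)"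
      unfolding e_def dT_simps dT_letter j by (simp add: c scale_diff)
    moreover have "conc (dl g) j \<in> supp (?S n)"
    proof -
      have "conc (dl g) j = extend (\<lambda>w. conc (dl g) (basis w)) j"
        by (simp flip: conc_extend_right)
      also have "\<dots> \<in> supp (?S n)"
      proof (rule supp_extend[OF j(1)])
        fix v assume v: "v \<in> {v \<in> LT. gdeg g + wdeg v \<le> t}"
        show "conc (dl g) (basis v) \<in> supp (?S n)"
          unfolding conc_extend
        proof (rule supp_extend[OF dl_heads], rule supp_closed(6))
          fix u assume "u \<in> {[a, b] |a b. b \<noteq> gunit \<and> a \<noteq> gunit \<and> rank a < rank g \<and> gdeg a + gdeg b = gdeg g}"
          then obtain a b where u: "u = [a, b]" "b \<noteq> gunit" "a \<noteq> gunit" "rank a < n" "gdeg a + gdeg b = gdeg g"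
            using g by blast
          show "u @ v \<in> ?S n"
            using v u(2-) by (simp add: u(1) LT_def wdeg_def)
        qed
      qed
      finally show ?thesis .
    qed
    ultimately have "c + dT e \<in> supp (?S n)" using r by simp
    moreover have "dT (c + dT e) = 0" using Suc.prems(2) by simp
    moreover have "qe (c + dT e) = 0"
      unfolding \<open>c + dT e = r + scale (gs g) (conc (dl g) j)\<close> by (simp add: qr qe_conc_dl j)
    ultimately obtain i where i: "i \<in> LTd t" "dT i = c + dT e" "ev i = 0"
      using Suc.IH by blast
    have "ev e = 0" by (simp add: e_def j)
    with i e show ?thesis by (intro bexI[of _ "i - e"]) auto
  qed
qed

text \<open>A bounding chain of \<open>qe c\<close> in Gamma tensor M, lifted to words, corrects c
  by a coboundary until \<open>qe\<close> kills it; then \<open>peel\<close> applies.\<close>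

lemma ev_kernel_acyclic:
  assumes "c \<in> LTd t" "dT c = 0" "ev c = 0"
  shows "\<exists>j\<in>LTd t. dT j = c \<and> ev j = 0"
  using assms
proof (induction t arbitrary: c rule: less_induct)
  case (less t)
  have cLT: "c \<in> supp LT"
    using less.prems(1) unfolding LTd_def by (rule supp_mono) auto
  have "Poly_Mapping.lookup c [] = 0"
    using lookup_ev_munit[OF cLT] less.prems(3) by simp
  then have c1: "c \<in> supp {w \<in> LT. w \<noteq> [] \<and> wdeg w \<le> t \<and> True}"
    using less.prems(1) by (auto simp: supp_iff LTd_def)
  then have c2: "c \<in> supp (- {[]})" by (rule supp_mono) auto
  have Dq: "D (qe c) = 0" by (simp add: D_qe[OF c2] less.prems)
  have "qe c \<in> supp {z. z \<noteq> yunit \<and> 0 \<le> wt z \<and> td z \<le> t}"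
    by (rule supp_mono[OF qe_supp[OF c1]]) (auto simp: yunit_def simp del: td.simps)
  then obtain x where x: "x \<in> supp {z. td z \<le> t}" "D x = qe c"
    using Dq by (rule D_acyclic)
  define w0 w1 where "w0 = lift0 x" and "w1 = liftL x"
  have w0: "w0 \<in> LTd t"
    unfolding w0_def lift0_def LTd_def
    by (rule supp_extend[OF x(1)])
      (auto simp: wdeg_lift lift_letters LT_def simp del: lift.simps mt.simps)
  have w1: "w1 \<in> LTd t"
    unfolding w1_def liftL_def LTd_def
    by (rule supp_extend[OF x(1)])
      (use wdeg_lift lift_letters in \<open>auto simp: wdeg_def LT_def simp del: lift.simps mt.simps\<close>)
  have dw1: "dT w1 \<in> supp {w \<in> LT. w \<noteq> [] \<and> wdeg w \<le> t \<and> True}"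
    using dT_LTd[OF w1] dT_nonempty[of w1] liftL_letters[of x] unfolding LTd_def w1_def
    by (auto simp: supp_iff)
  define c' where "c' = c + dT w1"
  have c': "c' \<in> supp {w \<in> LT. w \<noteq> [] \<and> wdeg w \<le> t \<and> True}"
    unfolding c'_def using c1 dw1 by simp
  \<comment> \<open>The corrected image lies over the unit of Gamma, whereas \<open>qe\<close> has
    no terms over the unit; so both sides vanish.\<close>
  have q: "qe c' = tn gunit (ev (dT w0 - w1))"
    using x(2) D_decomp[of x] by (simp add: c'_def w0_def w1_def algebra_simps)
  have "qe c' = 0"
    by (rule supp_disjoint[OF qe_supp[OF c'], of "{z. fst z = gunit}"])
      (auto simp: q tn_heads)
  then have e: "ev (dT w0 - w1) = 0" using q by (simp only: tn_eq_0)
  obtain n where n: "\<And>g. rank g < n"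
  proof
    show "rank g < Suc (Max (rank ` set gams))" for g
      using gams_complete[of g] by (simp add: less_Suc_eq_le)
  qed
  have "c' \<in> supp {w \<in> LT. w \<noteq> [] \<and> wdeg w \<le> t \<and> rank (hd w) < n}"
    using c' n by simp
  moreover have "dT c' = 0" using less.prems(2) by (simp add: c'_def)
  ultimately obtain j where "j \<in> LTd t" "dT j = c'" "ev j = 0"
    using peel[OF less.IH] \<open>qe c' = 0\<close> by blast
  \<comment> \<open>The summand \<open>dT w0 - w1\<close> lies in the kernel of \<open>ev\<close>,
    and its differential undoes the correction by \<open>dT w1\<close>.\<close>
  then show ?case
    using e w0 w1 dT_LTd by (intro bexI[of _ "j + (dT w0 - w1)"]) (auto simp: c'_def)
qed

section \<open>Generators of the cohomology\<close>

abbreviation gxt0 :: gam where "gxt0 \<equiv> (H1, True, False, False)"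
abbreviation gxt1 :: gam where "gxt1 \<equiv> (H1, False, True, False)"
abbreviation gtt :: gam where "gtt \<equiv> (H0, True, True, False)"
abbreviation gxtt :: gam where "gxtt \<equiv> (H1, True, True, False)"
abbreviation gxxt1 :: gam where "gxxt1 \<equiv> (H2, False, True, False)"

text \<open>A cocycle lifting \<open>[\<tau>\<^sub>1|\<tau>\<^sub>1|\<tau>\<^sub>1]\<close>; every other term has a letter that acts as zero.\<close>

definition c6_terms :: "(int \<times> gam list) list"
  where "c6_terms =
    [(1, [gtau1, gtau1, gtau1]), (1, [gtau1, gxt1, gtau0]), (-1, [gxi, gtau1, gtt]),
     (-1, [gxi, gxtt, gtau0]), (1, [gxxt1, gtau0, gtau0]), (-1, [gtau1, gxi, gtt]),
     (-1, [gxi, gtt, gtau1]), (-1, [gxt1, gtau1, gtau0]), (1, [gxi2, gtt, gtau0]),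
     (1, [gxi, gxt0, gtt])]"

text \<open>beta is, up to sign, the Massey product of three copies of alpha_1. Of its two terms,
  [xi_1^2|xi_1] acts on monomials without alpha and [xi_1|xi_1^2] on those with alpha.\<close>

fun pterms :: "poly_name \<Rightarrow> (int \<times> gam list) list"
  where
    "pterms V0 = [(1, [gtau0])]"
  | "pterms C6 = c6_terms"
  | "pterms V2 = [(1, [gtau2])]"
  | "pterms Beta = [(1, [gxi, gxi2]), (1, [gxi2, gxi])]"

text \<open>alpha_2 is, up to sign, the Massey product of alpha_1, alpha_1 and v_0: [xi_1^2] bounds
  -[xi_1|xi_1] and [tau_1] bounds [xi_1|tau_0].\<close>

fun eterms :: "ext_name \<Rightarrow> (int \<times> gam list) list"
  where
    "eterms Alpha1 = [(1, [gxi])]"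
  | "eterms Alpha2 = [(1, [gxi2, gtau0]), (-1, [gxi, gtau1])]"

lemma dT_lc_eq_0: "collect word_key (lext dwlist xs) = [] \<Longrightarrow> dT (lc xs) = 0"
  using lc_eq_0[of word_key "lext dwlist xs"] by (simp add: lc_dwlist dT_def)

lemma dT_pterms [simp]: "dT (lc (pterms x)) = 0"
proof (rule dT_lc_eq_0)
  have "list_all (\<lambda>x. collect word_key (lext dwlist (pterms x)) = []) [V0, C6, V2, Beta]"
    by code_simp
  then show "collect word_key (lext dwlist (pterms x)) = []"
    by (cases x) auto
qed

lemma dT_eterms [simp]: "dT (lc (eterms y)) = 0"
proof (rule dT_lc_eq_0)
  have "list_all (\<lambda>y. collect word_key (lext dwlist (eterms y)) = []) [Alpha1, Alpha2]"
    by code_simp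
  then show "collect word_key (lext dwlist (eterms y)) = []"
    by (cases y) auto
qed

text \<open>v_1 enters in cubes only. Since P(v_1^3) = 0 in characteristic 3, these multiplications
  commute with the action and with the differential.\<close>

fun shift :: "(poly_name \<Rightarrow> nat) \<Rightarrow> mb \<Rightarrow> mb"
  where "shift e (n0, n1, n2, k, b) = (n0 + e V0, n1 + 3 * e C6, n2 + e V2, k + e Beta, b)"

definition sh :: "(poly_name \<Rightarrow> nat) \<Rightarrow> mb lin \<Rightarrow> mb lin"
  where "sh e = extend (\<lambda>b. basis (shift e b))"

lemma sh_simps [simp]:
  "sh e 0 = 0" "sh e (p + q) = sh e p + sh e q" "sh e (p - q) = sh e p - sh e q"
  "sh e (- p) = - sh e p" "sh e (scale c p) = scale c (sh e p)"
  "sh e (Poly_Mapping.single b c) = Poly_Mapping.single (shift e b) c"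
  by (simp_all add: sh_def extend_add extend_diff extend_scale)

lemma sh_sh: "sh e (sh f p) = sh (\<lambda>x. e x + f x) p"
proof -
  have "shift e (shift f b) = shift (\<lambda>x. e x + f x) b" for b
    by (cases b) simp
  then show ?thesis by (simp add: sh_def extend_extend)
qed

lemma sh_0 [simp]: "sh (\<lambda>x. 0) p = p"
proof -
  have "shift (\<lambda>x. 0) b = b" for b by (cases b) simp
  then show ?thesis by (simp add: sh_def)
qed

lemma sh_act: "extend (act g) (sh e m) = sh e (extend (act g) m)"
proof -
  have "act g (shift e b) = sh e (act g b)" for b
  proof -
    obtain n0 n1 n2 k c where b: "b = (n0, n1, n2, k, c)" by (cases b)
    show ?thesis unfolding b
      by (cases n1) (auto simp: gen_defs)
  qed
  then show ?thesis by (simp add: sh_def extend_extend)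
qed

lemma sh_dM: "dM (sh e m) = sh e (dM m)"
proof -
  have "dmb (shift e b) = sh e (dmb b)" for b
  proof -
    obtain n0 n1 n2 k c where b: "b = (n0, n1, n2, k, c)" by (cases b)
    have "n1 = 0 \<or> n1 = Suc 0 \<or> (\<exists>m. n1 = Suc (Suc m))"
      by (metis not0_implies_Suc)
    then show ?thesis unfolding b
      by (elim disjE exE; cases c) auto
  qed
  then show ?thesis by (simp add: sh_def dM_def extend_extend)
qed

lemma actw_sh: "actw w (sh e m) = sh e (actw w m)"
  by (induction w) (simp_all add: sh_act)

lemma actT_sh: "actT p (sh e m) = sh e (actT p m)"
  using supp_UNIV[of p, unfolded supp_def mem_Collect_eq]
  by (induction p rule: lin_induct) (simp_all add: actw_sh)

lemma actT_extend: "actT p m = extend (\<lambda>b. actT p (basis b)) m"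
  using supp_UNIV[of m, unfolded supp_def mem_Collect_eq]
  by (induction m rule: lin_induct) (simp_all add: extend_add extend_scale)

text \<open>An exact equality on all of M, not one up to boundaries; this is what makes products
  with these cocycles visible on monomials.\<close>

lemma actT_pterms: "actT (lc (pterms x)) m = sh (\<lambda>y. of_bool (y = x)) m"
proof -
  have "actT (lc (pterms x)) (basis b) = basis (shift (\<lambda>y. of_bool (y = x)) b)" for b
  proof -
    obtain n0 n1 n2 k e where b: "b = (n0, n1, n2, k, e)" by (cases b)
    show ?thesis unfolding b
      by (cases x; cases e) (simp_all add: gen_defs c6_terms_def numeral_3_eq_3)
  qed
  then show ?thesis by (subst actT_extend) (simp add: sh_def)
qed

section \<open>Cocycle representatives of the monomials of the presentation\<close>

fun cpow :: "gam list lin \<Rightarrow> nat \<Rightarrow> gam list lin"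
  where
    "cpow p 0 = basis []"
  | "cpow p (Suc n) = conc p (cpow p n)"

definition ephi :: "ext_name fset \<Rightarrow> gam list lin"
  where "ephi S = conc (if Alpha1 |\<in>| S then lc (eterms Alpha1) else basis [])
    (if Alpha2 |\<in>| S then lc (eterms Alpha2) else basis [])"

fun phib :: "pmon \<Rightarrow> gam list lin"
  where "phib (e, S) =
    conc (cpow (lc (pterms V0)) (Poly_Mapping.lookup e V0))
    (conc (cpow (lc (pterms C6)) (Poly_Mapping.lookup e C6))
    (conc (cpow (lc (pterms V2)) (Poly_Mapping.lookup e V2))
    (conc (cpow (lc (pterms Beta)) (Poly_Mapping.lookup e Beta)) (ephi S))))"

text \<open>A linear section on cochains that fixes an order of the factors. It is multiplicative
  only up to coboundaries: alpha_1^2 is 0 while [xi_1|xi_1] is not.\<close>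

definition phi :: "pmon lin \<Rightarrow> gam list lin"
  where "phi = extend phib"

lemma phi_simps [simp]:
  "phi 0 = 0" "phi (p + q) = phi p + phi q" "phi (p - q) = phi p - phi q"
  "phi (- p) = - phi p" "phi (scale c p) = scale c (phi p)"
  "phi (Poly_Mapping.single b c) = scale c (phib b)"
  by (simp_all add: phi_def extend_add extend_diff extend_scale)

lemma actT_cpow: "actT (cpow (lc (pterms x)) n) m = sh (\<lambda>y. n * of_bool (y = x)) m"
  by (induction n) (simp_all add: actT_pterms sh_sh)

lemma actT_phib: "actT (phib (e, S)) m = sh (Poly_Mapping.lookup e) (actT (ephi S) m)"
proof -
  have *: "(\<lambda>x. a * of_bool (x = V0) + (b * of_bool (x = C6) + (c * of_bool (x = V2) + d * of_bool (x = Beta)))) = f"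
    if "a = f V0" "b = f C6" "c = f V2" "d = f Beta" for a b c d :: nat and f
  proof
    show "(a * of_bool (x = V0) + (b * of_bool (x = C6) + (c * of_bool (x = V2) + d * of_bool (x = Beta)))) = f x" for x
      using that by (cases x) auto
  qed
  show ?thesis
    unfolding phib.simps actT_conc actT_cpow sh_sh by (subst *[of _ "Poly_Mapping.lookup e"]) auto
qed

lemma dT_cpow: "dT p = 0 \<Longrightarrow> dT (cpow p n) = 0"
  by (induction n) (simp_all add: dT_conc)

lemma dT_phib [simp]: "dT (phib b) = 0"
  by (cases b) (simp add: dT_conc dT_cpow ephi_def del: pterms.simps eterms.simps)

lemma dT_phi [simp]: "dT (phi p) = 0"
  using supp_UNIV[of p, unfolded supp_def mem_Collect_eq]
  by (induction p rule: lin_induct) simp_all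

lemma ext_sets: "S = {||} \<or> S = {|Alpha1|} \<or> S = {|Alpha2|} \<or> S = {|Alpha1, Alpha2|}"
proof -
  have "x |\<in>| S \<longleftrightarrow> x |\<in>| (if Alpha1 |\<in>| S then {|Alpha1|} else {||}) |\<union>| (if Alpha2 |\<in>| S then {|Alpha2|} else {||})" for x
    by (cases x) auto
  then have "S = (if Alpha1 |\<in>| S then {|Alpha1|} else {||}) |\<union>| (if Alpha2 |\<in>| S then {|Alpha2|} else {||})"
    by (intro fset_eqI)
  then show ?thesis by (auto split: if_splits)
qed

section \<open>The cohomology of the small module\<close>

definition pexp :: "nat \<Rightarrow> nat \<Rightarrow> nat \<Rightarrow> nat \<Rightarrow> poly_name \<Rightarrow>\<^sub>0 nat"
  where "pexp a b c d = Poly_Mapping.single V0 a + Poly_Mapping.single C6 b +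
    Poly_Mapping.single V2 c + Poly_Mapping.single Beta d"

lemma lookup_pexp [simp]:
  "Poly_Mapping.lookup (pexp a b c d) V0 = a" "Poly_Mapping.lookup (pexp a b c d) C6 = b"
  "Poly_Mapping.lookup (pexp a b c d) V2 = c" "Poly_Mapping.lookup (pexp a b c d) Beta = d"
  by (simp_all add: pexp_def lookup_add lookup_single)

lemma pexp_lookup:
  "pexp (Poly_Mapping.lookup e V0) (Poly_Mapping.lookup e C6) (Poly_Mapping.lookup e V2)
    (Poly_Mapping.lookup e Beta) = e"
proof (rule poly_mapping_eqI)
  fix x show "Poly_Mapping.lookup (pexp (Poly_Mapping.lookup e V0) (Poly_Mapping.lookup e C6)
    (Poly_Mapping.lookup e V2) (Poly_Mapping.lookup e Beta)) x = Poly_Mapping.lookup e x"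
    by (cases x) simp_all
qed

text \<open>The basis elements with nonzero image represent a basis of the cohomology; the cycles among
  the others are boundaries. The sign makes \<open>\<alpha>\<^sub>1 \<alpha>\<^sub>2\<close> equal to \<open>v\<^sub>0 \<beta>\<close> rather than to its negative.\<close>

fun nfb :: "mb \<Rightarrow> pmon lin"
  where "nfb (n0, n1, n2, k, e) =
    (if e then
       if n0 = 0 \<and> n1 mod 3 = 0 then basis (pexp 0 (n1 div 3) n2 k, {|Alpha1|})
       else if n0 = 0 \<and> n1 mod 3 = 1 then - basis (pexp 0 (n1 div 3) n2 k, {|Alpha2|})
       else 0
     else if n1 mod 3 = 0 \<and> (n0 \<le> 1 \<or> k = 0) then basis (pexp n0 (n1 div 3) n2 k, {||})
     else 0)"

definition nf :: "mb lin \<Rightarrow> pmon lin"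
  where "nf = extend nfb"

lemma nf_simps [simp]:
  "nf 0 = 0" "nf (p + q) = nf p + nf q" "nf (p - q) = nf p - nf q" "nf (- p) = - nf p"
  "nf (scale c p) = scale c (nf p)" "nf (Poly_Mapping.single b c) = scale c (nfb b)"
  by (simp_all add: nf_def extend_add extend_diff extend_scale)

text \<open>Boundaries consist of multiples of v_0 alpha and of v_0^2 beta, on which
  \<open>nfb\<close> is 0.\<close>

lemma nf_dM [simp]: "nf (dM m) = 0"
  using supp_UNIV[of m, unfolded supp_def mem_Collect_eq]
proof (induction m rule: lin_induct)
  case (basis b)
  show ?case by (cases b) simp
qed simp_all

lemma dM_range_closed [intro]:
  "0 \<in> range dM" "p \<in> range dM \<Longrightarrow> q \<in> range dM \<Longrightarrow> p + q \<in> range dM"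
  "p \<in> range dM \<Longrightarrow> q \<in> range dM \<Longrightarrow> p - q \<in> range dM"
  "p \<in> range dM \<Longrightarrow> - p \<in> range dM"
  "p \<in> range dM \<Longrightarrow> scale c p \<in> range dM" "dM m \<in> range dM"
  by (metis dM_simps(1) rangeI) (auto simp flip: dM_simps)

fun dtarget :: "mb \<Rightarrow> mb"
  where "dtarget (n0, n1, n2, k, e) =
    (if e then (Suc (Suc n0), n1 - 2, n2, Suc k, False) else (Suc n0, n1 - 1, n2, k, True))"

fun dcoeff :: "mb \<Rightarrow> F3"
  where "dcoeff (n0, n1, n2, k, e) = (if e then of_nat n1 * of_nat (n1 - 1) else of_nat n1)"

lemma dmb_target: "dmb b = Poly_Mapping.single (dtarget b) (dcoeff b)"
  by (cases b) simp

lemma dtarget_inj: "dcoeff b \<noteq> 0 \<Longrightarrow> dcoeff b' \<noteq> 0 \<Longrightarrow> dtarget b = dtarget b' \<Longrightarrow> b = b'"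
proof -
  assume *: "dcoeff b \<noteq> 0" "dcoeff b' \<noteq> 0" "dtarget b = dtarget b'"
  \<comment> \<open>A nonzero coefficient excludes truncation, so the source can be recovered from
    the target.\<close>
  have pos: "n1 \<noteq> 0 \<and> (e \<longrightarrow> n1 \<noteq> Suc 0)" if "dcoeff (n0, n1, n2, k, e) \<noteq> 0" for n0 n1 n2 k e
    using that by (auto split: if_splits intro!: Nat.gr0I)
  obtain n0 n1 n2 k e where b: "b = (n0, n1, n2, k, e)" by (cases b)
  obtain n0' n1' n2' k' e' where b': "b' = (n0', n1', n2', k', e')" by (cases b')
  from *(3) pos[OF *(1)[unfolded b]] pos[OF *(2)[unfolded b']] show ?thesis
    unfolding b b' by (cases e; cases e') auto
qed

text \<open>Monomials with nonzero differential have distinct targets, so their differentials cannot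
  cancel each other.\<close>

lemma cycle_supp:
  assumes "dM m = 0"
  shows "m \<in> supp {b. dmb b = 0}"
  unfolding supp_iff
proof (intro allI impI)
  fix b assume "b \<notin> {b. dmb b = 0}"
  then have b: "dcoeff b \<noteq> 0" by (auto simp: dmb_target)
  have "Poly_Mapping.lookup (dM m) (dtarget b) =
      (\<Sum>b'\<in>Poly_Mapping.keys m. Poly_Mapping.lookup m b' * Poly_Mapping.lookup (dmb b') (dtarget b))"
    unfolding dM_def by (rule extend_lookup)
  also have "\<dots> = (\<Sum>b'\<in>Poly_Mapping.keys m. if b' = b then Poly_Mapping.lookup m b * dcoeff b else 0)"
  proof (rule sum.cong)
    fix b'
    show "Poly_Mapping.lookup m b' * Poly_Mapping.lookup (dmb b') (dtarget b) =
        (if b' = b then Poly_Mapping.lookup m b * dcoeff b else 0)"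
      using dtarget_inj[OF b, of b'] by (cases "dcoeff b' = 0") (auto simp: dmb_target lookup_single when_def simp del: dcoeff.simps dtarget.simps)
  qed simp
  also have "\<dots> = Poly_Mapping.lookup m b * dcoeff b"
    by (simp add: in_keys_iff)
  finally have "Poly_Mapping.lookup m b * dcoeff b * dcoeff b = 0"
    using assms by simp
  then show "Poly_Mapping.lookup m b = 0"
    using F3_square[OF b] by (simp add: mult.assoc)
qed

lemma ev_phib: "ev (phib (e, S)) = sh (Poly_Mapping.lookup e) (ev (ephi S))"
  by (simp only: ev_def actT_phib)

text \<open>The last value arises from xi_1 acting on -v_1 alpha, which gives P(v_1) beta = v_0
  beta; so the relation for alpha_1 alpha_2 holds exactly in M.\<close>

lemma ev_ephi:
  "ev (ephi {||}) = basis munit" "ev (ephi {|Alpha1|}) = basis (0, 0, 0, 0, True)"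
  "ev (ephi {|Alpha2|}) = - basis (0, 1, 0, 0, True)"
  "ev (ephi {|Alpha1, Alpha2|}) = basis (1, 0, 0, 1, False)"
  by (simp_all add: ev_def ephi_def gen_defs single_uminus)

lemma single_eq_0_iff: "Poly_Mapping.single k v = 0 \<longleftrightarrow> v = 0"
  by (metis lookup_single_eq lookup_zero single_zero)

lemma nf_cycle_basis:
  assumes "dmb b = 0"
  shows "basis b - ev (phi (nfb b)) \<in> range dM"
proof -
  obtain n0 n1 n2 k e where b: "b = (n0, n1, n2, k, e)" by (cases b)
  have eq: "3 * (n1 div 3) = n1" if "n1 mod 3 = 0" using that by auto
  have eq1: "Suc (3 * (n1 div 3)) = n1" if "n1 mod 3 = 1" using that by presburger
  show ?thesis
  proof (cases e)
    case False
    then have "(of_nat n1 :: F3) = 0" using assms by (simp add: b single_eq_0_iff)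
    then have n1: "n1 mod 3 = 0" by (simp add: of_nat_F3_eq_0 dvd_eq_mod_eq_0)
    show ?thesis
    proof (cases "n0 \<le> 1 \<or> k = 0")
      case True
      then have "basis b - ev (phi (nfb b)) = 0"
        using False n1 eq[OF n1] by (simp add: b ev_phib ev_ephi del: phib.simps)
      then show ?thesis by auto
    next
      case False': False
      then obtain m k' where mk: "n0 = Suc (Suc m)" "k = Suc k'"
        by (metis One_nat_def Suc_le_eq le_0_eq not0_implies_Suc not_less_eq_eq)
      \<comment> \<open>The coefficient of P^2 on v_1^(n1+2), which is 2 because 3 divides
        \<open>n1\<close>.\<close>
      have "(of_nat (n1 + 2) * of_nat (n1 + 1) :: F3) = - 1"
        using \<open>(of_nat n1 :: F3) = 0\<close> by (simp add: F3_double)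
      then have "dM (- basis (m, n1 + 2, n2, k', True)) = basis b"
        using False mk by (simp add: b single_uminus)
      moreover have "nfb b = 0" using False False' by (simp add: b)
      ultimately show ?thesis by (metis diff_zero ev_simps(1) phi_simps(1) rangeI)
    qed
  next
    case True
    have "(of_nat (n1 * (n1 - 1)) :: F3) = 0"
      using assms True by (simp add: b single_eq_0_iff)
    then have "3 dvd n1 * (n1 - 1)" by (simp only: of_nat_F3_eq_0)
    then have "n1 * (n1 - 1) mod 3 = 0" by (rule dvd_imp_mod_0)
    then have "(n1 mod 3) * ((n1 - 1) mod 3) mod 3 = 0"
      by (rule trans[OF mod_mult_eq])
    moreover have "(n1 - 1) mod 3 = 1" if "n1 mod 3 = 2"
    proof -
      have "n1 = 3 * (n1 div 3) + 2" using that by (metis mult_div_mod_eq)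
      then obtain q where "n1 = 3 * q + 2" ..
      then show ?thesis by simp
    qed
    moreover have "n1 mod 3 = 0 \<or> n1 mod 3 = 1 \<or> n1 mod 3 = 2" by auto
    ultimately have n1: "n1 mod 3 = 0 \<or> n1 mod 3 = 1" by auto
    show ?thesis
    proof (cases n0)
      case 0
      have "basis b - ev (phi (nfb b)) = 0"
        using n1
      proof
        assume "n1 mod 3 = 0"
        with True 0 eq show ?thesis by (simp add: b ev_phib ev_ephi del: phib.simps)
      next
        assume n1: "n1 mod 3 = 1"
        then have "nfb b = - basis (pexp 0 (n1 div 3) n2 k, {|Alpha2|})" using True 0 by (simp add: b)
        then show ?thesis using True 0 eq1 n1
          by (simp add: b ev_phib ev_ephi del: phib.simps nfb.simps)
      qed
      then show ?thesis by auto
    next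
      case (Suc m)
      \<comment> \<open>The coefficient of P on v_1^(n1+1). It is nonzero because \<open>n1\<close>
        is 0 or 1 mod 3, and it is its own inverse.\<close>
      let ?c = "of_nat (Suc n1) :: F3"
      have "?c \<noteq> 0"
        unfolding of_nat_F3_eq_0 using n1 by presburger
      then have "?c * ?c = 1" by (rule F3_square)
      then have "dM (scale ?c (basis (m, Suc n1, n2, k, False))) = basis b"
        using True Suc by (simp add: b)
      moreover have "nfb b = 0" using True Suc by (simp add: b)
      ultimately show ?thesis by (metis diff_zero ev_simps(1) phi_simps(1) rangeI)
    qed
  qed
qed

lemma nf_cycle:
  assumes "dM m = 0"
  shows "m - ev (phi (nf m)) \<in> range dM"
  using cycle_supp[OF assms] unfolding supp_def mem_Collect_eq
proof (induction m rule: lin_induct)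
  case (add p q)
  have "p + q - ev (phi (nf (p + q))) = (p - ev (phi (nf p))) + (q - ev (phi (nf q)))" by simp
  with add show ?case by (simp only: dM_range_closed)
next
  case (scale c p)
  have "scale c p - ev (phi (nf (scale c p))) = scale c (p - ev (phi (nf p)))" by (simp add: scale_diff)
  with scale show ?case by (simp only: dM_range_closed)
next
  case (basis b)
  then show ?case using nf_cycle_basis[of b] by simp
qed auto

section \<open>Products of representatives, up to boundaries\<close>

lemma triple_eq_0: "p + p + p = (0 :: 'a lin)"
proof -
  have "p + p + p = scale (1 + 1 + 1) p" by (simp only: scale_add_left scale_simps(3))
  then show ?thesis by simp
qed

lemma crossings_alpha:
  "crossings {|Alpha1|} {|Alpha2|} = 0" "crossings {|Alpha2|} {|Alpha1|} = 1"
proof -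
  have "{(s, t). s |\<in>| {|Alpha1|} \<and> t |\<in>| {|Alpha2|} \<and> t < s} = {}"
    "{(s, t). s |\<in>| {|Alpha2|} \<and> t |\<in>| {|Alpha1|} \<and> t < s} = {(Alpha2, Alpha1)}"
    by (auto simp: less_ext_name_def)
  then show "crossings {|Alpha1|} {|Alpha2|} = 0" "crossings {|Alpha2|} {|Alpha1|} = 1"
    by (simp_all only: crossings_def) simp_all
qed

lemma ephi_mult:
  "actT (ephi S) (ev (ephi T)) -
    (if S |\<inter>| T = {||} then scale ((-1) ^ crossings S T) (ev (ephi (S |\<union>| T))) else 0) \<in> range dM"
proof -
  \<comment> \<open>Products that are 0 in the exterior algebra can survive in M as multiples of v_0
    alpha beta, v_0 v_1 alpha beta or v_0^2 beta^2; these are boundaries.\<close>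
  have r: "Poly_Mapping.single (Suc 0, 0, 0, Suc 0, True) c = dM (Poly_Mapping.single (0, Suc 0, 0, Suc 0, False) c)"
    "Poly_Mapping.single (Suc 0, Suc 0, 0, Suc 0, True) c = dM (Poly_Mapping.single (0, 2, 0, Suc 0, False) (- c))"
    "Poly_Mapping.single (Suc (Suc 0), 0, 0, Suc (Suc 0), False) c = dM (Poly_Mapping.single (0, 2, 0, Suc 0, True) (- c))" for c
    by (simp_all add: F3_double numeral_2_eq_2)
  show ?thesis
    using ext_sets[of S] ext_sets[of T]
    by (elim disjE,
        simp_all add: ephi_def ev_def gen_defs single_uminus crossings_alpha F3_double
          dM_range_closed triple_eq_0)
      (simp_all add: r dM_range_closed del: dM_simps dmb.simps)
qed

lemma range_dM_sh: "m \<in> range dM \<Longrightarrow> sh e m \<in> range dM"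
  by (auto simp flip: sh_dM)

lemma ev_phi_mult_basis: "ev (conc (phib a) (phib b)) - ev (phi (mon_mult a b)) \<in> range dM"
proof -
  obtain e S f T where ab: "a = (e, S)" "b = (f, T)" by (metis prod.exhaust)
  have l: "(\<lambda>x. Poly_Mapping.lookup f x + Poly_Mapping.lookup e x) = Poly_Mapping.lookup (e + f)"
    by (simp add: lookup_add fun_eq_iff)
  have "ev (conc (phib a) (phib b)) - ev (phi (mon_mult a b)) = sh (Poly_Mapping.lookup (e + f))
    (actT (ephi S) (ev (ephi T)) -
      (if S |\<inter>| T = {||} then scale ((-1) ^ crossings S T) (ev (ephi (S |\<union>| T))) else 0))"
    unfolding ab ev_simps actT_phib ev_phib actT_sh sh_sh l
    by (simp add: ev_phib del: phib.simps)
  then show ?thesis using range_dM_sh[OF ephi_mult] by simp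
qed

lemma ev_phi_mult: "ev (conc (phi p) (phi q)) - ev (phi (extend2 mon_mult p q)) \<in> range dM"
proof -
  have "ev (conc (phi p) (phi q)) - ev (phi (extend2 mon_mult p q)) =
      extend (\<lambda>a. extend (\<lambda>b. ev (conc (phib a) (phib b)) - ev (phi (mon_mult a b))) q) p"
  proof -
    have ev_extend: "ev (extend g r) = extend (\<lambda>b. ev (g b)) r" for g and r :: "'b lin"
      by (simp add: ev_def actT_def extend_extend)
    have "conc (phi p) (phi q) = extend (\<lambda>a. extend (\<lambda>b. conc (phib a) (phib b)) q) p"
      by (simp only: phi_def conc_extend_left[of phib p]) (simp only: conc_extend_right)
    moreover have "phi (extend2 mon_mult p q) = extend (\<lambda>a. extend (\<lambda>b. phi (mon_mult a b)) q) p"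
      by (simp add: phi_def extend2_def extend_extend)
    ultimately show ?thesis by (simp only: extend_fun_diff ev_extend)
  qed
  also have "\<dots> \<in> range dM"
    by (rule extend_eq_induct[OF refl]; (rule dM_range_closed; assumption)?)
      (rule extend_eq_induct[OF refl]; (rule dM_range_closed; assumption)?; rule ev_phi_mult_basis)
  finally show ?thesis .
qed

section \<open>Parity and coboundaries in the cobar complex\<close>

lemma wsgn_square: "wsgn w * wsgn w = 1"
proof (induction w)
  case (Cons g w)
  have "wsgn (g # w) * wsgn (g # w) = (gs g * gs g) * (wsgn w * wsgn w)"
    by (simp add: wsgn_def mult_ac del: gs_square)
  then show ?case using Cons by simp
qed (simp add: wsgn_def)

lemma sigma_sigma [simp]: "sigma (sigma p) = p"
  by (simp add: sigma_def extend_extend wsgn_square)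

lemma sigma_simps:
  "sigma 0 = 0" "sigma (p + q) = sigma p + sigma q" "sigma (- p) = - sigma p"
  "sigma (scale c p) = scale c (sigma p)"
  by (simp_all add: sigma_def extend_add extend_scale)

lemma dw_wsgn: "dw w \<in> supp {v. wsgn v = - wsgn w}"
proof (induction w)
  case (Cons g w)
  have "conc (dl g) (basis w) \<in> supp {v. wsgn v = - wsgn (g # w)}"
    unfolding conc_extend
  proof (rule supp_extend[OF dl_supp], rule supp_closed(6))
    fix v assume "v \<in> {[a, b] |a b. a \<noteq> gunit \<and> b \<noteq> gunit \<and> gdeg a + gdeg b = gdeg g \<and> gs a * gs b = gs g}"
    then obtain a b where "v = [a, b]" "gs g = gs a * gs b" by auto
    then show "v @ w \<in> {v. wsgn v = - wsgn (g # w)}" by (simp add: wsgn_def)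
  qed
  moreover have "conc (basis [g]) (dw w) \<in> supp {v. wsgn v = - wsgn (g # w)}"
    unfolding conc_extend by (rule supp_extend[OF Cons]) (auto simp: wsgn_def)
  ultimately show ?case by simp
qed simp

text \<open>The differential reverses the parity of the total degree of a word.\<close>

lemma dT_sigma: "dT (sigma p) = - sigma (dT p)"
  using supp_UNIV[of p, unfolded supp_def mem_Collect_eq]
proof (induction p rule: lin_induct)
  case (basis w)
  have "sigma (dw w) = extend (\<lambda>v. scale (- wsgn w) (basis v)) (dw w)"
    unfolding sigma_def by (rule extend_cong_supp[OF dw_wsgn]) auto
  also have "\<dots> = - scale (wsgn w) (dw w)"
    by (simp only: extend_fun_scale extend_fun_minus extend_basis scale_minus)
  finally have "sigma (dw w) = - scale (wsgn w) (dw w)" .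
  moreover have "sigma (basis w) = Poly_Mapping.single w (wsgn w)" by (simp add: sigma_def)
  ultimately show ?case by simp
qed (simp_all add: sigma_simps)

lemma conc_LT: "p \<in> supp LT \<Longrightarrow> q \<in> supp LT \<Longrightarrow> conc p q \<in> supp LT"
  unfolding conc_def extend2_def
  by (erule supp_extend, erule supp_extend) (auto simp: LT_def)

lemma dT_LT: "p \<in> supp LT \<Longrightarrow> dT p \<in> supp LT"
  unfolding dT_def by (erule supp_extend, rule supp_mono[OF dw_supp]) (auto simp: LT_def)

text \<open>Subtracting the differential of a lift of the bounding element of M moves z into the
  kernel of \<open>ev\<close>, which is acyclic.\<close>

lemma coboundaryI:
  assumes "z \<in> supp LT" "dT z = 0" "ev z \<in> range dM"
  shows "z \<in> dT ` supp LT"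
proof -
  obtain m where m: "ev z = dM m" using assms(3) by auto
  define w where "w = lift0 (tn gunit m)"
  have w: "w \<in> supp LT" unfolding w_def LT_def by (rule lift0_letters)
  have "ev w = m"
  proof -
    have "lift0 (tn gunit m) = extend (\<lambda>b. basis (lift b)) m"
      by (simp add: lift0_def tn_def extend_extend)
    then show ?thesis
      by (simp add: w_def ev_def actT_def extend_extend ev_lift)
  qed
  then have ev0: "ev (z - dT w) = 0" using m by (simp flip: dM_ev)
  obtain t where "z - dT w \<in> LTd t"
  proof
    have fin: "finite (Poly_Mapping.keys (z - dT w))" by simp
    show "z - dT w \<in> LTd (Max (wdeg ` Poly_Mapping.keys (z - dT w)))"
      using assms(1) dT_LT[OF w] supp_closed(3)[of z LT "dT w"] fin
      by (auto simp: LTd_def supp_def simp del: keys_minus)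
  qed
  then obtain j where "j \<in> LTd t" "dT j = z - dT w"
    using ev_kernel_acyclic[of "z - dT w" t] ev0 assms(2) by auto
  then have "z = dT (j + w)" "j + w \<in> supp LT"
    using w by (auto simp: LTd_def elim: supp_mono intro!: supp_closed(2))
  then show ?thesis by blast
qed

lemma ev_coboundary: "ev (dT w) \<in> range dM"
  by (simp flip: dM_ev)


section \<open>The presentation\<close>

lemma mon_deg_finite:
  fixes e :: "poly_name \<Rightarrow>\<^sub>0 nat"
  shows "mon_deg dx dy (e, S) = Poly_Mapping.lookup e V0 * dx V0 + Poly_Mapping.lookup e C6 * dx C6 +
    Poly_Mapping.lookup e V2 * dx V2 + Poly_Mapping.lookup e Beta * dx Beta + (\<Sum>y\<in>fset S. dy y)"
proof -
  have "(\<Sum>x\<in>Poly_Mapping.keys e. Poly_Mapping.lookup e x * dx x) =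
      (\<Sum>x\<in>{V0, C6, V2, Beta}. Poly_Mapping.lookup e x * dx x)"
  proof (rule sum.mono_neutral_left)
    have "x \<in> {V0, C6, V2, Beta}" for x by (cases x) auto
    then show "Poly_Mapping.keys e \<subseteq> {V0, C6, V2, Beta}" by blast
  qed (auto simp: in_keys_iff)
  then show ?thesis by simp
qed

lemma nfb_deg: "nfb b \<in> supp {m. mon_deg poly_s ext_s m = ms b \<and> mon_deg poly_t ext_t m = mt b}"
proof -
  obtain n0 n1 n2 k e where b: "b = (n0, n1, n2, k, e)" by (cases b)
  have "(\<exists>q. n1 = 3 * q) \<or> (\<exists>q. n1 = 3 * q + 1) \<or> (\<exists>q. n1 = 3 * q + 2)"
    by presburger
  moreover have "Suc (Suc (3 * q)) mod 3 = 2" for q :: nat by presburger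
  ultimately show ?thesis unfolding b
    by (elim disjE exE)
      (auto simp: mon_deg_finite intro!: supp_closed(4,6) simp del: mon_deg.simps)
qed

lemma supp_conc_deg:
  assumes "p \<in> supp {w \<in> LT. length w = s \<and> wdeg w = t}" "q \<in> supp {w \<in> LT. length w = s' \<and> wdeg w = t'}"
  shows "conc p q \<in> supp {w \<in> LT. length w = s + s' \<and> wdeg w = t + t'}"
  unfolding conc_def extend2_def
  by (rule supp_extend[OF assms(1)], rule supp_extend[OF assms(2)]) (auto simp: LT_def wdeg_def)

lemma pterms_deg: "lc (pterms x) \<in> supp {w \<in> LT. length w = poly_s x \<and> wdeg w = poly_t x}"
  by (cases x) (auto simp: LT_def wdeg_def gen_defs c6_terms_def intro!: supp_closed(2,4,6))

lemma eterms_deg: "lc (eterms y) \<in> supp {w \<in> LT. length w = ext_s y \<and> wdeg w = ext_t y}"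
  by (cases y) (auto simp: LT_def wdeg_def gen_defs intro!: supp_closed(2,4,6))

lemma cpow_deg:
  assumes "p \<in> supp {w \<in> LT. length w = s \<and> wdeg w = t}"
  shows "cpow p n \<in> supp {w \<in> LT. length w = n * s \<and> wdeg w = n * t}"
proof (induction n)
  case (Suc n)
  show ?case using supp_conc_deg[OF assms Suc] by simp
qed (auto simp: LT_def wdeg_def)

lemma phib_deg: "phib m \<in> supp {w \<in> LT. length w = mon_deg poly_s ext_s m \<and> wdeg w = mon_deg poly_t ext_t m}"
proof -
  obtain e S where m: "m = (e, S)" by (cases m)
  have one: "basis [] \<in> supp {w \<in> LT. length w = 0 \<and> wdeg w = 0}"
    by (auto simp: LT_def wdeg_def)
  have "ephi S \<in> supp {w \<in> LT. length w = sum ext_s (fset S) \<and> wdeg w = sum ext_t (fset S)}"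
    using ext_sets[of S] supp_conc_deg[OF one one] supp_conc_deg[OF eterms_deg[of Alpha1] one]
      supp_conc_deg[OF one eterms_deg[of Alpha2]] supp_conc_deg[OF eterms_deg eterms_deg, of Alpha1 Alpha2]
    by (elim disjE) (simp_all add: ephi_def numeral_2_eq_2 del: eterms.simps conc_Nil)
  note ephi = this
  have c: "cpow (lc (pterms x)) n \<in> supp {w \<in> LT. length w = n * poly_s x \<and> wdeg w = n * poly_t x}" for x n
    by (rule cpow_deg[OF pterms_deg])
  show ?thesis
    unfolding m phib.simps
    by (rule supp_mono[OF supp_conc_deg[OF c supp_conc_deg[OF c supp_conc_deg[OF c
      supp_conc_deg[OF c ephi]]]]]) (simp add: mon_deg_finite add.assoc del: mon_deg.simps)
qed

lemma phib_LT: "phib m \<in> supp LT"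
  by (rule supp_mono[OF phib_deg]) auto

lemma phi_LT: "phi p \<in> supp LT"
  unfolding phi_def by (rule supp_extend[of p UNIV]) (simp_all add: phib_LT del: phib.simps)

section \<open>Ideals in algebras with a basis, and the ideal of relations\<close>

lemma basis_algebra_simps:
  "carrier (basis_algebra C m u) = {p. Poly_Mapping.keys p \<subseteq> C}"
  "mult (basis_algebra C m u) = extend2 m" "one (basis_algebra C m u) = basis u"
  "zero (basis_algebra C m u) = 0" "add (basis_algebra C m u) = (+)"
  by (simp_all add: basis_algebra_def)

lemma basis_algebra_a_inv:
  assumes "ring (basis_algebra C m u)" "Poly_Mapping.keys p \<subseteq> C"
  shows "\<ominus>\<^bsub>basis_algebra C m u\<^esub> p = - p"
proof -
  interpret ring "basis_algebra C m u" by fact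
  show ?thesis
    by (rule minus_equality) (use assms(2) in \<open>simp_all add: basis_algebra_simps\<close>)
qed

lemma basis_algebra_idealI:
  assumes "ring (basis_algebra C m u)" "\<And>p. p \<in> I \<Longrightarrow> Poly_Mapping.keys p \<subseteq> C" "0 \<in> I"
    "\<And>p q. p \<in> I \<Longrightarrow> q \<in> I \<Longrightarrow> p + q \<in> I" "\<And>p. p \<in> I \<Longrightarrow> - p \<in> I"
    "\<And>p x. p \<in> I \<Longrightarrow> Poly_Mapping.keys x \<subseteq> C \<Longrightarrow> extend2 m x p \<in> I"
    "\<And>p x. p \<in> I \<Longrightarrow> Poly_Mapping.keys x \<subseteq> C \<Longrightarrow> extend2 m p x \<in> I"
  shows "ideal I (basis_algebra C m u)"
proof (rule idealI)
  interpret ring "basis_algebra C m u" by fact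
  show "ring (basis_algebra C m u)" by fact
  show "subgroup I (add_monoid (basis_algebra C m u))"
  proof (rule add.subgroupI)
    fix p assume "p \<in> I"
    then have "\<ominus>\<^bsub>basis_algebra C m u\<^esub> p = - p"
      using assms(1,2) by (simp add: basis_algebra_a_inv)
    then show "\<ominus>\<^bsub>basis_algebra C m u\<^esub> p \<in> I" using assms(5) \<open>p \<in> I\<close> by simp
  qed (use assms in \<open>auto simp: basis_algebra_simps\<close>)
qed (use assms in \<open>auto simp: basis_algebra_simps\<close>)

lemma basis_algebra_coset_eq:
  assumes "ideal I (basis_algebra C m u)" "Poly_Mapping.keys p \<subseteq> C" "Poly_Mapping.keys q \<subseteq> C"
  shows "I +>\<^bsub>basis_algebra C m u\<^esub> p = I +>\<^bsub>basis_algebra C m u\<^esub> q \<longleftrightarrow> p - q \<in> I"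
proof -
  interpret ideal I "basis_algebra C m u" by fact
  have "p \<ominus>\<^bsub>basis_algebra C m u\<^esub> q = p - q"
    using basis_algebra_a_inv[OF ring_axioms assms(3)] by (simp add: a_minus_def basis_algebra_simps)
  then show ?thesis
    using quotient_eq_iff_same_a_r_cos[OF assms(1), of p q] assms(2,3)
    by (simp add: basis_algebra_simps)
qed

lemma free_presentation_ring: "ring free_presentation"
  by (simp add: free_presentation_def poly_ext_ring)

lemma free_presentation_simps:
  "carrier free_presentation = UNIV" "mult free_presentation = extend2 mon_mult"
  "one free_presentation = basis unit_mon" "zero free_presentation = 0" "add free_presentation = (+)"
  by (simp_all add: free_presentation_def poly_ext_def basis_algebra_simps)

definition rel_ideal :: "pmon lin set"
  where "rel_ideal = Idl\<^bsub>free_presentation\<^esub> relations"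

lemma rel_ideal: "ideal rel_ideal free_presentation"
  unfolding rel_ideal_def
  by (rule ring.genideal_ideal[OF free_presentation_ring]) (simp add: free_presentation_simps)

lemma relations_rel_ideal: "r \<in> relations \<Longrightarrow> r \<in> rel_ideal"
  unfolding rel_ideal_def using ring.genideal_self[OF free_presentation_ring, of relations]
  by (auto simp: free_presentation_simps)

lemma rel_ideal_closed:
  "0 \<in> rel_ideal" "p \<in> rel_ideal \<Longrightarrow> q \<in> rel_ideal \<Longrightarrow> p + q \<in> rel_ideal"
  "p \<in> rel_ideal \<Longrightarrow> - p \<in> rel_ideal" "p \<in> rel_ideal \<Longrightarrow> q \<in> rel_ideal \<Longrightarrow> p - q \<in> rel_ideal"
  "p \<in> rel_ideal \<Longrightarrow> extend2 mon_mult x p \<in> rel_ideal"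
  "p \<in> rel_ideal \<Longrightarrow> extend2 mon_mult p x \<in> rel_ideal"
proof -
  interpret ideal rel_ideal free_presentation by (rule rel_ideal)
  show "0 \<in> rel_ideal"
    using additive_subgroup.zero_closed[OF is_additive_subgroup] by (simp add: free_presentation_simps)
  show add: "p \<in> rel_ideal \<Longrightarrow> q \<in> rel_ideal \<Longrightarrow> p + q \<in> rel_ideal" for p q
    using additive_subgroup.a_closed[OF is_additive_subgroup] by (simp add: free_presentation_simps)
  show neg: "p \<in> rel_ideal \<Longrightarrow> - p \<in> rel_ideal" for p
    using additive_subgroup.a_inv_closed[OF is_additive_subgroup, of p]
      basis_algebra_a_inv[OF poly_ext_ring[unfolded poly_ext_def], of p]
    by (simp add: free_presentation_def poly_ext_def)
  show "p \<in> rel_ideal \<Longrightarrow> q \<in> rel_ideal \<Longrightarrow> p - q \<in> rel_ideal"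
    using add[of p "- q"] neg[of q] by simp
  show "p \<in> rel_ideal \<Longrightarrow> extend2 mon_mult x p \<in> rel_ideal"
    "p \<in> rel_ideal \<Longrightarrow> extend2 mon_mult p x \<in> rel_ideal"
    using I_l_closed[of p x] I_r_closed[of p x] by (simp_all add: free_presentation_simps)
qed

text \<open>Every scalar is 0, 1 or -1, so closure under sums and negation already gives a
  subspace.\<close>

lemma rel_ideal_scale: "p \<in> rel_ideal \<Longrightarrow> scale c p \<in> rel_ideal"
  using F3_cases[of c] by (elim disjE) (simp_all add: rel_ideal_closed(1,3))

lemma pexp_add: "pexp a b c d + pexp a' b' c' d' = pexp (a + a') (b + b') (c + c') (d + d')"
  by (simp add: pexp_def single_add add_ac)

lemma single_pexp: "Poly_Mapping.single V0 n = pexp n 0 0 0" "Poly_Mapping.single Beta n = pexp 0 0 0 n"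
  by (simp_all add: pexp_def)

lemma relations_eq:
  "relations = {basis (pexp 1 0 0 0, {|Alpha1|}), basis (pexp 1 0 0 0, {|Alpha2|}),
    basis (0, {|Alpha1, Alpha2|}) - basis (pexp 1 0 0 1, {||})}"
proof -
  have "{|Alpha2, Alpha1|} = {|Alpha1, Alpha2|}" by auto
  then show ?thesis
    by (simp add: relations_def poly_gen_def ext_gen_def free_presentation_simps extend2_def
        single_pexp pexp_add crossings_alpha)
qed

lemma v0_alpha_rel_ideal: "basis (pexp (Suc a) b c d, finsert y S) \<in> rel_ideal"
proof -
  have rel: "basis (pexp 1 0 0 0, {|y|}) \<in> rel_ideal"
    by (rule relations_rel_ideal) (cases y; simp add: relations_eq)
  define S' where "S' = S |-| {|y|}"
  have S: "finsert y S = {|y|} |\<union>| S'" "{|y|} |\<inter>| S' = {||}" by (auto simp: S'_def)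
  have "extend2 mon_mult (basis (pexp 1 0 0 0, {|y|})) (basis (pexp a b c d, S')) =
      Poly_Mapping.single (pexp (Suc a) b c d, finsert y S) ((-1) ^ crossings {|y|} S')"
    unfolding S by (simp add: extend2_def pexp_add S(2))
  then have "Poly_Mapping.single (pexp (Suc a) b c d, finsert y S) ((-1) ^ crossings {|y|} S') \<in> rel_ideal"
    using rel_ideal_closed(6)[OF rel] by metis
  \<comment> \<open>Multiplying by the same sign again removes it.\<close>
  then have "scale ((-1) ^ crossings {|y|} S') (Poly_Mapping.single (pexp (Suc a) b c d, finsert y S)
      ((-1) ^ crossings {|y|} S')) \<in> rel_ideal"
    by (rule rel_ideal_scale)
  moreover have "(- 1 :: F3) ^ n * (- 1) ^ n = 1" for n
    by (simp flip: power_mult_distrib)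
  ultimately show ?thesis by simp
qed

lemma alpha_alpha_rel_ideal:
  "basis (pexp a b c d, {|Alpha1, Alpha2|}) - basis (pexp (Suc a) b c (Suc d), {||}) \<in> rel_ideal"
proof -
  have "basis (0, {|Alpha1, Alpha2|}) - basis (pexp 1 0 0 1, {||}) \<in> relations"
    by (simp add: relations_eq)
  from rel_ideal_closed(5)[OF relations_rel_ideal[OF this], of "basis (pexp a b c d, {||})"]
  show ?thesis by (simp add: extend2_def extend_diff pexp_add)
qed

text \<open>v_0^2 beta = v_0 alpha_1 alpha_2 = 0 in the quotient. This consequence of the relations
  is the source of the condition on \<open>n0\<close> and \<open>k\<close> in
  \<open>nfb\<close>.\<close>

lemma v0_v0_beta_rel_ideal: "basis (pexp (Suc (Suc a)) b c (Suc d), {||}) \<in> rel_ideal"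
  using rel_ideal_closed(4)[OF v0_alpha_rel_ideal[of a b c d Alpha1 "{|Alpha2|}"]
    alpha_alpha_rel_ideal[of "Suc a" b c d]]
  by simp

text \<open>The normal form of the class of a cocycle. Its values lie in the free algebra; it is
  multiplicative modulo \<open>rel_ideal\<close>.\<close>

definition th :: "gam list lin \<Rightarrow> pmon lin"
  where "th z = nf (ev z)"

lemma th_simps [simp]:
  "th 0 = 0" "th (p + q) = th p + th q" "th (p - q) = th p - th q" "th (- p) = - th p"
  "th (scale c p) = scale c (th p)"
  by (simp_all add: th_def)

lemma th_dT [simp]: "th (dT w) = 0"
  by (simp add: th_def flip: dM_ev)

text \<open>Monomials in normal form are reproduced. Any other one contains v_0 with some alpha, or
  v_0^2 beta, or alpha_1 alpha_2, and the relations account for the change.\<close>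

lemma th_phib: "th (phib m) - basis m \<in> rel_ideal"
proof -
  obtain e S where "m = (e, S)" by (cases m)
  then obtain a b c d where m: "m = (pexp a b c d, S)" using pexp_lookup[of e] by metis
  have th: "th (phib m) = nf (sh (Poly_Mapping.lookup (pexp a b c d)) (ev (ephi S)))"
    unfolding m th_def ev_phib ..
  consider "S = {||}" | "S = {|Alpha1|}" | "S = {|Alpha2|}" | "S = {|Alpha1, Alpha2|}"
    using ext_sets[of S] by blast
  then show ?thesis
  proof cases
    case 1
    show ?thesis
    proof (cases "a \<le> 1 \<or> d = 0")
      case True
      then show ?thesis using 1 th by (simp add: m ev_ephi rel_ideal_closed)
    next
      case False
      then obtain a' d' where "a = Suc (Suc a')" "d = Suc d'"
        by (metis One_nat_def Suc_le_eq le_0_eq not0_implies_Suc not_less_eq_eq)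
      then show ?thesis using 1 th rel_ideal_closed(3)[OF v0_v0_beta_rel_ideal]
        by (simp add: m ev_ephi)
    qed
  next
    case 2
    then show ?thesis
      using th rel_ideal_closed(3)[OF v0_alpha_rel_ideal] by (cases a) (simp_all add: m ev_ephi rel_ideal_closed)
  next
    case 3
    have "Suc (3 * b) mod 3 = 1" "Suc (3 * b) div 3 = b" by presburger+
    with 3 show ?thesis
      using th rel_ideal_closed(3)[OF v0_alpha_rel_ideal] by (cases a) (simp_all add: m ev_ephi rel_ideal_closed)
  next
    case 4
    show ?thesis
    proof (cases a)
      case 0
      then show ?thesis
        using 4 th rel_ideal_closed(3)[OF alpha_alpha_rel_ideal[of 0 b c d]] by (simp add: m ev_ephi)
    next
      case (Suc a')
      then show ?thesis
        using 4 th rel_ideal_closed(3)[OF v0_alpha_rel_ideal] by (simp add: m ev_ephi)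
    qed
  qed
qed

lemma th_phi: "th (phi p) - p \<in> rel_ideal"
proof -
  have "th (phi p) - p = extend (\<lambda>m. th (phib m) - basis m) p"
    by (simp add: th_def nf_def ev_def actT_def phi_def extend_extend extend_fun_diff)
  also have "\<dots> \<in> rel_ideal"
    by (rule extend_eq_induct[OF refl]) (auto intro: rel_ideal_closed rel_ideal_scale th_phib)
  finally show ?thesis .
qed

lemma th_unit: "th (basis []) = basis unit_mon"
  by (simp add: th_def ev_def pexp_def)

section \<open>Multiplicativity and kernel of the normal form\<close>

definition ZT :: "gam list lin set"
  where "ZT = {z \<in> supp LT. dT z = 0}"

lemma phi_ZT: "phi p \<in> ZT"
  by (simp add: ZT_def phi_LT)

text \<open>The image of the difference in M is a boundary by \<open>nf_cycle\<close>, and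
  \<open>coboundaryI\<close> transports this to T.\<close>

lemma cocycle_phi_th: "z \<in> ZT \<Longrightarrow> z - phi (th z) \<in> dT ` supp LT"
  by (rule coboundaryI) (auto simp: ZT_def phi_LT th_def nf_cycle dM_ev)

lemma th_eq_0: "z \<in> ZT \<Longrightarrow> th z = 0 \<Longrightarrow> z \<in> dT ` supp LT"
  using cocycle_phi_th[of z] by simp

lemma ev_conc_coboundary_left:
  "z \<in> ZT \<Longrightarrow> ev (conc (dT w) z) \<in> range dM"
  using ev_coboundary[of "conc w z"] by (simp add: dT_conc ZT_def del: ev_simps)

text \<open>z d(w) is the differential of \<open>sigma z\<close> times w, where \<open>sigma\<close>
  compensates the sign in the Leibniz rule.\<close>

lemma ev_conc_coboundary_right:
  assumes "z \<in> ZT"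
  shows "ev (conc z (dT w)) \<in> range dM"
proof -
  have "dT (conc (sigma z) w) = conc z (dT w)"
    using assms by (simp add: dT_conc dT_sigma ZT_def sigma_simps)
  then show ?thesis using ev_coboundary[of "conc (sigma z) w"] by simp
qed

lemma nf_range_dM: "m \<in> range dM \<Longrightarrow> nf m = 0"
  by auto

text \<open>Both cocycles may be replaced, up to coboundaries, by their representatives under
  \<open>phi\<close>, whose products are known from M.\<close>

lemma th_conc:
  assumes "z \<in> ZT" "z' \<in> ZT"
  shows "th (conc z z') - extend2 mon_mult (th z) (th z') \<in> rel_ideal"
proof -
  let ?p = "th z" and ?q = "th z'"
  obtain w w' where w: "z - phi ?p = dT w" "z' - phi ?q = dT w'"
    using cocycle_phi_th[OF assms(1)] cocycle_phi_th[OF assms(2)] by (auto simp: image_iff)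
  have "conc z z' = conc (phi ?p) (phi ?q) + conc (phi ?p) (dT w') + conc (dT w) z'"
    by (simp flip: w add: conc_diff)
  then have "ev (conc z z') - ev (phi (extend2 mon_mult ?p ?q)) =
      (ev (conc (phi ?p) (phi ?q)) - ev (phi (extend2 mon_mult ?p ?q)))
      + ev (conc (phi ?p) (dT w')) + ev (conc (dT w) z')"
    by (simp del: ev_simps(6))
  also have "\<dots> \<in> range dM"
    by (intro dM_range_closed ev_phi_mult ev_conc_coboundary_right ev_conc_coboundary_left phi_ZT assms)
  finally have "nf (ev (conc z z') - ev (phi (extend2 mon_mult ?p ?q))) = 0"
    by (rule nf_range_dM)
  then have "th (conc z z') = th (phi (extend2 mon_mult ?p ?q))"
    by (simp add: th_def del: ev_simps(6))
  then show ?thesis using th_phi by simp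
qed

text \<open>The elements with this property form an ideal: \<open>phi\<close> sends them to
  coboundaries, and coboundaries absorb products with cocycles. So only the three relations have to
  be evaluated.\<close>

lemma rel_ideal_th_phi:
  assumes "r \<in> rel_ideal"
  shows "th (phi r) = 0"
proof -
  define J where "J = {r. th (phi r) = 0}"
  have mult: "th (phi (extend2 mon_mult p q)) = nf (ev (conc (phi p) (phi q)))" for p q
    using nf_range_dM[OF ev_phi_mult[of p q]] by (simp add: th_def del: ev_simps(6))
  have bd: "\<exists>w. phi r = dT w" if "r \<in> J" for r
    using th_eq_0[OF phi_ZT] that by (auto simp: J_def)
  have "ideal J free_presentation"
    unfolding free_presentation_def poly_ext_def
  proof (rule basis_algebra_idealI[OF poly_ext_ring[unfolded poly_ext_def]])
    fix p x assume "p \<in> J"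
    then obtain w where w: "phi p = dT w" using bd by blast
    show "extend2 mon_mult x p \<in> J" "extend2 mon_mult p x \<in> J"
      unfolding J_def mem_Collect_eq mult w
      by (intro nf_range_dM ev_conc_coboundary_right ev_conc_coboundary_left phi_ZT)+
  qed (auto simp: J_def)
  moreover have "relations \<subseteq> J"
    by (simp add: relations_eq J_def th_def ev_phib ev_ephi del: phib.simps)
  ultimately have "rel_ideal \<subseteq> J"
    unfolding rel_ideal_def by (rule ring.genideal_minimal[OF free_presentation_ring])
  then show ?thesis using assms by (auto simp: J_def)
qed

text \<open>z is cohomologous to \<open>phi (th z)\<close>, and \<open>phi\<close> of a relation has
  normal form 0.\<close>

lemma th_rel_ideal:
  assumes "z \<in> ZT" "th z \<in> rel_ideal"
  shows "z \<in> dT ` supp LT"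
proof -
  obtain w where "z - phi (th z) = dT w"
    using cocycle_phi_th[OF assms(1)] by (auto simp: image_iff)
  then have "th (z - phi (th z)) = 0" by simp
  then have "th z = 0" using rel_ideal_th_phi[OF assms(2)] by simp
  then show ?thesis by (rule th_eq_0[OF assms(1)])
qed

lemma th_deg:
  assumes "z \<in> supp {w. length w = s \<and> wdeg w = t}"
  shows "th z \<in> supp {m. mon_deg poly_s ext_s m = s \<and> mon_deg poly_t ext_t m = t}"
proof -
  have "ev z \<in> supp {b. ms b = s \<and> mt b = t}"
    unfolding ev_def actT_def
  proof (rule supp_extend[OF assms])
    fix w assume "w \<in> {w. length w = s \<and> wdeg w = t}"
    then show "actw w (basis munit) \<in> supp {b. ms b = s \<and> mt b = t}"
      using actw_supp[of "basis munit" 0 0 w] by simp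
  qed
  then show ?thesis
    unfolding th_def nf_def by (rule supp_extend) (rule supp_mono[OF nfb_deg], auto)
qed

lemma phi_deg:
  assumes "p \<in> supp {m. mon_deg poly_s ext_s m = s \<and> mon_deg poly_t ext_t m = t}"
  shows "phi p \<in> supp {w \<in> LT. length w = s \<and> wdeg w = t}"
  unfolding phi_def using assms by (rule supp_extend) (rule supp_mono[OF phib_deg], auto)

section \<open>Comparison with the quotient of the dual Steenrod algebra\<close>

text \<open>The monomials that survive in Gamma. Index 0 of the polynomial part is xi_1, hence the
  bound 2 there and 0 at the other indices.\<close>

fun small :: "smon \<Rightarrow> bool"
  where "small (e, S) \<longleftrightarrow> (\<forall>n. Poly_Mapping.lookup e n \<le> (if n = 0 then 2 else 0)) \<and> (\<forall>y. y |\<in>| S \<longrightarrow> y \<le> 2)"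

text \<open>Meaningful on small monomials: exponents above 2 also give \<open>H2\<close>, and so
  \<open>pr\<close> tests \<open>small\<close> first.\<close>

fun cog :: "smon \<Rightarrow> gam"
  where "cog (e, S) =
    (if Poly_Mapping.lookup e 0 = 0 then H0 else if Poly_Mapping.lookup e 0 = 1 then H1 else H2,
     0 |\<in>| S, 1 |\<in>| S, 2 |\<in>| S)"

fun iota :: "gam \<Rightarrow> smon"
  where "iota (a, x0, x1, x2) = (Poly_Mapping.single 0 (hnat a),
    (if x0 then {|0|} else {||}) |\<union>| (if x1 then {|1|} else {||}) |\<union>| (if x2 then {|2|} else {||}))"

lemma small_iota [simp]: "small (iota g)"
  by (cases g; cases "fst g") (auto simp: lookup_single when_def simp del: single_numeral)

lemma cog_iota [simp]: "cog (iota g) = g"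
  by (cases g; cases "fst g") (auto simp: lookup_single when_def simp del: single_numeral)

lemma iota_cog: "small m \<Longrightarrow> iota (cog m) = m"
proof -
  assume small: "small m"
  obtain e S where m: "m = (e, S)" by (cases m)
  have e: "Poly_Mapping.lookup e n \<le> (if n = 0 then 2 else 0)" for n using small m by simp
  have S: "y \<le> 2" if "y |\<in>| S" for y using small m that by simp
  have "Poly_Mapping.single 0 (hnat (fst (cog m))) = e"
  proof (rule poly_mapping_eqI)
    fix n show "Poly_Mapping.lookup (Poly_Mapping.single 0 (hnat (fst (cog m)))) n = Poly_Mapping.lookup e n"
      using e[of n] by (cases "n = 0") (auto simp: m lookup_single when_def)
  qed
  moreover have "snd (iota (cog m)) = S"
  proof (rule fset_eqI)
    fix y
    have "y \<le> 2 \<Longrightarrow> y = 0 \<or> y = 1 \<or> y = 2" for y :: nat by arith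
    then show "y |\<in>| snd (iota (cog m)) \<longleftrightarrow> y |\<in>| S"
      using S[of y] by (auto simp: m)
  qed
  ultimately show ?thesis by (simp add: m prod_eq_iff)
qed

lemma iota_inj: "inj iota"
  by (metis cog_iota injI)

lemma small_cases:
  assumes "small m"
  obtains g where "m = iota g"
  using iota_cog[OF assms] by metis

lemma iota_unit: "iota gunit = unit_mon"
  by simp

lemma iota_eq_unit [simp]: "iota g = unit_mon \<longleftrightarrow> g = gunit"
  using iota_inj iota_unit by (metis injD)

lemma sdeg_iota: "sdeg (iota g) = gdeg g"
proof -
  obtain a x0 x1 x2 where g: "g = (a, x0, x1, x2)" by (cases g)
  have k: "(\<Sum>x\<in>Poly_Mapping.keys (Poly_Mapping.single 0 n). Poly_Mapping.lookup (Poly_Mapping.single 0 n) x * (2 * (3 ^ (x + 1) - 1))) = 4 * n" for n :: nat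
    by (cases "n = 0") auto
  show ?thesis
    unfolding g sdeg_def iota.simps mon_deg.simps k
    by (cases x0; cases x1; cases x2) simp_all
qed

lemma odd_gdeg: "odd (gdeg g) \<longleftrightarrow> gpar g"
  by (cases g rule: gdeg.cases) auto

lemma sign_gdeg: "(- 1 :: F3) ^ gdeg g = gs g"
  using odd_gdeg[of g] by (auto simp: gs_def sg_def)

definition pr :: "smon \<Rightarrow> gam lin"
  where "pr m = (if small m then basis (cog m) else 0)"

lemma pr_iota [simp]: "pr (iota g) = basis g"
  by (simp add: pr_def)

lemma small_factor:
  assumes "small (e + f, S |\<union>| T)"
  shows "small (e, S)" "small (f, T)"
proof -
  have e: "Poly_Mapping.lookup e n + Poly_Mapping.lookup f n \<le> (if n = 0 then 2 else 0)" for n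
    using assms unfolding small.simps lookup_add by blast
  have S: "y \<le> 2" if "y |\<in>| S |\<union>| T" for y
    using assms that unfolding small.simps by blast
  show "small (e, S)" "small (f, T)"
    unfolding small.simps using e S by (blast intro: add_leD1 add_leD2 funionI1 funionI2)+
qed

abbreviation gext :: "bool \<Rightarrow> bool \<Rightarrow> bool \<Rightarrow> nat fset"
  where "gext x0 x1 x2 \<equiv> (if x0 then {|0|} else {||}) |\<union>| (if x1 then {|1|} else {||}) |\<union>|
    (if x2 then {|2|} else {||})"

lemma crossings_finsert:
  "s |\<notin>| S \<Longrightarrow> crossings (finsert s S) T = crossings {|s|} T + crossings S T"
  "s |\<notin>| S \<Longrightarrow> crossings T (finsert s S) = crossings T {|s|} + crossings T S"
  using crossings_union_left[of "{|s|}" S T] crossings_union_right[of "{|s|}" S T] by simp_all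

lemma crossings_single: "crossings {|s|} {|t|} = of_bool (t < s)"
proof -
  have "{(s', t'). s' |\<in>| {|s|} \<and> t' |\<in>| {|t|} \<and> t' < s'} = (if t < s then {(s, t)} else {})"
    by auto
  then show ?thesis by (simp only: crossings_def) simp
qed

lemma crossings_gext:
  "(- 1 :: F3) ^ crossings (gext x0 x1 x2) (gext y0 y1 y2) =
    of_int (sg ((x1 \<and> y0) \<noteq> ((x2 \<and> y0) \<noteq> (x2 \<and> y1))))"
proof -
  have "crossings (gext x0 x1 x2) (gext y0 y1 y2) =
      of_bool (x1 \<and> y0) + (of_bool (x2 \<and> y0) + of_bool (x2 \<and> y1))"
    by (cases x0; cases x1; cases x2; cases y0; cases y1; cases y2)
      (simp_all add: crossings_finsert[where S = "{|_|}"] crossings_finsert[where S = "finsert _ {|_|}"]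
        crossings_single)
  then show ?thesis by (auto simp: sg_def)
qed

lemma pr_mon_mult_iota: "extend pr (mon_mult (iota g) (iota h)) = lc (gmul g h)"
proof -
  obtain a x0 x1 x2 where g: "g = (a, x0, x1, x2)" by (cases g)
  obtain b y0 y1 y2 where h: "h = (b, y0, y1, y2)" by (cases h)
  let ?S = "gext x0 x1 x2" and ?T = "gext y0 y1 y2"
  have disj: "?S |\<inter>| ?T = {||} \<longleftrightarrow> \<not> (x0 \<and> y0 \<or> x1 \<and> y1 \<or> x2 \<and> y2)"
    by (auto simp: fset_eq_iff)
  have add: "Poly_Mapping.single (0::nat) (hnat a) + Poly_Mapping.single 0 (hnat b) =
      Poly_Mapping.single 0 (hnat a + hnat b)"
    by (simp add: single_add)
  show ?thesis
  proof (cases "?S |\<inter>| ?T = {||}")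
    case True
    show ?thesis
    proof (cases "hadd a b")
      case None
      have "\<not> small (Poly_Mapping.single 0 (hnat a + hnat b), ?S |\<union>| ?T)"
      proof (intro notI)
        assume "small (Poly_Mapping.single 0 (hnat a + hnat b), ?S |\<union>| ?T)"
        then have "\<forall>n. Poly_Mapping.lookup (Poly_Mapping.single (0::nat) (hnat a + hnat b)) n \<le> (if n = 0 then 2 else 0)"
          unfolding small.simps by (rule conjunct1)
        from this[THEN spec, of 0] have "hnat a + hnat b \<le> 2" by simp
        then show False using None by (cases a; cases b) simp_all
      qed
      then have "pr (Poly_Mapping.single 0 (hnat a + hnat b), ?S |\<union>| ?T) = 0"
        by (simp add: pr_def del: small.simps cog.simps)
      then show ?thesis
        using True None unfolding g h iota.simps mon_mult.simps add by simp
    next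
      case (Some c)
      then have c: "hnat a + hnat b = hnat c"
        by (cases a; cases b) auto
      have "(Poly_Mapping.single 0 (hnat a + hnat b), ?S |\<union>| ?T) = iota (c, x0 \<or> y0, x1 \<or> y1, x2 \<or> y2)"
        by (auto simp: c)
      then have "pr (Poly_Mapping.single 0 (hnat a + hnat b), ?S |\<union>| ?T) = basis (c, x0 \<or> y0, x1 \<or> y1, x2 \<or> y2)"
        using pr_iota by metis
      then show ?thesis
        using True Some disj unfolding g h iota.simps mon_mult.simps add
        by (simp add: crossings_gext) blast
    qed
  next
    case False
    then show ?thesis
      using disj unfolding g h iota.simps mon_mult.simps by (simp split: option.split)
  qed
qed

text \<open>A product of monomials can be small only if both factors are, so discarding the others
  respects products.\<close>

lemma pr_mon_mult: "extend pr (mon_mult m n) = extend2 (\<lambda>g h. lc (gmul g h)) (pr m) (pr n)"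
proof (cases "small m \<and> small n")
  case True
  then show ?thesis
    by (auto elim!: small_cases simp: pr_mon_mult_iota extend2_def simp del: iota.simps mon_mult.simps gmul.simps)
next
  case False
  obtain e S f T where mn: "m = (e, S)" "n = (f, T)" by (metis prod.exhaust)
  have "\<not> small (e + f, S |\<union>| T)" using small_factor[of e f S T] False unfolding mn by blast
  then have "extend pr (mon_mult m n) = 0" by (simp add: mn pr_def del: small.simps cog.simps)
  moreover have "pr m = 0 \<or> pr n = 0" using False by (auto simp: pr_def)
  ultimately show ?thesis by (auto simp: extend2_def)
qed

section \<open>The coproduct of Gamma in coordinates\<close>

definition pr2 :: "(smon \<times> smon) lin \<Rightarrow> (gam \<times> gam) lin"
  where "pr2 = extend (\<lambda>(a, b). tens (pr a) (pr b))"

definition mm2 :: "(gam \<times> gam) lin \<Rightarrow> (gam \<times> gam) lin \<Rightarrow> (gam \<times> gam) lin"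
  where "mm2 = extend2 (\<lambda>a b. lc (gmul2 a b))"

lemma lc_lmul2: "lc (lmul2 xs ys) = mm2 (lc xs) (lc ys)"
  by (simp add: lmul2_def mm2_def extend2_def)

lemma tens_extend: "tens (extend f p) (extend g q) = extend2 (\<lambda>a b. tens (f a) (g b)) p q"
proof -
  have l: "tens (extend f p) r = extend (\<lambda>a. tens (f a) r) p" for r
    by (simp add: tens_def extend2_def extend_extend)
  have r: "tens r (extend g q) = extend (\<lambda>b. tens r (g b)) q" for r
    unfolding tens_def extend2_def extend_extend by (rule extend_swap)
  show ?thesis by (simp only: l extend2_def) (simp only: r)
qed

lemma pr2_tens: "pr2 (tens p q) = tens (extend pr p) (extend pr q)"
  unfolding tens_extend by (simp add: pr2_def tens_def extend2_def extend_extend)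

lemma pr2_simps [simp]:
  "pr2 0 = 0" "pr2 (p + q) = pr2 p + pr2 q" "pr2 (scale c p) = scale c (pr2 p)"
  by (simp_all add: pr2_def extend_add extend_scale)

lemma lc_gmul2: "lc (gmul2 (a, b) (c, d)) =
  scale (of_int (sg (gpar b \<and> gpar c))) (tens (lc (gmul a c)) (lc (gmul b d)))"
proof -
  have *: "lc [(k * s * t, (x, y)). (s, x) \<leftarrow> xs, (t, y) \<leftarrow> ys] = scale (of_int k) (tens (lc xs) (lc ys))"
    for k and xs ys :: "(int \<times> gam) list"
  proof (induction xs)
    case (Cons sx xs)
    obtain s x where sx: "sx = (s, x)" by (cases sx)
    have "lc [(k * s * t, (x, y)). (t, y) \<leftarrow> ys] = scale (of_int k) (tens (Poly_Mapping.single x (of_int s)) (lc ys))"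
      by (induction ys) (auto simp: tens_def extend2_def extend_add scale_add mult_ac)
    then show ?case using Cons by (simp add: sx tens_def extend2_def extend_add scale_add)
  qed simp
  show ?thesis using * by simp
qed

lemma pr2_mult_basis:
  "pr2 (scale ((-1) ^ (sdeg b * sdeg c)) (tens (mon_mult a c) (mon_mult b d))) =
    mm2 (tens (pr a) (pr b)) (tens (pr c) (pr d))"
proof (cases "small a \<and> small b \<and> small c \<and> small d")
  case True
  then obtain a' b' c' d' where abcd: "a = iota a'" "b = iota b'" "c = iota c'" "d = iota d'"
    by (metis iota_cog)
  have "(- 1 :: F3) ^ (sdeg b * sdeg c) = of_int (sg (gpar b' \<and> gpar c'))"
    unfolding abcd sdeg_iota using odd_gdeg[of b'] odd_gdeg[of c'] by (auto simp: sg_def)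
  then show ?thesis
    unfolding abcd
    by (simp add: pr2_tens pr_mon_mult_iota mm2_def extend2_def lc_gmul2
        del: iota.simps mon_mult.simps gmul.simps gmul2.simps)
next
  case False
  then have "pr a = 0 \<or> pr b = 0 \<or> pr c = 0 \<or> pr d = 0" by (auto simp: pr_def)
  then show ?thesis
    by (auto simp: pr2_tens pr_mon_mult mm2_def extend2_def)
qed

lemma mm2_bilinear:
  "mm2 (extend f p) q = extend (\<lambda>a. mm2 (f a) q) p"
  "mm2 q (extend f p) = extend (\<lambda>a. mm2 q (f a)) p"
proof -
  show "mm2 (extend f p) q = extend (\<lambda>a. mm2 (f a) q) p"
    by (simp add: mm2_def extend2_def extend_extend)
  show "mm2 q (extend f p) = extend (\<lambda>a. mm2 q (f a)) p"
    unfolding mm2_def extend2_def extend_extend by (rule extend_swap)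
qed

lemma pr2_mult: "pr2 (x \<otimes>\<^bsub>steenrod2\<^esub> y) = mm2 (pr2 x) (pr2 y)"
proof -
  have *: "pr2 ((\<lambda>(a, b) (c, d). scale ((-1) ^ (sdeg b * sdeg c)) (tens (mon_mult a c) (mon_mult b d))) ab cd)
      = mm2 ((\<lambda>(a, b). tens (pr a) (pr b)) ab) ((\<lambda>(a, b). tens (pr a) (pr b)) cd)" for ab cd
    by (cases ab; cases cd) (simp only: case_prod_conv pr2_mult_basis)
  have pr2_extend: "pr2 (extend g r) = extend (\<lambda>b. pr2 (g b)) r" for g and r :: "'b lin"
    by (simp add: pr2_def extend_extend)
  show ?thesis
    unfolding steenrod2_def basis_algebra_simps extend2_def pr2_extend *
    by (simp only: pr2_def mm2_bilinear(1)) (simp only: mm2_bilinear(2))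
qed

lemma steenrod_ring: "ring steenrod"
  by (simp add: steenrod_def poly_ext_ring)

lemma steenrod_simps:
  "carrier steenrod = UNIV" "mult steenrod = extend2 mon_mult" "one steenrod = basis unit_mon"
  "zero steenrod = 0" "add steenrod = (+)"
  by (simp_all add: steenrod_def poly_ext_def basis_algebra_simps)

lemma steenrod2_simps:
  "carrier steenrod2 = UNIV" "one steenrod2 = basis (unit_mon, unit_mon)"
  by (simp_all add: steenrod2_def basis_algebra_simps)

lemma xi_0: "xi 0 = basis unit_mon"
  by (simp add: xi_def steenrod_simps)

lemma xi_pow: "xi (Suc n) [^]\<^bsub>steenrod\<^esub> (k::nat) = basis (Poly_Mapping.single n k, {||})"
proof -
  interpret ring steenrod by (rule steenrod_ring)
  show ?thesis
    by (induction k)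
      (simp_all add: steenrod_simps xi_def poly_gen_def extend2_def add.commute flip: single_add)
qed

lemma xi_0_pow: "xi 0 [^]\<^bsub>steenrod\<^esub> (k::nat) = basis unit_mon"
proof -
  interpret ring steenrod by (rule steenrod_ring)
  show ?thesis using nat_pow_one[of k] by (simp add: xi_def steenrod_simps)
qed

lemma xi_1: "xi (Suc n) = basis (Poly_Mapping.single n 1, {||})"
  by (simp add: xi_def poly_gen_def)

lemma small_single: "small (Poly_Mapping.single n k, {||}) \<longleftrightarrow> k = 0 \<or> n = 0 \<and> k \<le> 2"
  by (auto simp: lookup_single when_def split: if_splits)

lemma small_tau: "small (0, {|n|}) \<longleftrightarrow> n \<le> 2"
  by auto

lemma pr_unit: "pr unit_mon = basis gunit"
  by (simp add: pr_def)

lemma three_le_pow: "0 < i \<Longrightarrow> 3 \<le> (3::nat) ^ i"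
  using power_increasing[of 1 i "3::nat"] by simp

text \<open>Why the coproducts become short in Gamma: inner terms carry a 3^i-th power with i > 0,
  and xi_n itself vanishes for n at least 2.\<close>

lemma pr_xi_pow:
  "0 < i \<Longrightarrow> i < n \<Longrightarrow> extend pr (xi (n - i) [^]\<^bsub>steenrod\<^esub> ((3::nat) ^ i)) = 0"
  "2 \<le> n \<Longrightarrow> extend pr (xi (n - 0) [^]\<^bsub>steenrod\<^esub> ((3::nat) ^ 0)) = 0"
proof -
  assume i: "0 < i" "i < n"
  then obtain k where k: "n - i = Suc k" by (metis Suc_diff_Suc)
  show "extend pr (xi (n - i) [^]\<^bsub>steenrod\<^esub> ((3::nat) ^ i)) = 0"
    using three_le_pow[OF i(1)] unfolding k xi_pow by (simp add: pr_def small_single del: small.simps cog.simps)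
next
  assume "2 \<le> n"
  then obtain k where k: "n = Suc (Suc k)" by (metis add_2_eq_Suc le_Suc_ex)
  show "extend pr (xi (n - 0) [^]\<^bsub>steenrod\<^esub> ((3::nat) ^ 0)) = 0"
    unfolding k diff_zero xi_pow by (simp add: pr_def small_single del: small.simps cog.simps)
qed

lemma pr2_sum: "pr2 (sum f A) = (\<Sum>a\<in>A. pr2 (f a))"
  by (simp add: pr2_def extend_sum)

lemma pr2_psi_xi: "2 \<le> n \<Longrightarrow> pr2 (psi_xi n) = 0"
proof -
  assume n: "2 \<le> n"
  have "extend pr (xi n) = 0"
    using n by (cases n) (auto simp: xi_1 pr_def small_single simp del: small.simps cog.simps)
  then have "pr2 (tens (xi (n - i) [^]\<^bsub>steenrod\<^esub> ((3::nat) ^ i)) (xi i)) = 0" if "i \<le> n" for i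
    using that n pr_xi_pow(1)[of i n] pr_xi_pow(2)[of n]
    by (cases "i = 0"; cases "i = n") (simp_all add: pr2_tens)
  then show ?thesis unfolding psi_xi_def pr2_sum by simp
qed

lemma pr_tau: "extend pr (tau n) = (if n \<le> 2 then basis (cog (0, {|n|})) else 0)"
  by (simp add: tau_def ext_gen_def pr_def small_tau del: small.simps cog.simps)

lemma pr2_psi_tau: "3 \<le> n \<Longrightarrow> pr2 (psi_tau n) = 0"
proof -
  assume n: "3 \<le> n"
  have "extend pr (tau n) = 0" using n by (simp add: pr_tau)
  moreover from this have "pr2 (tens (xi (n - i) [^]\<^bsub>steenrod\<^esub> ((3::nat) ^ i)) (tau i)) = 0" if "i \<le> n" for i
    using that n pr_xi_pow(1)[of i n] pr_xi_pow(2)[of n]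
    by (cases "i = 0"; cases "i = n") (simp_all add: pr2_tens)
  ultimately show ?thesis unfolding psi_tau_def pr2_sum pr2_simps by (simp add: pr2_tens)
qed

lemma cog_simps:
  "cog unit_mon = gunit" "cog (Poly_Mapping.single 0 (Suc 0), {||}) = gxi"
  "cog (0, {|0|}) = gtau0" "cog (0, {|1|}) = gtau1" "cog (0, {|2|}) = gtau2"
  by (simp_all add: gen_defs lookup_one)

lemma pr2_psi_xi_1: "pr2 (psi_xi 1) = lc cop_xi"
proof -
  have "psi_xi 1 = tens (xi 1 [^]\<^bsub>steenrod\<^esub> (1::nat)) (xi 0) + tens (xi 0 [^]\<^bsub>steenrod\<^esub> (3::nat)) (xi 1)"
    by (simp add: psi_xi_def)
  also have "pr2 \<dots> = lc cop_xi"
  proof -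
    have "extend pr (xi 1 [^]\<^bsub>steenrod\<^esub> (1::nat)) = basis gxi"
      unfolding One_nat_def xi_pow by (simp add: pr_def small_single cog_simps del: small.simps cog.simps)
    moreover have "extend pr (xi 1) = basis gxi"
      unfolding One_nat_def xi_1 by (simp add: pr_def small_single cog_simps del: small.simps cog.simps)
    moreover have "extend pr (xi 0 [^]\<^bsub>steenrod\<^esub> (3::nat)) = basis gunit"
      unfolding xi_0_pow by (simp add: pr_unit)
    moreover have "extend pr (xi 0) = basis gunit"
      unfolding xi_0 by (simp add: pr_unit)
    ultimately show ?thesis by (simp add: pr2_tens cop_xi_def)
  qed
  finally show ?thesis .
qed

lemma extend_pr_unit: "extend pr (\<one>\<^bsub>steenrod\<^esub>) = basis gunit"
  by (simp add: steenrod_simps pr_unit)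

lemma pr2_psi_tau_small:
  assumes "n \<le> 2"
  shows "pr2 (psi_tau n) = lc (cop_tau n)"
proof -
  have last: "pr2 (tens (xi (n - n) [^]\<^bsub>steenrod\<^esub> ((3::nat) ^ n)) (tau n)) = basis (gunit, cog (0, {|n|}))"
    unfolding diff_self_eq_0 xi_0_pow using assms by (simp add: pr2_tens pr_tau pr_unit)
  have first: "pr2 (tens (tau n) \<one>\<^bsub>steenrod\<^esub>) = basis (cog (0, {|n|}), gunit)"
    using assms by (simp add: pr2_tens pr_tau extend_pr_unit)
  have split: "pr2 (psi_tau n) = basis (cog (0, {|n|}), gunit) + (basis (gunit, cog (0, {|n|})) +
    (\<Sum>i<n. pr2 (tens (xi (n - i) [^]\<^bsub>steenrod\<^esub> ((3::nat) ^ i)) (tau i))))"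
    unfolding psi_tau_def pr2_simps pr2_sum first lessThan_Suc_atMost[symmetric] sum.lessThan_Suc last
    by (simp add: add_ac)
  consider "n = 0" | "n = 1" | "n = 2" using assms by linarith
  then show ?thesis
  proof cases
    case 1
    then show ?thesis using split by (simp add: cop_tau_def cog_simps del: cog.simps)
  next
    case 2
    have "pr2 (tens (xi 1 [^]\<^bsub>steenrod\<^esub> (1::nat)) (tau 0)) = basis (gxi, gtau0)"
      unfolding One_nat_def xi_pow
      by (simp add: pr2_tens pr_tau pr_def small_single cog_simps del: small.simps cog.simps)
    with 2 show ?thesis using split
      by (simp add: cop_tau_def cog_simps[unfolded One_nat_def] add_ac del: cog.simps)
  next
    case 3
    have "pr2 (tens (xi (2 - i) [^]\<^bsub>steenrod\<^esub> ((3::nat) ^ i)) (tau i)) = 0" if "i < 2" for i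
      using that pr_xi_pow(1)[of i 2] pr_xi_pow(2)[of 2] by (cases "i = 0") (simp_all add: pr2_tens)
    then have "(\<Sum>i<2. pr2 (tens (xi (2 - i) [^]\<^bsub>steenrod\<^esub> ((3::nat) ^ i)) (tau i))) = 0"
      by (intro sum.neutral) auto
    with 3 show ?thesis using split
      by (simp add: cop_tau_def cog_simps[unfolded One_nat_def] add_ac del: cog.simps)
  qed
qed

lemma mm2_zero [simp]: "mm2 0 p = 0" "mm2 p 0 = 0"
  by (simp_all add: mm2_def extend2_def)

lemma steenrod2_carrier [simp]: "x \<in> carrier steenrod2"
  by (simp add: steenrod2_simps)

lemma pr2_pow_zero: "pr2 x = 0 \<Longrightarrow> 0 < k \<Longrightarrow> pr2 (x [^]\<^bsub>steenrod2\<^esub> (k::nat)) = 0"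
proof -
  interpret ring steenrod2 by (rule steenrod2_ring)
  show "pr2 x = 0 \<Longrightarrow> 0 < k \<Longrightarrow> pr2 (x [^]\<^bsub>steenrod2\<^esub> (k::nat)) = 0"
    by (cases k) (simp_all add: pr2_mult)
qed

text \<open>In characteristic 3 the cube of xi_1 tensor 1 + 1 tensor xi_1 is the sum of the cubes,
  which vanishes.\<close>

lemma pr2_xi_cube: "3 \<le> k \<Longrightarrow> pr2 (psi_xi 1 [^]\<^bsub>steenrod2\<^esub> (k::nat)) = 0"
proof -
  assume k: "3 \<le> k"
  interpret ring steenrod2 by (rule steenrod2_ring)
  have "collect pair_key (lmul2 cop_xi (lmul2 cop_xi cop_xi)) = []"
    by code_simp
  then have "lc (lmul2 cop_xi (lmul2 cop_xi cop_xi)) = 0" by (rule lc_eq_0)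
  then have "pr2 (psi_xi 1 \<otimes>\<^bsub>steenrod2\<^esub> (psi_xi 1 \<otimes>\<^bsub>steenrod2\<^esub> psi_xi 1)) = 0"
    by (simp add: pr2_mult pr2_psi_xi_1 lc_lmul2 del: One_nat_def)
  moreover have "psi_xi 1 [^]\<^bsub>steenrod2\<^esub> (3::nat) = psi_xi 1 \<otimes>\<^bsub>steenrod2\<^esub> (psi_xi 1 \<otimes>\<^bsub>steenrod2\<^esub> psi_xi 1)"
    by (simp add: numeral_3_eq_3 m_assoc del: One_nat_def)
  moreover have "psi_xi 1 [^]\<^bsub>steenrod2\<^esub> k = psi_xi 1 [^]\<^bsub>steenrod2\<^esub> (3::nat) \<otimes>\<^bsub>steenrod2\<^esub> psi_xi 1 [^]\<^bsub>steenrod2\<^esub> (k - 3)"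
    using k by (simp add: nat_pow_mult del: One_nat_def)
  ultimately show ?thesis by (simp add: pr2_mult del: One_nat_def)
qed

lemma pr2_foldr: "pr2 (foldr (\<otimes>\<^bsub>steenrod2\<^esub>) xs z) = foldr mm2 (map pr2 xs) (pr2 z)"
  by (induction xs) (simp_all add: pr2_mult)

lemma foldr_mm2_zero: "0 \<in> set xs \<Longrightarrow> foldr mm2 xs z = 0"
  by (induction xs) auto

lemma pr2_unit: "pr2 \<one>\<^bsub>steenrod2\<^esub> = lc [(1, (gunit, gunit))]"
  by (simp add: steenrod2_simps pr2_def pr_unit)

text \<open>The coproduct descends to Gamma: a forbidden generator or power contributes a factor
  whose image is already 0.\<close>

lemma pr2_psi_not_small:
  assumes "\<not> small (e, S)"
  shows "pr2 (psi_mon (e, S)) = 0"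
proof -
  let ?xs = "map (\<lambda>n. psi_xi (n + 1) [^]\<^bsub>steenrod2\<^esub> Poly_Mapping.lookup e n)
    (sorted_list_of_set (Poly_Mapping.keys e)) @ map psi_tau (sorted_list_of_fset S)"
  have "0 \<in> set (map pr2 ?xs)"
  proof (cases "\<exists>y. y |\<in>| S \<and> \<not> y \<le> 2")
    case True
    then obtain y where y: "y |\<in>| S" "3 \<le> y" by auto
    then have "psi_tau y \<in> set ?xs" by simp
    then show ?thesis using pr2_psi_tau[OF y(2)] by force
  next
    case False
    then obtain n where n: "\<not> Poly_Mapping.lookup e n \<le> (if n = 0 then 2 else 0)"
      using assms by auto
    then have "n \<in> Poly_Mapping.keys e" by (auto simp: in_keys_iff split: if_splits)
    then have in_xs: "psi_xi (n + 1) [^]\<^bsub>steenrod2\<^esub> Poly_Mapping.lookup e n \<in> set ?xs" by simp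
    have "pr2 (psi_xi (n + 1) [^]\<^bsub>steenrod2\<^esub> Poly_Mapping.lookup e n) = 0"
    proof (cases "n = 0")
      case True
      then show ?thesis using n pr2_xi_cube[of "Poly_Mapping.lookup e n"] by simp
    next
      case False
      then show ?thesis using n by (intro pr2_pow_zero pr2_psi_xi) auto
    qed
    with in_xs show ?thesis by force
  qed
  then show ?thesis
    unfolding psi_mon.simps pr2_foldr by (rule foldr_mm2_zero)
qed

lemma lc_foldr_lmul2: "lc (foldr lmul2 xs z) = foldr mm2 (map lc xs) (lc z)"
  by (induction xs) (simp_all add: lc_lmul2)

lemma pr2_psi_small: "pr2 (psi_mon (iota g)) = lc (cop g)"
proof -
  interpret ring steenrod2 by (rule steenrod2_ring)
  obtain a x0 x1 x2 where g: "g = (a, x0, x1, x2)" by (cases g)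
  let ?l = "(if x0 then [0] else []) @ (if x1 then [1] else []) @ (if x2 then [2] else [])"
  have keys: "sorted_list_of_set (Poly_Mapping.keys (Poly_Mapping.single 0 n)) = (if n = 0 then [] else [0])"
    for n :: nat by simp
  have ext: "sorted_list_of_fset (gext x0 x1 x2) = ?l"
    by (cases x0; cases x1; cases x2) (simp_all add: sorted_list_of_fset.rep_eq)
  have pow: "foldr (\<otimes>\<^bsub>steenrod2\<^esub>) (map (\<lambda>n. psi_xi (n + 1) [^]\<^bsub>steenrod2\<^esub> Poly_Mapping.lookup (Poly_Mapping.single 0 (hnat a)) n)
      (if hnat a = 0 then [] else [0])) z = foldr (\<otimes>\<^bsub>steenrod2\<^esub>) (replicate (hnat a) (psi_xi 1)) z" for z
    by (cases a) (simp_all add: numeral_2_eq_2 m_assoc del: single_numeral)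
  show ?thesis
    unfolding g iota.simps psi_mon.simps keys ext foldr_append pow pr2_foldr pr2_unit
      cop.simps lc_collect lc_foldr_lmul2 map_append map_replicate map_map pr2_psi_xi_1
    by (auto simp: pr2_psi_tau_small split: if_splits)
qed

section \<open>Projection of words and its compatibility with the differentials\<close>

fun rw :: "smon list \<Rightarrow> gam list lin"
  where "rw w = (if \<forall>m\<in>set w. small m then basis (map cog w) else 0)"

declare rw.simps [simp del]

lemma rw_Nil [simp]: "rw [] = basis []"
  by (simp add: rw.simps)

lemma rw_Cons: "rw (m # w) = (if small m then conc (basis [cog m]) (rw w) else 0)"
  by (simp add: rw.simps)

lemma rw_append: "rw (v @ w) = conc (rw v) (rw w)"
  by (auto simp: rw.simps)

definition rho :: "smon list lin \<Rightarrow> gam list lin"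
  where "rho = extend rw"

lemma rho_simps [simp]:
  "rho 0 = 0" "rho (p + q) = rho p + rho q" "rho (p - q) = rho p - rho q" "rho (- p) = - rho p"
  "rho (scale c p) = scale c (rho p)" "rho (Poly_Mapping.single b c) = scale c (rw b)"
  by (simp_all add: rho_def extend_add extend_diff extend_scale)

lemma rho_conc: "rho (conc p q) = conc (rho p) (rho q)"
proof -
  have *: "rho (conc (basis v) q) = conc (rw v) (rho q)" for v
    using supp_UNIV[of q, unfolded supp_def mem_Collect_eq]
  proof (induction q rule: lin_induct)
    case (basis w)
    show ?case by (simp add: rw_append)
  qed (simp_all add: conc_add conc_scale)
  show ?thesis
    using supp_UNIV[of p, unfolded supp_def mem_Collect_eq]
  proof (induction p rule: lin_induct)
    case (basis v)
    show ?case using * by simp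
  qed (simp_all add: conc_add conc_scale)
qed

lemma small_unit: "small m \<Longrightarrow> cog m = gunit \<longleftrightarrow> m = unit_mon"
  by (metis iota_cog iota_eq_unit)

definition bar :: "gam \<times> gam \<Rightarrow> gam list lin"
  where "bar = (\<lambda>(a, b). if a = gunit \<or> b = gunit then 0 else Poly_Mapping.single [a, b] (gs a))"

lemma rho_d_letter_aux:
  "rho (extend (\<lambda>(a, b). if a = unit_mon \<or> b = unit_mon then 0
      else Poly_Mapping.single [a, b] ((-1) ^ sdeg a)) x) = extend bar (pr2 x)"
proof -
  have "rho (if a = unit_mon \<or> b = unit_mon then 0 else Poly_Mapping.single [a, b] ((-1) ^ sdeg a)) =
      extend bar (tens (pr a) (pr b))" for a b
  proof (cases "small a \<and> small b")
    case True
    then obtain a' b' where ab: "a = iota a'" "b = iota b'" by (metis iota_cog)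
    show ?thesis
      unfolding ab
      by (simp add: bar_def rw.simps sdeg_iota sign_gdeg del: iota.simps small.simps cog.simps)
  next
    case False
    then show ?thesis by (auto simp: pr_def rw.simps)
  qed
  then show ?thesis
    by (simp add: rho_def pr2_def extend_extend case_prod_beta)
qed

text \<open>Connects the table \<open>red\<close>, from which \<open>dl\<close> is built, with the
  coproduct computed multiplicatively from the generators.\<close>

lemma extend_bar_cop: "extend bar (lc (cop g)) = dl g"
proof -
  let ?P = "\<lambda>(c :: int, a, b). a \<noteq> gunit \<and> b \<noteq> gunit"
  have filter: "extend bar (lc xs) = extend bar (lc (filter ?P xs))" for xs
    by (induction xs) (auto simp: extend_add bar_def)
  have "lc (filter ?P (cop g) @ map (\<lambda>(c, x). (- c, x)) (red g)) = 0"
    by (rule lc_eq_0[OF collect_cop_red])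
  moreover have "lc (map (\<lambda>(c, x). (- c, x)) xs) = - lc xs" for xs :: "(int \<times> gam \<times> gam) list"
    by (induction xs) (auto simp: single_uminus)
  ultimately have "lc (filter ?P (cop g)) = lc (red g)" by (simp only: lc_append) simp
  moreover have "extend bar (lc (red g)) = dl g"
  proof -
    have "extend bar (lc xs) = lc (map (\<lambda>(c, a, b). (sg (gpar a) * c, [a, b])) xs)"
      if "list_all (\<lambda>(c, a, b). a \<noteq> gunit \<and> b \<noteq> gunit) xs" for xs :: "(int \<times> gam \<times> gam) list"
      using that
    proof (induction xs)
      case (Cons cab xs)
      obtain c a b where "cab = (c, a, b)" by (cases cab)
      with Cons show ?case by (simp add: extend_add bar_def gs_def mult.commute)
    qed simp
    moreover have "list_all (\<lambda>(c, a, b). a \<noteq> gunit \<and> b \<noteq> gunit) (red g)"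
      using red_props[of g] by (auto simp: list_all_iff)
    ultimately show ?thesis by (simp add: dl_def dlist_def)
  qed
  ultimately show ?thesis by (metis filter)
qed

lemma psi_basis: "psi (basis m) = psi_mon m"
  by (simp add: psi_def del: psi_mon.simps)

lemma rho_d_letter: "rho (d_letter m) = (if small m then dl (cog m) else 0)"
proof (cases "small m")
  case True
  then have "pr2 (psi (basis m)) = lc (cop (cog m))"
    using pr2_psi_small[of "cog m"] unfolding psi_basis by (simp only: iota_cog)
  then show ?thesis using True by (simp add: d_letter_def rho_d_letter_aux extend_bar_cop)
next
  case False
  then have "pr2 (psi (basis m)) = 0"
    unfolding psi_basis using pr2_psi_not_small[of "fst m" "snd m"] unfolding prod.collapse by blast
  then show ?thesis using False by (simp add: d_letter_def rho_d_letter_aux)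
qed

lemma steenrod_tensor_simps:
  "carrier steenrod_tensor = supp (lists (- {unit_mon}))" "mult steenrod_tensor = conc"
  "one steenrod_tensor = basis []" "zero steenrod_tensor = 0" "add steenrod_tensor = (+)"
  by (simp_all add: steenrod_tensor_def basis_algebra_simps conc_def supp_def)

lemma rho_d_word: "rho (d_word w) = dT (rw w)"
proof (induction w)
  case (Cons m w)
  show ?case
  proof (cases "small m")
    case True
    then have "(- 1 :: F3) ^ (sdeg m + 1) = - gs (cog m)"
      using sdeg_iota[of "cog m"] sign_gdeg[of "cog m"] by (simp add: iota_cog)
    then show ?thesis
      using True Cons
      by (simp add: steenrod_tensor_simps rho_conc rho_d_letter rw_Cons dT_letter)
  next
    case False
    then show ?thesis
      by (simp add: steenrod_tensor_simps rho_conc rho_d_letter rw_Cons)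
  qed
qed simp

lemma rho_d: "rho (d_steenrod p) = dT (rho p)"
proof -
  have "rho (d_steenrod p) = extend (\<lambda>w. rho (d_word w)) p"
    by (simp add: rho_def d_steenrod_def extend_extend)
  also have "\<dots> = dT (rho p)"
    by (simp add: rho_d_word) (simp add: rho_def dT_def extend_extend)
  finally show ?thesis .
qed

lemma d_steenrod_simps [simp]:
  "d_steenrod (p + q) = d_steenrod p + d_steenrod q" "d_steenrod (p - q) = d_steenrod p - d_steenrod q"
  by (simp_all add: d_steenrod_def extend_add extend_diff)

abbreviation swords :: "smon list set"
  where "swords \<equiv> lists (- {unit_mon})"

lemma conc_supp:
  assumes "p \<in> supp (lists A)" "q \<in> supp (lists A)"
  shows "conc p q \<in> supp (lists A)"
  unfolding conc_def extend2_def
  by (rule supp_extend[OF assms(1)], rule supp_extend[OF assms(2)]) auto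

lemma d_steenrod_supp:
  assumes "p \<in> supp swords"
  shows "d_steenrod p \<in> supp swords"
proof -
  have "d_letter m \<in> supp swords" for m
    unfolding d_letter_def by (rule supp_extend[of _ UNIV]) auto
  note d_letter = this
  have "d_word w \<in> supp swords" if "w \<in> swords" for w
    using that
  proof (induction w rule: list.induct)
    case (Cons m w)
    then have "m \<noteq> unit_mon" "w \<in> swords" by auto
    then have "conc (d_letter m) (basis w) \<in> supp swords" "conc (basis [m]) (d_word w) \<in> supp swords"
      using Cons.IH by (auto intro!: conc_supp[OF d_letter] conc_supp[OF supp_closed(6)] supp_closed(6))
    then show ?case by (simp only: d_word.simps steenrod_tensor_simps supp_closed)
  qed simp
  then show ?thesis unfolding d_steenrod_def using assms by (blast intro: supp_extend)
qed

lemma rw_supp: "w \<in> swords \<Longrightarrow> rw w \<in> supp LT"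
proof (cases "\<forall>m\<in>set w. small m")
  case True
  assume "w \<in> swords"
  then have ne: "cog m \<noteq> gunit" if "m \<in> set w" for m
    using that small_unit True by blast
  have "map cog w \<in> LT"
    unfolding LT_def in_lists_conv_set
  proof
    fix g assume "g \<in> set (map cog w)"
    then obtain m where m: "m \<in> set w" "g = cog m" unfolding set_map by (rule imageE)
    from ne[OF m(1)] show "g \<in> - {gunit}"
      unfolding m(2) by (simp only: Compl_iff singleton_iff not_False_eq_True)
  qed
  then show ?thesis using True by (simp add: rw.simps del: small.simps cog.simps)
next
  case False
  then show ?thesis by (auto simp: rw.simps)
qed

lemma rho_supp: "p \<in> supp swords \<Longrightarrow> rho p \<in> supp LT"
  unfolding rho_def by (rule supp_extend) (auto intro: rw_supp)

definition sec :: "gam list lin \<Rightarrow> smon list lin"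
  where "sec = extend (\<lambda>w. basis (map iota w))"

lemma rho_sec [simp]: "rho (sec p) = p"
proof -
  have "rw (map iota w) = basis w" for w
    by (simp add: rw.simps comp_def del: iota.simps small.simps cog.simps)
  then show ?thesis by (simp add: rho_def sec_def extend_extend)
qed

lemma sec_supp: "p \<in> supp LT \<Longrightarrow> sec p \<in> supp swords"
  unfolding sec_def
proof (erule supp_extend)
  fix w assume "w \<in> LT"
  then have w: "\<forall>g\<in>set w. g \<in> - {gunit}" unfolding LT_def in_lists_conv_set .
  have "map iota w \<in> swords"
    unfolding in_lists_conv_set
  proof
    fix m assume "m \<in> set (map iota w)"
    then obtain g where g: "g \<in> set w" "m = iota g" unfolding set_map by (rule imageE)
    from bspec[OF w g(1)] have "g \<noteq> gunit" by (simp only: Compl_iff singleton_iff not_False_eq_True)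
    then have "m \<noteq> unit_mon" unfolding g(2) iota_eq_unit .
    then show "m \<in> - {unit_mon}" by (simp only: Compl_iff singleton_iff not_False_eq_True)
  qed
  then show "basis (map iota w) \<in> supp swords" by (rule supp_closed(6))
qed

section \<open>The ideal of Gamma as a span of monomials\<close>

lemma steenrod_ideal_closed:
  assumes "ideal I steenrod"
  shows "0 \<in> I" "p \<in> I \<Longrightarrow> q \<in> I \<Longrightarrow> p + q \<in> I" "p \<in> I \<Longrightarrow> - p \<in> I" "p \<in> I \<Longrightarrow> q \<in> I \<Longrightarrow> p - q \<in> I"
    "p \<in> I \<Longrightarrow> x \<otimes>\<^bsub>steenrod\<^esub> p \<in> I" "p \<in> I \<Longrightarrow> p \<otimes>\<^bsub>steenrod\<^esub> x \<in> I"
    "(\<And>a. a \<in> A \<Longrightarrow> f a \<in> I) \<Longrightarrow> sum f A \<in> I"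
proof -
  interpret ideal I steenrod by fact
  show 0: "0 \<in> I"
    using additive_subgroup.zero_closed[OF is_additive_subgroup] by (simp add: steenrod_simps)
  show add: "p \<in> I \<Longrightarrow> q \<in> I \<Longrightarrow> p + q \<in> I" for p q
    using additive_subgroup.a_closed[OF is_additive_subgroup] by (simp add: steenrod_simps)
  show neg: "p \<in> I \<Longrightarrow> - p \<in> I" for p
    using additive_subgroup.a_inv_closed[OF is_additive_subgroup, of p]
      basis_algebra_a_inv[OF poly_ext_ring[unfolded poly_ext_def], of p]
    by (simp add: steenrod_def poly_ext_def)
  show "p \<in> I \<Longrightarrow> q \<in> I \<Longrightarrow> p - q \<in> I"
    using add[of p "- q"] neg[of q] by simp
  show "p \<in> I \<Longrightarrow> x \<otimes>\<^bsub>steenrod\<^esub> p \<in> I" "p \<in> I \<Longrightarrow> p \<otimes>\<^bsub>steenrod\<^esub> x \<in> I"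
    using I_l_closed[of p x] I_r_closed[of p x] by (simp_all add: steenrod_simps)
  show "(\<And>a. a \<in> A \<Longrightarrow> f a \<in> I) \<Longrightarrow> sum f A \<in> I"
    by (induction A rule: infinite_finite_induct) (auto simp: 0 add)
qed

lemma not_small_ideal: "ideal (supp {m. \<not> small m}) steenrod"
  unfolding steenrod_def poly_ext_def
proof (rule basis_algebra_idealI[OF poly_ext_ring[unfolded poly_ext_def]])
  have mult: "mon_mult a b \<in> supp {m. \<not> small m}" if "\<not> small a \<or> \<not> small b" for a b
  proof -
    obtain e S f T where ab: "a = (e, S)" "b = (f, T)" by (metis prod.exhaust)
    have "\<not> small (e + f, S |\<union>| T)" using small_factor[of e f S T] that unfolding ab by blast
    then show ?thesis by (simp add: ab del: small.simps)
  qed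
  fix p x :: "smon lin" assume p: "p \<in> supp {m. \<not> small m}"
  show "extend2 mon_mult x p \<in> supp {m. \<not> small m}"
    unfolding extend2_def
    by (rule supp_extend[OF supp_UNIV], rule supp_extend[OF p]) (rule mult, simp)
  show "extend2 mon_mult p x \<in> supp {m. \<not> small m}"
    unfolding extend2_def
    by (rule supp_extend[OF p], rule supp_extend[OF supp_UNIV]) (rule mult, simp)
qed auto

lemma zeta_0: "zeta 0 = basis unit_mon"
  by (simp add: zeta.simps steenrod_simps)

lemma steenrod_mult_unit: "x \<otimes>\<^bsub>steenrod\<^esub> basis unit_mon = x" "basis unit_mon \<otimes>\<^bsub>steenrod\<^esub> x = x"
proof -
  interpret ring steenrod by (rule steenrod_ring)
  show "x \<otimes>\<^bsub>steenrod\<^esub> basis unit_mon = x" "basis unit_mon \<otimes>\<^bsub>steenrod\<^esub> x = x"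
    using r_one[of x] l_one[of x] by (simp_all add: steenrod_simps)
qed

lemma not_small_xi_pow: "0 < i \<Longrightarrow> i < n \<Longrightarrow> xi (n - i) [^]\<^bsub>steenrod\<^esub> ((3::nat) ^ i) \<in> supp {m. \<not> small m}"
proof -
  assume i: "0 < i" "i < n"
  then obtain k where k: "n - i = Suc k" by (metis Suc_diff_Suc)
  show ?thesis
    unfolding k xi_pow using three_le_pow[OF i(1)]
    by (intro supp_closed(6)) (simp add: small_single del: small.simps)
qed

lemma sum_split_first: "0 < n \<Longrightarrow> (\<Sum>i<n. f i) = f 0 + (\<Sum>i\<in>{0<..<n}. f i)" for f :: "nat \<Rightarrow> 'a::comm_monoid_add"
proof -
  assume "0 < n"
  then have "{..<n} = insert 0 {0<..<n}" by auto
  then show ?thesis by simp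
qed

lemma xi_pow_1: "xi (Suc n) [^]\<^bsub>steenrod\<^esub> ((3::nat) ^ 0) = xi (Suc n)"
  unfolding power_0 by (rule trans[OF xi_pow xi_1[symmetric]])

text \<open>The term for i = 0 is xi_n itself. So zeta_n and -xi_n differ by multiples of powers
  xi_(n-i)^(3^i), which lie in the ideal.\<close>

lemma zeta_rec:
  assumes "0 < n"
  shows "zeta n = - (xi n + (\<Sum>i\<in>{0<..<n}. (xi (n - i) [^]\<^bsub>steenrod\<^esub> ((3::nat) ^ i)) \<otimes>\<^bsub>steenrod\<^esub> zeta i))"
proof -
  obtain k where k: "n = Suc k" using assms by (cases n) auto
  have "zeta n = - (\<Sum>i<n. (xi (n - i) [^]\<^bsub>steenrod\<^esub> ((3::nat) ^ i)) \<otimes>\<^bsub>steenrod\<^esub> zeta i)"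
    using assms by (subst zeta.simps) simp
  then show ?thesis
    unfolding sum_split_first[OF assms] zeta_0 steenrod_mult_unit diff_zero by (simp only: k xi_pow_1)
qed

lemma zeta_1_cube: "zeta 1 [^]\<^bsub>steenrod\<^esub> (3::nat) = - basis (Poly_Mapping.single 0 3, {||})"
proof -
  interpret ring steenrod by (rule steenrod_ring)
  have z: "zeta 1 = - basis (Poly_Mapping.single 0 1, {||})"
  proof -
    have "{0<..<Suc 0} = {}" by auto
    then show ?thesis using zeta_rec[of 1] xi_1[of 0] by simp
  qed
  have s: "Poly_Mapping.single 0 (Suc 0) + (Poly_Mapping.single 0 (Suc 0) + Poly_Mapping.single 0 (Suc 0)) =
      Poly_Mapping.single (0::nat) (Suc (Suc (Suc 0)))"
    by (simp flip: single_add)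
  show ?thesis
    unfolding z numeral_3_eq_3 nat_pow_Suc nat_pow_0
    by (simp add: steenrod_simps extend2_def extend_fun_minus s add.assoc del: single_one)
qed

lemma taubar_rec:
  assumes "0 < n"
  shows "taubar n = - tau n - (xi n \<otimes>\<^bsub>steenrod\<^esub> taubar 0 +
    (\<Sum>i\<in>{0<..<n}. (xi (n - i) [^]\<^bsub>steenrod\<^esub> ((3::nat) ^ i)) \<otimes>\<^bsub>steenrod\<^esub> taubar i))"
proof -
  obtain k where k: "n = Suc k" using assms by (cases n) auto
  show ?thesis
    by (subst taubar.simps) (unfold sum_split_first[OF assms] diff_zero, simp only: k xi_pow_1)
qed

lemma xi_not_small: "2 \<le> n \<Longrightarrow> xi n \<in> supp {m. \<not> small m}"
  by (cases n) (auto simp: xi_1 small_single simp del: small.simps)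

lemma Gamma_ideal_not_small: "p \<in> Gamma_ideal \<Longrightarrow> p \<in> supp {m. \<not> small m}"
proof -
  note closed = steenrod_ideal_closed[OF not_small_ideal]
  have "zeta 1 [^]\<^bsub>steenrod\<^esub> (3::nat) \<in> supp {m. \<not> small m}"
    unfolding zeta_1_cube
    by (intro supp_closed) (simp add: small_single del: small.simps single_numeral)
  moreover have "zeta n \<in> supp {m. \<not> small m}" if "2 \<le> n" for n
    unfolding zeta_rec[of n, OF order.strict_trans2[OF zero_less_numeral that]]
    by (intro closed(3) closed(2) closed(7) closed(6) xi_not_small that not_small_xi_pow) auto
  moreover have "taubar m \<in> supp {m. \<not> small m}" if "3 \<le> m" for m
  proof -
    have "tau m \<in> supp {m. \<not> small m}"
      unfolding tau_def ext_gen_def using that by (intro supp_closed(6)) auto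
    then show ?thesis
      unfolding taubar_rec[of m, OF order.strict_trans2[OF zero_less_numeral that]] using that
      by (intro closed(3) closed(4) closed(2) closed(7) closed(6) xi_not_small not_small_xi_pow) auto
  qed
  ultimately have "Gamma_ideal \<subseteq> supp {m. \<not> small m}"
    unfolding Gamma_ideal_def
    by (intro ring.genideal_minimal[OF steenrod_ring not_small_ideal]) auto
  then show "p \<in> Gamma_ideal \<Longrightarrow> p \<in> supp {m. \<not> small m}" by blast
qed

lemma Gamma_ideal: "ideal Gamma_ideal steenrod"
  unfolding Gamma_ideal_def
  by (rule ring.genideal_ideal[OF steenrod_ring]) (simp add: steenrod_simps)

lemma Gamma_ideal_gens:
  "zeta 1 [^]\<^bsub>steenrod\<^esub> (3::nat) \<in> Gamma_ideal" "2 \<le> n \<Longrightarrow> zeta n \<in> Gamma_ideal"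
  "3 \<le> m \<Longrightarrow> taubar m \<in> Gamma_ideal"
proof -
  have *: "S \<subseteq> Gamma_ideal" if "S \<subseteq> {zeta 1 [^]\<^bsub>steenrod\<^esub> (3::nat)} \<union> {zeta n |n. n \<ge> 2} \<union> {taubar m |m. m \<ge> 3}" for S
    using that ring.genideal_self[OF steenrod_ring, of "{zeta 1 [^]\<^bsub>steenrod\<^esub> (3::nat)} \<union> {zeta n |n. n \<ge> 2} \<union> {taubar m |m. m \<ge> 3}"]
    unfolding Gamma_ideal_def by (auto simp: steenrod_simps)
  show "zeta 1 [^]\<^bsub>steenrod\<^esub> (3::nat) \<in> Gamma_ideal" using *[of "{zeta 1 [^]\<^bsub>steenrod\<^esub> (3::nat)}"] by auto
  show "2 \<le> n \<Longrightarrow> zeta n \<in> Gamma_ideal" using *[of "{zeta n}"] by auto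
  show "3 \<le> m \<Longrightarrow> taubar m \<in> Gamma_ideal" using *[of "{taubar m}"] by auto
qed

lemma mon_factor:
  "basis (Poly_Mapping.single n k, {||}) \<otimes>\<^bsub>steenrod\<^esub> basis (e, S) = basis (Poly_Mapping.single n k + e, S)"
  by (simp add: steenrod_simps extend2_def)

lemma xi_cube_in_Gamma_ideal: "3 \<le> k \<Longrightarrow> basis (Poly_Mapping.single 0 k, {||}) \<in> Gamma_ideal"
proof -
  assume k: "3 \<le> k"
  note closed = steenrod_ideal_closed[OF Gamma_ideal]
  have "basis (Poly_Mapping.single 0 3, {||}) \<in> Gamma_ideal"
    using closed(3)[OF Gamma_ideal_gens(1)] unfolding zeta_1_cube by simp
  from closed(6)[OF this, of "basis (Poly_Mapping.single 0 (k - 3), {||})"] show ?thesis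
    unfolding mon_factor using k by (simp flip: single_add del: single_numeral)
qed

text \<open>A power of xi_1 occurring here has exponent at least 3; any other base has index between
  2 and n - 1, where the induction hypothesis applies.\<close>

lemma xi_pow_in_Gamma_ideal:
  assumes "\<And>j. 2 \<le> j \<Longrightarrow> j < n \<Longrightarrow> xi j \<in> Gamma_ideal" "0 < i" "i < n"
  shows "xi (n - i) [^]\<^bsub>steenrod\<^esub> ((3::nat) ^ i) \<in> Gamma_ideal"
proof -
  note closed = steenrod_ideal_closed[OF Gamma_ideal]
  obtain k where k: "n - i = Suc k" using assms by (metis Suc_diff_Suc)
  have pow: "3 \<le> (3::nat) ^ i" using three_le_pow assms(2) by simp
  show ?thesis
  proof (cases k)
    case 0
    then show ?thesis unfolding k xi_pow using xi_cube_in_Gamma_ideal[OF pow] by simp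
  next
    case (Suc k')
    then have "xi (Suc k) \<in> Gamma_ideal" using assms(1)[of "Suc k"] assms k by auto
    from closed(6)[OF this, of "basis (Poly_Mapping.single k (3 ^ i - 1), {||})"]
    have "basis (Poly_Mapping.single k (1 + (3 ^ i - 1)), {||}) \<in> Gamma_ideal"
      unfolding xi_1 mon_factor single_add .
    moreover have "1 + (3 ^ i - 1) = (3::nat) ^ i" using pow by simp
    ultimately show ?thesis unfolding k xi_pow by simp
  qed
qed

lemma xi_in_Gamma_ideal: "2 \<le> n \<Longrightarrow> xi n \<in> Gamma_ideal"
proof (induction n rule: less_induct)
  case (less n)
  note closed = steenrod_ideal_closed[OF Gamma_ideal]
  let ?r = "\<Sum>i\<in>{0<..<n}. (xi (n - i) [^]\<^bsub>steenrod\<^esub> ((3::nat) ^ i)) \<otimes>\<^bsub>steenrod\<^esub> zeta i"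
  have r: "?r \<in> Gamma_ideal"
    by (intro closed(7) closed(6) xi_pow_in_Gamma_ideal) (use less in auto)
  have "zeta n = - (xi n + ?r)" using less.prems by (intro zeta_rec) simp
  then have eq: "xi n = - zeta n - ?r" by (simp only:) simp
  show ?case
    by (subst eq) (rule closed(4)[OF closed(3)[OF Gamma_ideal_gens(2)[OF less.prems]] r])
qed

lemma tau_in_Gamma_ideal: "3 \<le> n \<Longrightarrow> tau n \<in> Gamma_ideal"
proof -
  assume n: "3 \<le> n"
  note closed = steenrod_ideal_closed[OF Gamma_ideal]
  let ?r = "xi n \<otimes>\<^bsub>steenrod\<^esub> taubar 0 + (\<Sum>i\<in>{0<..<n}. (xi (n - i) [^]\<^bsub>steenrod\<^esub> ((3::nat) ^ i)) \<otimes>\<^bsub>steenrod\<^esub> taubar i)"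
  have r: "?r \<in> Gamma_ideal"
    by (intro closed(2) closed(7) closed(6) xi_pow_in_Gamma_ideal xi_in_Gamma_ideal) (use n in auto)
  have "taubar n = - tau n - ?r" using n by (intro taubar_rec) simp
  then have eq: "tau n = - taubar n - ?r" by (simp only:) simp
  show ?thesis
    by (subst eq) (rule closed(4)[OF closed(3)[OF Gamma_ideal_gens(3)[OF n]] r])
qed

text \<open>A forbidden tau_y or power of xi_n is split off as a left factor, at the cost of a sign
  in the case of tau_y.\<close>

lemma not_small_in_Gamma_ideal:
  assumes "\<not> small m"
  shows "basis m \<in> Gamma_ideal"
proof -
  note closed = steenrod_ideal_closed[OF Gamma_ideal]
  obtain e S where m: "m = (e, S)" by (cases m)
  show ?thesis
  proof (cases "\<exists>y. y |\<in>| S \<and> \<not> y \<le> 2")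
    case True
    then obtain y where y: "y |\<in>| S" "3 \<le> y" by auto
    define S' where "S' = S |-| {|y|}"
    have S: "S = {|y|} |\<union>| S'" "{|y|} |\<inter>| S' = {||}" using y by (auto simp: S'_def)
    have "basis (0, {|y|}) \<otimes>\<^bsub>steenrod\<^esub> Poly_Mapping.single (e, S') ((-1) ^ crossings {|y|} S') \<in> Gamma_ideal"
      using closed(6)[OF tau_in_Gamma_ideal[OF y(2)]] by (simp add: tau_def ext_gen_def)
    moreover have "(- 1 :: F3) ^ n * (- 1) ^ n = 1" for n
      by (simp flip: power_mult_distrib)
    moreover have "S = finsert y S'" using S(1) by simp
    ultimately show ?thesis
      by (simp add: m steenrod_simps extend2_def S(2))
  next
    case False
    then obtain n where n: "\<not> Poly_Mapping.lookup e n \<le> (if n = 0 then 2 else 0)"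
      using assms by (auto simp: m)
    define k where "k = Poly_Mapping.lookup e n"
    define e' where "e' = e - Poly_Mapping.single n k"
    have e: "e = Poly_Mapping.single n k + e'"
      by (rule poly_mapping_eqI) (auto simp: e'_def k_def lookup_add lookup_minus lookup_single when_def)
    have "basis (Poly_Mapping.single n k, {||}) \<in> Gamma_ideal"
    proof (cases "n = 0")
      case True
      then show ?thesis using n xi_cube_in_Gamma_ideal by (simp add: k_def)
    next
      case False
      then have "xi (Suc n) \<in> Gamma_ideal" by (intro xi_in_Gamma_ideal) simp
      from closed(6)[OF this, of "basis (Poly_Mapping.single n (k - 1), {||})"]
      have "basis (Poly_Mapping.single n (1 + (k - 1)), {||}) \<in> Gamma_ideal"
        unfolding xi_1 mon_factor single_add .
      then show ?thesis using n False by (simp add: k_def)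
    qed
    from closed(6)[OF this, of "basis (e', S)"] show ?thesis
      unfolding mon_factor m by (simp flip: e)
  qed
qed

section \<open>The ideal of the tensor algebra as a kernel\<close>

lemma Gamma_tensor_ideal: "ideal Gamma_tensor_ideal steenrod_tensor"
  and letter_in_ideal: "p \<in> Gamma_ideal \<Longrightarrow> letter p \<in> Gamma_tensor_ideal"
proof -
  have "letter p \<in> supp swords" for p
    unfolding letter_def by (rule supp_extend[of p UNIV]) auto
  then have sub: "letter ` Gamma_ideal \<subseteq> carrier steenrod_tensor"
    by (auto simp: steenrod_tensor_simps)
  show "ideal Gamma_tensor_ideal steenrod_tensor"
    unfolding Gamma_tensor_ideal_def by (rule ring.genideal_ideal[OF steenrod_tensor_ring sub])
  show "p \<in> Gamma_ideal \<Longrightarrow> letter p \<in> Gamma_tensor_ideal"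
    unfolding Gamma_tensor_ideal_def using ring.genideal_self[OF steenrod_tensor_ring sub] by blast
qed

lemma Gamma_tensor_ideal_subset: "Gamma_tensor_ideal \<subseteq> {p \<in> supp swords. rho p = 0}"
  unfolding Gamma_tensor_ideal_def
proof (rule ring.genideal_minimal[OF steenrod_tensor_ring])
  show "ideal {p \<in> supp swords. rho p = 0} steenrod_tensor"
    unfolding steenrod_tensor_def
  proof (rule basis_algebra_idealI[OF steenrod_tensor_ring[unfolded steenrod_tensor_def]], goal_cases)
    case (5 p x)
    then have "x \<in> supp swords" unfolding supp_def by blast
    with 5 show ?case by (simp add: rho_conc conc_supp flip: conc_def)
  next
    case (6 p x)
    then have "x \<in> supp swords" unfolding supp_def by blast
    with 6 show ?case by (simp add: rho_conc conc_supp flip: conc_def)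
  qed (simp_all, simp add: supp_def)
  show "letter ` Gamma_ideal \<subseteq> {p \<in> supp swords. rho p = 0}"
  proof (intro subsetI CollectI)
    fix q assume "q \<in> letter ` Gamma_ideal"
    then obtain p where p: "p \<in> Gamma_ideal" "q = letter p" by blast
    have "rho (letter p) = extend (\<lambda>m. rho (if m = unit_mon then 0 else basis [m])) p"
      by (simp add: rho_def letter_def extend_extend)
    also have "\<dots> = extend (\<lambda>m. 0) p"
      by (rule extend_cong_supp[OF Gamma_ideal_not_small[OF p(1)]]) (simp add: rw.simps del: small.simps)
    finally have "rho q = 0" by (simp add: p(2))
    moreover have "q \<in> supp swords"
      unfolding p(2) letter_def by (rule supp_extend[of p UNIV]) auto
    ultimately show "q \<in> supp swords \<and> rho q = 0" by simp
  qed
qed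

text \<open>A word containing a forbidden letter lies in the two-sided ideal, and \<open>sec\<close>
  after \<open>rho\<close> fixes all other words. Hence p and \<open>sec (rho p)\<close> agree
  modulo the ideal.\<close>

lemma Gamma_tensor_ideal_eq: "Gamma_tensor_ideal = {p \<in> supp swords. rho p = 0}"
proof
  show "Gamma_tensor_ideal \<subseteq> {p \<in> supp swords. rho p = 0}" by (rule Gamma_tensor_ideal_subset)
next
  interpret ideal Gamma_tensor_ideal steenrod_tensor by (rule Gamma_tensor_ideal)
  have closed: "0 \<in> Gamma_tensor_ideal"
    "p \<in> Gamma_tensor_ideal \<Longrightarrow> q \<in> Gamma_tensor_ideal \<Longrightarrow> p + q \<in> Gamma_tensor_ideal" for p q
    using additive_subgroup.zero_closed[OF is_additive_subgroup]
      additive_subgroup.a_closed[OF is_additive_subgroup] by (simp_all add: steenrod_tensor_simps)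
  have neg: "p \<in> Gamma_tensor_ideal \<Longrightarrow> - p \<in> Gamma_tensor_ideal" for p
    using additive_subgroup.a_inv_closed[OF is_additive_subgroup, of p] Gamma_tensor_ideal_subset
      basis_algebra_a_inv[OF steenrod_tensor_ring[unfolded steenrod_tensor_def], of p]
    by (auto simp: steenrod_tensor_def supp_def)
  have word: "basis w - sec (rw w) \<in> Gamma_tensor_ideal" if w: "w \<in> swords" for w
  proof (cases "\<forall>m\<in>set w. small m")
    case True
    then have "map iota (map cog w) = w" by (simp add: map_idI iota_cog del: iota.simps small.simps cog.simps)
    then show ?thesis using True closed(1) by (simp add: rw.simps sec_def del: iota.simps small.simps cog.simps)
  next
    case False
    then obtain m where m: "m \<in> set w" "\<not> small m" by blast
    then obtain u v where uv: "w = u @ m # v" by (metis split_list)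
    have mem: "u \<in> swords" "v \<in> swords" "m \<noteq> unit_mon" using w by (auto simp: uv)
    have "letter (basis m) \<in> Gamma_tensor_ideal"
      by (rule letter_in_ideal[OF not_small_in_Gamma_ideal[OF m(2)]])
    then have "basis [m] \<in> Gamma_tensor_ideal" using mem(3) by (simp add: letter_def)
    then have "conc (basis u) (conc (basis [m]) (basis v)) \<in> Gamma_tensor_ideal"
      using I_l_closed[of _ "basis u"] I_r_closed[of _ "basis v"] mem
      by (simp add: steenrod_tensor_simps del: conc_basis)
    moreover have "rw w = 0" using m by (auto simp: rw.simps)
    ultimately show ?thesis by (simp add: uv sec_def)
  qed
  show "{p \<in> supp swords. rho p = 0} \<subseteq> Gamma_tensor_ideal"
  proof
    fix p assume p: "p \<in> {p \<in> supp swords. rho p = 0}"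
    have "p - sec (rho p) = extend (\<lambda>w. basis w - sec (rw w)) p"
      by (simp add: extend_fun_diff sec_def rho_def extend_extend)
    also have "\<dots> \<in> Gamma_tensor_ideal"
    proof (rule extend_eq_induct[OF refl])
      fix c q assume "q \<in> Gamma_tensor_ideal"
      then show "scale c q \<in> Gamma_tensor_ideal"
        using F3_cases[of c] neg closed(1) by (elim disjE) simp_all
    next
      fix w assume "w \<in> Poly_Mapping.keys p"
      then have "w \<in> swords" using p unfolding supp_def by blast
      then show "basis w - sec (rw w) \<in> Gamma_tensor_ideal" by (rule word)
    qed (use closed in auto)
    finally show "p \<in> Gamma_tensor_ideal" using p by (simp add: sec_def)
  qed
qed

section \<open>The isomorphism\<close>

abbreviation cls :: "smon list lin \<Rightarrow> smon list lin set"
  where "cls x \<equiv> Gamma_tensor_ideal +>\<^bsub>steenrod_tensor\<^esub> x"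

abbreviation pcls :: "pmon lin \<Rightarrow> pmon lin set"
  where "pcls p \<equiv> rel_ideal +>\<^bsub>free_presentation\<^esub> p"

lemma cls_eq: "x \<in> supp swords \<Longrightarrow> y \<in> supp swords \<Longrightarrow> cls x = cls y \<longleftrightarrow> rho x = rho y"
  using basis_algebra_coset_eq[OF Gamma_tensor_ideal[unfolded steenrod_tensor_def], of x y]
  unfolding steenrod_tensor_def[symmetric] by (auto simp: Gamma_tensor_ideal_eq supp_def)
    (use supp_closed(3)[of x swords y] in \<open>auto simp: supp_def\<close>)

lemma cls_mem: "x \<in> supp swords \<Longrightarrow> y \<in> cls x \<longleftrightarrow> y \<in> supp swords \<and> rho y = rho x"
proof -
  assume x: "x \<in> supp swords"
  have "y \<in> cls x \<longleftrightarrow> (\<exists>i\<in>Gamma_tensor_ideal. y = i + x)"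
    by (simp add: a_r_coset_def' steenrod_tensor_simps)
  also have "\<dots> \<longleftrightarrow> y \<in> supp swords \<and> rho y = rho x"
  proof
    assume "y \<in> supp swords \<and> rho y = rho x"
    then have "y - x \<in> Gamma_tensor_ideal" using x by (simp add: Gamma_tensor_ideal_eq)
    then show "\<exists>i\<in>Gamma_tensor_ideal. y = i + x" by (intro bexI[of _ "y - x"]) simp
  qed (use x in \<open>auto simp: Gamma_tensor_ideal_eq\<close>)
  finally show ?thesis .
qed

lemma pcls_eq: "pcls p = pcls q \<longleftrightarrow> p - q \<in> rel_ideal"
  using basis_algebra_coset_eq[of rel_ideal UNIV mon_mult unit_mon p q] rel_ideal
  by (simp add: free_presentation_def poly_ext_def)

lemma cobar_ring: "ring cobar_Gamma"
  unfolding cobar_Gamma_def by (rule ideal.quotient_is_ring[OF Gamma_tensor_ideal])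

lemma presentation_ring: "ring presentation"
  unfolding presentation_def using ideal.quotient_is_ring[OF rel_ideal] by (simp add: rel_ideal_def)

lemma cobar_carrier: "carrier cobar_Gamma = cls ` supp swords"
  by (auto simp: cobar_Gamma_def FactRing_def A_RCOSETS_def' steenrod_tensor_simps)

lemma cobar_ops:
  assumes "x \<in> supp swords" "y \<in> supp swords"
  shows "cls x \<otimes>\<^bsub>cobar_Gamma\<^esub> cls y = cls (conc x y)" "cls x \<oplus>\<^bsub>cobar_Gamma\<^esub> cls y = cls (x + y)"
    "\<one>\<^bsub>cobar_Gamma\<^esub> = cls (basis [])" "\<zero>\<^bsub>cobar_Gamma\<^esub> = cls 0"
proof -
  have hom: "cls \<in> ring_hom steenrod_tensor cobar_Gamma"
    unfolding cobar_Gamma_def by (rule ideal.rcos_ring_hom[OF Gamma_tensor_ideal])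
  show "cls x \<otimes>\<^bsub>cobar_Gamma\<^esub> cls y = cls (conc x y)" "cls x \<oplus>\<^bsub>cobar_Gamma\<^esub> cls y = cls (x + y)"
    "\<one>\<^bsub>cobar_Gamma\<^esub> = cls (basis [])"
    using ring_hom_mult[OF hom, of x y] ring_hom_add[OF hom, of x y] ring_hom_one[OF hom] assms
    by (simp_all add: steenrod_tensor_simps)
  show "\<zero>\<^bsub>cobar_Gamma\<^esub> = cls 0"
    using ring_hom_zero[OF hom steenrod_tensor_ring cobar_ring] by (simp add: steenrod_tensor_simps)
qed

lemma presentation_ops:
  "pcls p \<otimes>\<^bsub>presentation\<^esub> pcls q = pcls (extend2 mon_mult p q)"
  "pcls p \<oplus>\<^bsub>presentation\<^esub> pcls q = pcls (p + q)"
  "\<one>\<^bsub>presentation\<^esub> = pcls (basis unit_mon)" "\<zero>\<^bsub>presentation\<^esub> = pcls 0"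
  "carrier presentation = range pcls"
proof -
  have hom: "pcls \<in> ring_hom free_presentation presentation"
    unfolding presentation_def rel_ideal_def[symmetric] by (rule ideal.rcos_ring_hom[OF rel_ideal])
  show "pcls p \<otimes>\<^bsub>presentation\<^esub> pcls q = pcls (extend2 mon_mult p q)"
    "pcls p \<oplus>\<^bsub>presentation\<^esub> pcls q = pcls (p + q)"
    "\<one>\<^bsub>presentation\<^esub> = pcls (basis unit_mon)"
    using ring_hom_mult[OF hom, of p q] ring_hom_add[OF hom, of p q] ring_hom_one[OF hom]
    by (simp_all add: free_presentation_simps)
  show "\<zero>\<^bsub>presentation\<^esub> = pcls 0"
    using ring_hom_zero[OF hom free_presentation_ring presentation_ring] by (simp add: free_presentation_simps)
  show "carrier presentation = range pcls"
    unfolding presentation_def rel_ideal_def[symmetric]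
    by (auto simp: FactRing_def A_RCOSETS_def' free_presentation_simps)
qed

lemma d_Gamma_cls:
  assumes "x \<in> supp swords"
  shows "d_Gamma (cls x) = cls (d_steenrod x)"
proof -
  have "cls (d_steenrod y) = cls (d_steenrod x)" if "y \<in> cls x" for y
    using that assms by (simp add: cls_eq cls_mem d_steenrod_supp rho_d)
  moreover have "x \<in> cls x" using assms by (simp add: cls_mem)
  ultimately show ?thesis unfolding d_Gamma_def by blast
qed

abbreviation cocycle_ring :: "smon list lin set ring"
  where "cocycle_ring \<equiv> cocycles cobar_Gamma d_Gamma"

lemma rho_ZT: "x \<in> supp swords \<Longrightarrow> d_Gamma (cls x) = \<zero>\<^bsub>cobar_Gamma\<^esub> \<longleftrightarrow> rho x \<in> ZT"
  by (simp add: d_Gamma_cls cobar_ops(4)[of 0 0] cls_eq d_steenrod_supp rho_d ZT_def rho_supp)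

lemma cocycle_carrier: "carrier cocycle_ring = cls ` {x \<in> supp swords. rho x \<in> ZT}"
  using rho_ZT by (auto simp: cocycles_def cobar_carrier)

lemma cocycle_cls: "x \<in> supp swords \<Longrightarrow> cls x \<in> carrier cocycle_ring \<longleftrightarrow> rho x \<in> ZT"
  using rho_ZT by (auto simp: cocycles_def cobar_carrier)

lemma ZT_closed:
  "z \<in> ZT \<Longrightarrow> z' \<in> ZT \<Longrightarrow> z + z' \<in> ZT" "z \<in> ZT \<Longrightarrow> - z \<in> ZT" "z \<in> ZT \<Longrightarrow> z' \<in> ZT \<Longrightarrow> conc z z' \<in> ZT"
  "basis [] \<in> ZT"
  by (auto simp: ZT_def dT_conc conc_LT) (auto simp: LT_def)

lemma swords_closed: "x \<in> supp swords \<Longrightarrow> y \<in> supp swords \<Longrightarrow> conc x y \<in> supp swords" "basis [] \<in> supp swords"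
  by (auto intro: conc_supp)

lemma cobar_a_inv: "x \<in> supp swords \<Longrightarrow> \<ominus>\<^bsub>cobar_Gamma\<^esub> cls x = cls (- x)"
proof -
  assume x: "x \<in> supp swords"
  interpret ring cobar_Gamma by (rule cobar_ring)
  show ?thesis
    by (rule minus_equality) (use x in \<open>auto simp: cobar_ops[of "- x" x] cobar_ops(4)[of x x] cobar_carrier\<close>)
qed

lemma cocycle_ring: "ring cocycle_ring"
proof -
  interpret ring cobar_Gamma by (rule cobar_ring)
  have "subring (carrier cocycle_ring) cobar_Gamma"
  proof (rule subringI)
    show "carrier cocycle_ring \<subseteq> carrier cobar_Gamma" by (auto simp: cocycles_def)
    show "\<one>\<^bsub>cobar_Gamma\<^esub> \<in> carrier cocycle_ring"
      unfolding cobar_ops(3)[OF swords_closed(2) swords_closed(2)]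
      by (subst cocycle_cls) (simp_all add: swords_closed ZT_closed)
  next
    fix X assume "X \<in> carrier cocycle_ring"
    then obtain x where "X = cls x" "x \<in> supp swords" "rho x \<in> ZT" unfolding cocycle_carrier by blast
    then show "\<ominus>\<^bsub>cobar_Gamma\<^esub> X \<in> carrier cocycle_ring"
      by (simp add: cobar_a_inv cocycle_cls ZT_closed)
  next
    fix X Y assume "X \<in> carrier cocycle_ring" "Y \<in> carrier cocycle_ring"
    then obtain x y where "X = cls x" "x \<in> supp swords" "rho x \<in> ZT" "Y = cls y" "y \<in> supp swords" "rho y \<in> ZT"
      unfolding cocycle_carrier by blast
    then show "X \<otimes>\<^bsub>cobar_Gamma\<^esub> Y \<in> carrier cocycle_ring" "X \<oplus>\<^bsub>cobar_Gamma\<^esub> Y \<in> carrier cocycle_ring"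
      by (simp_all add: cobar_ops cocycle_cls swords_closed rho_conc ZT_closed)
  qed
  then have "ring (cobar_Gamma\<lparr>carrier := carrier cocycle_ring\<rparr>)" by (rule subring_is_ring)
  then show ?thesis by (simp add: cocycles_def)
qed

text \<open>\<open>the_elem\<close> extracts the common value on a coset: by \<open>cls_mem\<close>
  all members have the same image under \<open>rho\<close>.\<close>

definition Theta :: "smon list lin set \<Rightarrow> pmon lin set"
  where "Theta X = the_elem ((\<lambda>x. pcls (th (rho x))) ` X)"

lemma Theta_cls: "x \<in> supp swords \<Longrightarrow> Theta (cls x) = pcls (th (rho x))"
proof -
  assume x: "x \<in> supp swords"
  have "(\<lambda>x. pcls (th (rho x))) ` cls x = {pcls (th (rho x))}"
    using cls_mem[OF x] x by (auto simp: image_iff) 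
  then show ?thesis by (simp add: Theta_def)
qed

lemma Theta_hom: "ring_hom_ring cocycle_ring presentation Theta"
proof (rule ring_hom_ringI[OF cocycle_ring presentation_ring])
  fix X assume "X \<in> carrier cocycle_ring"
  then show "Theta X \<in> carrier presentation"
    unfolding cocycle_carrier by (auto simp: Theta_cls presentation_ops)
next
  fix X Y assume "X \<in> carrier cocycle_ring" "Y \<in> carrier cocycle_ring"
  then obtain x y where xy: "X = cls x" "x \<in> supp swords" "rho x \<in> ZT" "Y = cls y" "y \<in> supp swords" "rho y \<in> ZT"
    unfolding cocycle_carrier by blast
  have ops: "X \<otimes>\<^bsub>cocycle_ring\<^esub> Y = cls (conc x y)" "X \<oplus>\<^bsub>cocycle_ring\<^esub> Y = cls (x + y)"
    using xy by (simp_all add: cocycles_def cobar_ops)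
  show "Theta (X \<otimes>\<^bsub>cocycle_ring\<^esub> Y) = Theta X \<otimes>\<^bsub>presentation\<^esub> Theta Y"
    "Theta (X \<oplus>\<^bsub>cocycle_ring\<^esub> Y) = Theta X \<oplus>\<^bsub>presentation\<^esub> Theta Y"
    unfolding ops using xy th_conc[of "rho x" "rho y"]
    by (simp_all add: Theta_cls swords_closed presentation_ops rho_conc pcls_eq)
next
  have "\<one>\<^bsub>cocycle_ring\<^esub> = cls (basis [])"
    using cobar_ops(3)[OF swords_closed(2) swords_closed(2)] by (simp add: cocycles_def)
  then show "Theta \<one>\<^bsub>cocycle_ring\<^esub> = \<one>\<^bsub>presentation\<^esub>"
    by (simp add: Theta_cls swords_closed th_unit presentation_ops)
qed

lemma Theta_kernel: "a_kernel cocycle_ring presentation Theta = d_Gamma ` carrier cobar_Gamma"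
proof (intro equalityI subsetI)
  fix X assume "X \<in> a_kernel cocycle_ring presentation Theta"
  then have "X \<in> carrier cocycle_ring" "Theta X = \<zero>\<^bsub>presentation\<^esub>"
    by (auto simp: a_kernel_def')
  then obtain x where x: "X = cls x" "x \<in> supp swords" "rho x \<in> ZT" "th (rho x) \<in> rel_ideal"
    unfolding cocycle_carrier by (auto simp: Theta_cls presentation_ops pcls_eq)
  from th_rel_ideal[OF x(3,4)] obtain w where w: "w \<in> supp LT" "rho x = dT w" by blast
  have "X = d_Gamma (cls (sec w))"
    using x w by (simp add: d_Gamma_cls sec_supp cls_eq d_steenrod_supp rho_d)
  then show "X \<in> d_Gamma ` carrier cobar_Gamma"
    using w by (simp add: cobar_carrier sec_supp)
next
  fix X assume "X \<in> d_Gamma ` carrier cobar_Gamma"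
  then obtain w where w: "w \<in> supp swords" "X = cls (d_steenrod w)"
    by (auto simp: cobar_carrier d_Gamma_cls)
  then have "X \<in> carrier cocycle_ring"
    by (simp add: cocycle_cls d_steenrod_supp rho_d ZT_def dT_LT rho_supp)
  moreover have "Theta X = \<zero>\<^bsub>presentation\<^esub>"
    using w by (simp add: Theta_cls d_steenrod_supp rho_d presentation_ops)
  ultimately show "X \<in> a_kernel cocycle_ring presentation Theta"
    by (simp add: a_kernel_def')
qed

lemma Theta_sec_phi: "Theta (cls (sec (phi p))) = pcls p"
  by (simp add: Theta_cls sec_supp phi_LT pcls_eq th_phi)

lemma sec_phi_cocycle: "cls (sec (phi p)) \<in> carrier cocycle_ring"
  by (simp add: cocycle_cls sec_supp phi_LT phi_ZT)

lemma Theta_surj: "Theta ` carrier cocycle_ring = carrier presentation"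
proof (intro equalityI subsetI)
  fix Y assume "Y \<in> carrier presentation"
  then obtain p where "Y = pcls p" by (auto simp: presentation_ops)
  then show "Y \<in> Theta ` carrier cocycle_ring"
    using Theta_sec_phi[of p] sec_phi_cocycle[of p] by force
qed (use ring_hom_ring.homh[OF Theta_hom] in \<open>auto simp: ring_hom_def\<close>)

text \<open>Both directions preserve bidegree: \<open>rho\<close> followed by \<open>th\<close> is
  homogeneous, and \<open>phi\<close> followed by \<open>sec\<close> gives homogeneous
  preimages.\<close>

lemma Theta_cobar_part: "Theta ` (carrier cocycle_ring \<inter> cobar_part s t) = presentation_part s t"
proof (intro equalityI subsetI)
  let ?W = "{w. length w = s \<and> sum_list (map sdeg w) = t}"
  fix Y assume "Y \<in> Theta ` (carrier cocycle_ring \<inter> cobar_part s t)"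
  then obtain x where x: "x \<in> supp swords" "x \<in> supp ?W" "Y = Theta (cls x)"
    by (auto simp: cobar_part_def steenrod_tensor_simps supp_def)
  have "rho x \<in> supp {w. length w = s \<and> wdeg w = t}"
    unfolding rho_def
  proof (rule supp_extend[OF x(2)])
    fix w assume w: "w \<in> ?W"
    have "gdeg (cog m) = sdeg m" if "small m" for m
      using that by (metis iota_cog sdeg_iota)
    then have "wdeg (map cog w) = t" if "\<forall>m\<in>set w. small m"
      using w that by (simp add: wdeg_def comp_def del: small.simps cog.simps cong: map_cong)
    then show "rw w \<in> supp {w. length w = s \<and> wdeg w = t}"
      using w by (simp add: rw.simps del: small.simps cog.simps)
  qed
  from th_deg[OF this] show "Y \<in> presentation_part s t"
    unfolding presentation_part_def rel_ideal_def[symmetric] x(3) Theta_cls[OF x(1)] by (auto simp: supp_def)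
next
  fix Y assume "Y \<in> presentation_part s t"
  then obtain p where p: "p \<in> supp {m. mon_deg poly_s ext_s m = s \<and> mon_deg poly_t ext_t m = t}" "Y = pcls p"
    unfolding presentation_part_def rel_ideal_def[symmetric] by (auto simp: supp_def)
  have "sec (phi p) \<in> supp {w. length w = s \<and> sum_list (map sdeg w) = t}"
    unfolding sec_def
    by (rule supp_extend[OF phi_deg[OF p(1)]], rule supp_closed(6))
      (auto simp: wdeg_def comp_def sdeg_iota simp del: iota.simps)
  then have "cls (sec (phi p)) \<in> cobar_part s t"
    using sec_supp[OF phi_LT[of p]] by (auto simp: cobar_part_def steenrod_tensor_simps supp_def)
  then show "Y \<in> Theta ` (carrier cocycle_ring \<inter> cobar_part s t)"
    using Theta_sec_phi[of p] sec_phi_cocycle[of p] p(2) by force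
qed

theorem corollary3p6:
  shows "\<exists>h \<in> ring_iso presentation Ext_Gamma. \<forall>s t. h ` presentation_part s t = Ext_part s t"
proof -
  interpret Theta: ring_hom_ring cocycle_ring presentation Theta by (rule Theta_hom)
  define H where "H = (\<lambda>X. the_elem (Theta ` X))"
  have Ext: "Ext_Gamma = cocycle_ring Quot (a_kernel cocycle_ring presentation Theta)"
    by (simp add: Ext_Gamma_def cohomology_def Theta_kernel)
  have iso: "H \<in> ring_iso Ext_Gamma presentation"
    unfolding Ext H_def by (rule Theta.FactRing_iso_set[OF Theta_surj])
  have ring: "ring Ext_Gamma"
    unfolding Ext by (rule ideal.quotient_is_ring[OF Theta.kernel_is_ideal])
  have bij: "bij_betw H (carrier Ext_Gamma) (carrier presentation)"
    using iso by (auto simp: ring_iso_def)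
  \<comment> \<open>The first isomorphism theorem yields the map out of Ext; the required
    isomorphism is its inverse.\<close>
  let ?h = "inv_into (carrier Ext_Gamma) H"
  have part: "Ext_part s t = (\<lambda>x. a_kernel cocycle_ring presentation Theta +>\<^bsub>cocycle_ring\<^esub> x) `
      (carrier cocycle_ring \<inter> cobar_part s t)" for s t
    unfolding Ext_part_def Theta_kernel by blast
  have "H ` Ext_part s t = presentation_part s t" for s t
    unfolding part image_image Theta_cobar_part[symmetric]
    by (rule image_cong) (auto simp: H_def)
  moreover have "Ext_part s t \<subseteq> carrier Ext_Gamma" for s t
    unfolding part Ext by (auto simp: FactRing_def A_RCOSETS_def')
  ultimately have "?h ` presentation_part s t = Ext_part s t" for s t
    using inv_into_image_cancel[OF bij_betw_imp_inj_on[OF bij]] by metis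
  moreover have "?h \<in> ring_iso presentation Ext_Gamma"
    by (rule ring_iso_set_sym[OF ring iso])
  ultimately show ?thesis by blast
qed

end
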